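(* Suppose that $p \in P_{3,6}$ and $p \notin \Sigma_{3,6}$. Then there exist two real cubics $q_1,q_2 \in H_{3,3}$ intersecting in $9$ (possibly complex) projective points $\gamma_1,\ldots,\gamma_9 \in \mathbb{CP}^2$ such that the values of $p$ on the $\gamma_i$ certify that $p$ is not a sum of squares. More precisely, let $z_1,\ldots,z_9 \in \mathbb{C}^3$ be affine representatives of $\gamma_1,\ldots,\gamma_9$. Then there exists a real (i.e. real-valued) linear functional $\ell: H_{3,6} \rightarrow \mathbb{R}$ given by $$\ell(f)=\sum_{i=1}^9 \mu_i f(z_i)$$ for some $\mu_i \in \mathbb{C}$, such that $\ell(r) \geq 0$ for all $r \in \Sigma_{3,6}$ and $\ell(p)<0$. Furthermore, at most $2$ of the points $\gamma_i$ are complex (i.e. non-real).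
   Context: $H_{n,d}$ is the real vector space of real forms (homogeneous polynomials) of degree $d$ in $n$ variables. $P_{n,2d}=\{p\in H_{n,2d} : p(x)\ge 0 \text{ for all } x\in\mathbb{R}^n\}$, and $\Sigma_{n,2d}=\{p\in H_{n,2d} : p=\sum_i q_i^2 \text{ (finite sum) for some } q_i\in H_{n,d}\}$. "Intersecting in $9$ projective points" means that the common zero set of $q_1,q_2$ in $\mathbb{CP}^2$ consists of $9$ distinct points. An affine representative of a projective point $\gamma$ is a nonzero vector $z\in\mathbb{C}^n$ spanning the line $\gamma$. A projective point is real if it has a representative in $\mathbb{R}^n$. *)

theory Defs
  imports "HOL-Analysis.Analysis" "HOL-Library.Poly_Mapping"
begin

text \<open>
  Real polynomials are formal ones, with monomials as exponent functions \<open>'n \<Rightarrow>\<^sub>0 nat\<close> on a finite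
  type \<open>'n\<close> of variables, so that the same polynomial can be evaluated at real and at complex
  points; the ring structure, in particular \<open>q\<^sup>2\<close>, is that of \<^theory>\<open>HOL-Library.Poly_Mapping\<close>.
\<close>

type_synonym 'n real_mpoly = "('n \<Rightarrow>\<^sub>0 nat) \<Rightarrow>\<^sub>0 real"

definition monom_degree :: "('n::finite \<Rightarrow>\<^sub>0 nat) \<Rightarrow> nat" where
  "monom_degree m = (\<Sum>i\<in>UNIV. Poly_Mapping.lookup m i)"

definition eval_mpoly :: "'n::finite real_mpoly \<Rightarrow> 'k::real_field ^ 'n \<Rightarrow> 'k" where
  "eval_mpoly f x = (\<Sum>m\<in>Poly_Mapping.keys f.
     of_real (Poly_Mapping.lookup f m) * (\<Prod>i\<in>UNIV. (x $ i) ^ Poly_Mapping.lookup m i))"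

text \<open>The space $H_{n,d}$, with $n$ the cardinality of \<open>'n\<close>; it contains \<open>0\<close>.\<close>

definition forms :: "nat \<Rightarrow> 'n::finite real_mpoly set" where
  "forms d = {f. \<forall>m\<in>Poly_Mapping.keys f. monom_degree m = d}"

text \<open>The cones $P_{n,2d}$ and $\Sigma_{n,2d}$. The argument is \<open>d\<close>, half the degree of the members.\<close>

definition psd_forms :: "nat \<Rightarrow> 'n::finite real_mpoly set" where
  "psd_forms d = {p \<in> forms (2 * d). \<forall>x :: real ^ 'n. eval_mpoly p x \<ge> 0}"

definition sos_forms :: "nat \<Rightarrow> 'n::finite real_mpoly set" where
  "sos_forms d = {p \<in> forms (2 * d).
     \<exists>(k::nat) q. (\<forall>i<k. q i \<in> forms d) \<and> p = (\<Sum>i<k. (q i)\<^sup>2)}"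

definition linear_functional_on :: "'n real_mpoly set \<Rightarrow> ('n real_mpoly \<Rightarrow> real) \<Rightarrow> bool" where
  "linear_functional_on V l \<longleftrightarrow>
     (\<forall>f\<in>V. \<forall>g\<in>V. l (f + g) = l f + l g) \<and>
     (\<forall>c. \<forall>f\<in>V. l (Poly_Mapping.map ((*) c) f) = c * l f)"

text \<open>A projective point is a complex line through the origin.\<close>

definition affine_rep :: "complex ^ 'n \<Rightarrow> (complex ^ 'n) set \<Rightarrow> bool" where
  "affine_rep z \<gamma> \<longleftrightarrow> z \<noteq> 0 \<and> \<gamma> = vec.span {z}"

definition proj_space :: "(complex ^ 'n) set set" where
  "proj_space = {\<gamma>. \<exists>z. affine_rep z \<gamma>}"

definition real_proj_point :: "(complex ^ 'n) set \<Rightarrow> bool" where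
  "real_proj_point \<gamma> \<longleftrightarrow> (\<exists>x :: real ^ 'n. affine_rep (\<chi> i. complex_of_real (x $ i)) \<gamma>)"

definition common_zeros ::
    "'n::finite real_mpoly \<Rightarrow> 'n real_mpoly \<Rightarrow> (complex ^ 'n) set set" where
  "common_zeros q1 q2 =
     {\<gamma> \<in> proj_space. \<forall>z\<in>\<gamma>. eval_mpoly q1 z = 0 \<and> eval_mpoly q2 z = 0}"

end

theory Submission
  imports Defs "HOL-Library.Function_Algebras" "HOL-Computational_Algebra.Polynomial_Factorial"
    "HOL-Computational_Algebra.Field_as_Ring" "HOL-Computational_Algebra.Fundamental_Theorem_Algebra"
begin

text \<open>
  Write \<open>l\<close> for a linear functional on real sextics, and call the cubics \<open>q\<close> with \<open>l (q r) = 0\<close>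
  for all cubics \<open>r\<close> the kernel of \<open>l\<close>. The cone of sums of squares is closed, so some \<open>l\<close> is
  nonnegative on it and negative at \<open>p\<close>; on cubics, \<open>l (q\<^sup>2)\<close> is then a positive semidefinite
  quadratic form with the same kernel. Among all such \<open>l\<close>, take one whose kernel has the largest
  dimension. Its kernel has no common complex zero. Indeed, if \<open>z\<close> were one, then for suitable
  \<open>\<eta>\<close> the functional \<open>f \<mapsto> Re (\<eta> f(z))\<close> is nonpositive at \<open>p\<close> and negative on some square
  (\<open>test_cubic\<close>, which uses \<open>p \<ge> 0\<close>), and it vanishes on all products with a kernel cubic.
  Adding it to \<open>l\<close> up to the boundary of the semidefinite cone enlarges the kernel
  (\<open>psd_perturb_to_boundary\<close>), which contradicts maximality (\<open>separating_functional_base_free\<close>).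

  A base point free system of cubics contains three members \<open>w1, w2, w3\<close> without common zero,
  and the map \<open>w\<close> that they define is a finite map from the projective plane to itself. The
  common zeros of a pencil in the net of the \<open>w\<^sub>i\<close> form the fibre of \<open>w\<close> over a point \<open>c\<close>. The
  pencil has no zero on the line \<open>X3 = 0\<close> and only transversal zeros as soon as \<open>c\<close> avoids two
  curves, which contain the images under \<open>w\<close> of that line and of the ramification locus; real
  points are dense, so a real \<open>c\<close> can be chosen (\<open>generic_transversal_pencil\<close>). Both curves are
  found by counting coefficients (\<open>image_of_infinity\<close>, \<open>image_of_ramification\<close>). The second
  count requires that the Jacobian of \<open>w\<close> is not identically zero; otherwise its cofactors would
  define a derivation that preserves the ideal of every pencil in the net, and such a derivation
  vanishes at all zeros of the pencil (\<open>derivation_vanishes\<close>, \<open>jacobian_nonzero\<close>).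

  For a pencil \<open>q1, q2\<close> that is free of zeros on \<open>X3 = 0\<close> and transversal, the classical theory
  is available: a form of degree at least four that vanishes at all common zeros lies in the
  ideal of the pencil (\<open>max_noether\<close>), there are exactly nine zeros (\<open>card_zeros\<close>), and a cubic
  through eight of them belongs to the pencil (\<open>cayley_bacharach\<close>). The first statement comes
  from a Nullstellensatz (\<open>ideal_separating_zero\<close>): modulo the ideal and up to powers of \<open>X3\<close>,
  every form reduces to a quartic, so multiplications by \<open>X1\<close> and \<open>X2\<close> act as on a
  finite-dimensional space, and a common eigenvector exhibits a common zero.

  Since \<open>q1\<close> and \<open>q2\<close> lie in the kernel, \<open>l\<close> vanishes on the sextic part of their ideal, which
  by \<open>max_noether\<close> consists of the sextics that vanish at the nine points. Thus \<open>l\<close> is a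
  combination of evaluations at these points (\<open>representation_exists\<close>). The weights can be taken
  invariant under complex conjugation. By Cayley-Bacharach a cubic can be prescribed at any
  eight of the nine points. If a nonreal point had weight zero, this would force all nonreal
  weights to vanish and all real weights to be nonnegative, hence \<open>l p \<ge> 0\<close> (\<open>weight_nonzero\<close>).
  As nine is odd, one of the points is real; with two pairs of nonreal points of nonzero weight,
  there would be a real cubic that vanishes at the other five points, the real one included,
  with \<open>l (g\<^sup>2) < 0\<close> (\<open>card_nonreal_le_2\<close>).
\<close>

section \<open>Underdetermined linear systems\<close>

text \<open>Gaussian elimination, one equation at a time. It replaces dimension theory in all the
  counting arguments below, where unknowns and equations come as index sets rather than as
  spaces.\<close>

lemma underdetermined_system:
  fixes a :: "'s \<Rightarrow> 'e \<Rightarrow> 'k::field"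
  assumes "finite E" "finite S" "card E < card S"
  shows "\<exists>c. (\<exists>s\<in>S. c s \<noteq> 0) \<and> (\<forall>e\<in>E. (\<Sum>s\<in>S. c s * a s e) = 0)"
  using assms
proof (induction E arbitrary: S a rule: finite_induct)
  case empty
  then obtain s where "s \<in> S" by (metis card.empty card_gt_0_iff ex_in_conv)
  then show ?case by (intro exI[of _ "\<lambda>_. 1"]) auto
next
  case (insert e E)
  show ?case
  proof (cases "\<exists>t\<in>S. a t e \<noteq> 0")
    case False
    from insert.IH[of S a] insert.prems insert.hyps obtain c where
      "\<exists>s\<in>S. c s \<noteq> 0" "\<forall>e\<in>E. (\<Sum>s\<in>S. c s * a s e) = 0" by auto
    with False show ?thesis by (intro exI[of _ c]) auto
  next
    case True
    then obtain t where t: "t \<in> S" "a t e \<noteq> 0" by blast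
    define S' where "S' = S - {t}"
    define a' where "a' s f = a s f - a s e / a t e * a t f" for s f
    have fS': "finite S'" and tS': "t \<notin> S'" and SS': "S = insert t S'" using insert.prems t by (auto simp: S'_def)
    have "card E < card S'" using insert.prems insert.hyps t by (simp add: S'_def)
    from insert.IH[OF fS' this, of a'] obtain c where
      c: "\<exists>s\<in>S'. c s \<noteq> 0" "\<forall>f\<in>E. (\<Sum>s\<in>S'. c s * a' s f) = 0" by auto
    define d where "d s = (if s = t then - (\<Sum>u\<in>S'. c u * a u e) / a t e else c s)" for s
    have sm: "(\<Sum>s\<in>S. d s * a s f) = d t * a t f + (\<Sum>s\<in>S'. c s * a s f)" for f
    proof -
      have "(\<Sum>s\<in>S'. d s * a s f) = (\<Sum>s\<in>S'. c s * a s f)"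
        using tS' by (intro sum.cong) (auto simp: d_def)
      then show ?thesis using fS' tS' by (simp add: SS')
    qed
    have "d t * a t e + (\<Sum>s\<in>S'. c s * a s e) = 0" using t by (simp add: d_def)
    then have "(\<Sum>s\<in>S. d s * a s e) = 0" by (simp only: sm)
    moreover have "(\<Sum>s\<in>S. d s * a s f) = 0" if "f \<in> E" for f
    proof -
      have "0 = (\<Sum>s\<in>S'. c s * a' s f)" using c that by simp
      also have "\<dots> = (\<Sum>s\<in>S'. c s * a s f) - (\<Sum>s\<in>S'. c s * a s e) / a t e * a t f"
        by (simp add: a'_def algebra_simps sum_subtractf sum_distrib_left sum_distrib_right sum_divide_distrib)
      finally have "d t * a t f + (\<Sum>s\<in>S'. c s * a s f) = 0" by (simp add: d_def algebra_simps)
      then show ?thesis by (simp only: sm)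
    qed
    moreover have "\<exists>s\<in>S. d s \<noteq> 0" using c(1) tS' SS' by (auto simp: d_def)
    ultimately show ?thesis by blast
  qed
qed

section \<open>Complex ternary forms as functions\<close>

lemma power_fun_apply [simp]: "(f ^ n) x = (f x :: 'a::monoid_mult) ^ n"
  by (induction n) auto

lemma sum_fun_apply [simp]: "(\<Sum>i\<in>A. f i) x = (\<Sum>i\<in>A. f i x :: 'a::comm_monoid_add)"
  by (induction A rule: infinite_finite_induct) auto

lemma minus_fun_apply' [simp]: "(f - g) x = (f x - g x :: 'a::ab_group_add)"
  by (simp add: fun_diff_def)

definition point :: "'a \<Rightarrow> 'a \<Rightarrow> 'a \<Rightarrow> 'a::zero ^ 3" where "point x y z = vector [x, y, z]"

lemma point_nth [simp]: "point x y z $ 1 = x" "point x y z $ 2 = y" "point x y z $ 3 = z"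
  by (simp_all add: point_def vector_3)

lemma point_eta: "point (v$1) (v$2) (v$3) = v"
  by (simp add: vec_eq_iff forall_3)

lemma point_eqI: "v$1 = x \<Longrightarrow> v$2 = y \<Longrightarrow> v$3 = z \<Longrightarrow> v = point x y z"
  by (simp add: vec_eq_iff forall_3)

definition mon :: "nat \<times> nat \<times> nat \<Rightarrow> complex ^ 3 \<Rightarrow> complex" where
  "mon m v = v$1 ^ fst m * v$2 ^ fst (snd m) * v$3 ^ snd (snd m)"

definition mons :: "nat \<Rightarrow> (nat \<times> nat \<times> nat) set" where
  "mons d = {(i, j, k). i + j + k = d}"

text \<open>Forms are functions here, so that sums, products, composition with a map and evaluation
  need no further apparatus. The encoding loses nothing, since the coefficients can be recovered
  (\<open>cform_coeffs_unique\<close>).\<close>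

definition cform :: "nat \<Rightarrow> (complex ^ 3 \<Rightarrow> complex) set" where
  "cform d = {f. \<exists>c. f = (\<lambda>v. \<Sum>m\<in>mons d. c m * mon m v)}"

definition cst :: "complex \<Rightarrow> complex ^ 3 \<Rightarrow> complex" where "cst c = (\<lambda>_. c)"

lemma cst_apply [simp]: "cst c v = c" by (simp add: cst_def)

definition X1 :: "complex ^ 3 \<Rightarrow> complex" where "X1 v = v $ 1"
definition X2 :: "complex ^ 3 \<Rightarrow> complex" where "X2 v = v $ 2"
definition X3 :: "complex ^ 3 \<Rightarrow> complex" where "X3 v = v $ 3"

lemma mons_eq: "mons d = (\<lambda>(i, j). (i, j, d - i - j)) ` (SIGMA i:{..d}. {..d - i})"
proof -
  have "x \<in> (\<lambda>(i, j). (i, j, d - i - j)) ` (SIGMA i:{..d}. {..d - i})" if "x \<in> mons d" for x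
    using that by (intro image_eqI[of _ _ "(fst x, fst (snd x))"]) (auto simp: mons_def)
  then show ?thesis by (auto simp: mons_def)
qed

lemma finite_mons [simp]: "finite (mons d)"
  by (simp add: mons_eq)

lemma card_mons: "2 * card (mons d) = (d + 1) * (d + 2)"
proof -
  have "inj_on (\<lambda>(i, j). (i, j, d - i - j)) (SIGMA i:{..d}. {..d - i})" by (auto simp: inj_on_def)
  then have "card (mons d) = (\<Sum>i\<le>d. Suc (d - i))" by (simp add: mons_eq card_image)
  also have "\<dots> = (\<Sum>i\<le>d. Suc i)" 
    by (rule sum.reindex_bij_witness[of _ "\<lambda>i. d - i" "\<lambda>i. d - i"]) auto
  finally have "card (mons d) = (\<Sum>i\<le>d. Suc i)" .
  moreover have "2 * (\<Sum>i\<le>d. Suc i) = (d + 1) * (d + 2)" by (induction d) auto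
  ultimately show ?thesis by simp
qed

lemma mons_add: "m \<in> mons d \<Longrightarrow> n \<in> mons e \<Longrightarrow>
   (fst m + fst n, fst (snd m) + fst (snd n), snd (snd m) + snd (snd n)) \<in> mons (d + e)"
  by (auto simp: mons_def)

lemma mon_mult: "mon m v * mon n v =
   mon (fst m + fst n, fst (snd m) + fst (snd n), snd (snd m) + snd (snd n)) v"
  by (simp add: mon_def power_add)

lemma cformE: assumes "f \<in> cform d" obtains c where "f = (\<lambda>v. \<Sum>m\<in>mons d. c m * mon m v)"
  using assms by (auto simp: cform_def)

lemma cform_0 [simp]: "0 \<in> cform d"
  unfolding cform_def by (intro CollectI exI[of _ "\<lambda>_. 0"]) (auto simp: fun_eq_iff)

lemma cform_add [simp]: assumes "f \<in> cform d" "g \<in> cform d" shows "f + g \<in> cform d"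
proof -
  obtain a b where "f = (\<lambda>v. \<Sum>m\<in>mons d. a m * mon m v)" "g = (\<lambda>v. \<Sum>m\<in>mons d. b m * mon m v)"
    using assms by (auto simp: cform_def)
  then have "f + g = (\<lambda>v. \<Sum>m\<in>mons d. (a m + b m) * mon m v)"
    by (auto simp: fun_eq_iff sum.distrib algebra_simps)
  then show ?thesis unfolding cform_def by (intro CollectI exI)
qed

lemma cform_scale [simp]: assumes "f \<in> cform d" shows "cst c * f \<in> cform d"
proof -
  obtain a where "f = (\<lambda>v. \<Sum>m\<in>mons d. a m * mon m v)"
    using assms by (auto simp: cform_def)
  then have "cst c * f = (\<lambda>v. \<Sum>m\<in>mons d. (c * a m) * mon m v)"
    by (auto simp: fun_eq_iff sum_distrib_left algebra_simps)
  then show ?thesis unfolding cform_def by (intro CollectI exI)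
qed

lemma cform_uminus [simp]: "f \<in> cform d \<Longrightarrow> - f \<in> cform d"
proof -
  assume "f \<in> cform d"
  then have "cst (-1) * f \<in> cform d" by (rule cform_scale)
  also have "cst (-1) * f = - f" by (auto simp: fun_eq_iff)
  finally show ?thesis .
qed

lemma cform_diff [simp]: "f \<in> cform d \<Longrightarrow> g \<in> cform d \<Longrightarrow> f - g \<in> cform d"
  using cform_add[of f d "- g"] cform_uminus[of g d] by simp

lemma cform_sum [simp]: "(\<And>i. i \<in> A \<Longrightarrow> f i \<in> cform d) \<Longrightarrow> (\<Sum>i\<in>A. f i) \<in> cform d"
  by (induction A rule: infinite_finite_induct) (simp_all del: sum_fun_apply)

lemma cform_mon: assumes "m \<in> mons d" shows "mon m \<in> cform d"
proof -
  have "mon m = (\<lambda>v. \<Sum>n\<in>mons d. (if n = m then 1 else 0) * mon n v)"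
    using assms by (auto simp: if_distrib[of "\<lambda>x. x * _"] cong: if_cong)
  then show ?thesis unfolding cform_def by (intro CollectI exI)
qed

lemma cform_sum_mon: "f \<in> cform d \<Longrightarrow> \<exists>c. f = (\<Sum>m\<in>mons d. cst (c m) * mon m)"
  by (erule cformE) (auto simp: fun_eq_iff)

lemma cform_induct [consumes 1, case_names zero add mon]:
  assumes "f \<in> cform d" "P 0" "\<And>f g. P f \<Longrightarrow> P g \<Longrightarrow> P (f + g)"
    "\<And>c m. m \<in> mons d \<Longrightarrow> P (cst c * mon m)"
  shows "P f"
proof -
  obtain c where f: "f = (\<Sum>m\<in>mons d. cst (c m) * mon m)" using assms(1) cform_sum_mon by blast
  have "P (\<Sum>m\<in>A. cst (c m) * mon m)" if "finite A" "A \<subseteq> mons d" for A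
    using that by (induction A rule: finite_induct) (use assms in auto)
  then show ?thesis using f by simp
qed

lemma cform_mult_mon:
  assumes "m \<in> mons d" "g \<in> cform e" shows "cst c * mon m * g \<in> cform (d + e)"
proof -
  obtain b where g: "g = (\<Sum>n\<in>mons e. cst (b n) * mon n)" using assms(2) cform_sum_mon by blast
  have "cst c * mon m * (cst (b n) * mon n) \<in> cform (d + e)" if n: "n \<in> mons e" for n
  proof -
    let ?k = "(fst m + fst n, fst (snd m) + fst (snd n), snd (snd m) + snd (snd n))"
    have "cst c * mon m * (cst (b n) * mon n) = cst (c * b n) * mon ?k"
      by (auto simp: fun_eq_iff mon_mult[symmetric])
    then show ?thesis by (simp only: cform_scale cform_mon mons_add assms n)
  qed
  then show ?thesis unfolding g sum_distrib_left by (intro cform_sum)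
qed

lemma cform_mult [simp]: assumes "f \<in> cform d" "g \<in> cform e" shows "f * g \<in> cform (d + e)"
proof -
  obtain c where f: "f = (\<Sum>m\<in>mons d. cst (c m) * mon m)" using assms(1) cform_sum_mon by blast
  show ?thesis unfolding f sum_distrib_right by (intro cform_sum cform_mult_mon assms(2))
qed

lemma cform_mult': "f \<in> cform d \<Longrightarrow> g \<in> cform e \<Longrightarrow> n = d + e \<Longrightarrow> f * g \<in> cform n"
  by simp

lemma cform_cst [simp]: "cst c \<in> cform 0"
proof -
  have "cst c * mon (0,0,0) \<in> cform 0" by (intro cform_scale cform_mon) (auto simp: mons_def)
  also have "cst c * mon (0,0,0) = cst c" by (auto simp: fun_eq_iff mon_def)
  finally show ?thesis .
qed

lemma cform_1 [simp]: "1 \<in> cform 0"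
  using cform_cst[of 1] by (simp add: one_fun_def cst_def)

lemma cform_X [simp]: "X1 \<in> cform 1" "X2 \<in> cform 1" "X3 \<in> cform 1"
proof -
  have "mon (1,0,0) \<in> cform 1" "mon (0,1,0) \<in> cform 1" "mon (0,0,1) \<in> cform 1"
    by (intro cform_mon; simp add: mons_def)+
  moreover have "mon (1,0,0) = X1" "mon (0,1,0) = X2" "mon (0,0,1) = X3"
    by (auto simp: fun_eq_iff mon_def X1_def X2_def X3_def)
  ultimately show "X1 \<in> cform 1" "X2 \<in> cform 1" "X3 \<in> cform 1" by simp_all
qed

lemma cform_power: "f \<in> cform d \<Longrightarrow> f ^ n \<in> cform (n * d)"
  by (induction n) auto

lemma cform_X_power [simp]: "X1 ^ n \<in> cform n" "X2 ^ n \<in> cform n" "X3 ^ n \<in> cform n"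
  using cform_power[OF cform_X(1), of n] cform_power[OF cform_X(2), of n] cform_power[OF cform_X(3), of n] by simp_all

lemma mon_eq_X: "mon m = X1 ^ fst m * X2 ^ fst (snd m) * X3 ^ snd (snd m)"
  by (auto simp: fun_eq_iff mon_def X1_def X2_def X3_def)

lemma cform_scaleC: assumes "f \<in> cform d" shows "f (t *s v) = t ^ d * f v"
  using assms
  by (induction rule: cform_induct)
     (auto simp: mon_def mons_def algebra_simps power_mult_distrib power_add)

lemma cform_Suc_split:
  assumes "f \<in> cform (Suc d)"
  shows "\<exists>f1\<in>cform d. \<exists>f2\<in>cform d. \<exists>f3\<in>cform d. f = X1 * f1 + X2 * f2 + X3 * f3"
  using assms
proof (induction rule: cform_induct)
  case zero
  show ?case by (intro bexI[of _ 0]) auto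
next
  case (add f g)
  then obtain f1 f2 f3 g1 g2 g3 where 
    "f1\<in>cform d" "f2\<in>cform d" "f3\<in>cform d" "f = X1 * f1 + X2 * f2 + X3 * f3"
    "g1\<in>cform d" "g2\<in>cform d" "g3\<in>cform d" "g = X1 * g1 + X2 * g2 + X3 * g3" by blast
  then show ?case
    by (intro bexI[of _ "f1 + g1"] bexI[of _ "f2 + g2"] bexI[of _ "f3 + g3"]) (auto simp: algebra_simps)
next
  case (mon c m)
  obtain i j k where m: "m = (i, j, k)" by (cases m)
  have s: "i + j + k = Suc d" using mon by (simp add: m mons_def)
  consider i' where "i = Suc i'" | j' where "j = Suc j'" | k' where "k = Suc k'"
    using s by (cases i; cases j; cases k) auto
  then show ?case
  proof cases
    case 1
    have "cst c * mon (i', j, k) \<in> cform d" using s 1 by (intro cform_scale cform_mon) (auto simp: mons_def)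
    then show ?thesis using 1 m
      by (intro bexI[of _ "cst c * mon (i', j, k)"] bexI[of _ 0]) (auto simp: mon_eq_X algebra_simps)
  next
    case 2
    have "cst c * mon (i, j', k) \<in> cform d" using s 2 by (intro cform_scale cform_mon) (auto simp: mons_def)
    then show ?thesis using 2 m
      by (intro bexI[of _ 0] bexI[of _ "cst c * mon (i, j', k)"]) (auto simp: mon_eq_X algebra_simps)
  next
    case 3
    have "cst c * mon (i, j, k') \<in> cform d" using s 3 by (intro cform_scale cform_mon) (auto simp: mons_def)
    then show ?thesis using 3 m
      by (intro bexI[of _ 0] bexI[of _ "cst c * mon (i, j, k')"]) (auto simp: mon_eq_X algebra_simps)
  qed
qed

text \<open>Restriction to a line reduces questions about vanishing to polynomials in one variable.\<close>

lemma cform_line_poly: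
  assumes "f \<in> cform d"
  shows "\<exists>p. degree p \<le> d \<and> (\<forall>t. f (u + t *s v) = poly p t)"
  using assms
proof (induction rule: cform_induct)
  case (add f g)
  then obtain p q where "degree p \<le> d" "\<forall>t. f (u + t *s v) = poly p t" 
     "degree q \<le> d" "\<forall>t. g (u + t *s v) = poly q t" by blast
  then show ?case by (intro exI[of _ "p + q"]) (auto intro: degree_add_le)
next
  case (mon c m)
  obtain i j k where m: "m = (i, j, k)" by (cases m)
  define p where "p = smult c ([:u$1, v$1:] ^ i * [:u$2, v$2:] ^ j * [:u$3, v$3:] ^ k)"
  have *: "degree ([:a, b:] ^ n) \<le> n" for a b :: complex and n
    by (rule order.trans[OF degree_power_le]) auto
  have "degree p \<le> i + j + k" unfolding p_def
    by (intro order.trans[OF degree_smult_le] order.trans[OF degree_mult_le] add_mono *)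
  then show ?case using mon by (intro exI[of _ p]) (auto simp: m mons_def p_def mon_def)
qed (auto intro!: exI[of _ 0])

text \<open>Restrict to the line through a point where \<open>f\<close> is nonzero and one where \<open>g\<close> is.\<close>

lemma cform_mult_eq_0:
  assumes "f \<in> cform d" "g \<in> cform e" "f * g = 0"
  shows "f = 0 \<or> g = 0"
proof (rule ccontr)
  assume "\<not> ?thesis"
  then obtain u v where uv: "f u \<noteq> 0" "g v \<noteq> 0" by (auto simp: fun_eq_iff)
  obtain p where p: "\<forall>t. f (u + t *s (v - u)) = poly p t" using cform_line_poly[OF assms(1)] by blast
  obtain q where q: "\<forall>t. g (u + t *s (v - u)) = poly q t" using cform_line_poly[OF assms(2)] by blast
  have "poly (p * q) t = 0" for t
    using p q assms(3) by (metis poly_mult times_fun_apply zero_fun_apply)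
  then have "p * q = 0" using poly_all_0_iff_0 by blast
  moreover have "p \<noteq> 0" using p[rule_format, of 0] uv by auto
  moreover have "q \<noteq> 0" using q[rule_format, of 1] uv by (auto simp: vector_smult_lid)
  ultimately show False by auto
qed

lemma cform_cancel: "h \<in> cform e \<Longrightarrow> h \<noteq> 0 \<Longrightarrow> f \<in> cform d \<Longrightarrow> g \<in> cform d \<Longrightarrow> h * f = h * g \<Longrightarrow> f = g"
  using cform_mult_eq_0[of h e "f - g" d] by (auto simp: algebra_simps)

lemma X_neq_0 [simp]: "X1 \<noteq> 0" "X2 \<noteq> 0" "X3 \<noteq> 0"
  by (auto simp: fun_eq_iff X1_def X2_def X3_def intro!: exI[of _ "point 1 1 1"])

definition cvec :: "real ^ 3 \<Rightarrow> complex ^ 3" where "cvec x = (\<chi> i. complex_of_real (x $ i))"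

lemma poly_real_roots_0:
  fixes p :: "complex poly" assumes "\<And>t::real. poly p (of_real t) = 0" shows "p = 0"
proof (rule ccontr)
  assume "p \<noteq> 0"
  then have "finite {x. poly p x = 0}" by (rule poly_roots_finite)
  moreover have "range complex_of_real \<subseteq> {x. poly p x = 0}" using assms by auto
  ultimately have "finite (range complex_of_real)" by (rule finite_subset[rotated])
  then have "finite (UNIV :: real set)" by (rule finite_imageD) (auto intro: inj_onI)
  then show False using infinite_UNIV_char_0 by blast
qed

text \<open>Real points are Zariski dense: a polynomial in one variable that vanishes on the real line
  is zero, and the three coordinates can be made complex one after the other.\<close>

lemma cform_real_nonzero:
  assumes "f \<in> cform d" "f \<noteq> 0"
  shows "\<exists>x. f (cvec x) \<noteq> 0"
proof (rule ccontr)
  assume "\<not> ?thesis"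
  then have r: "f (cvec x) = 0" for x by auto
  have line0: "point x y z + t *s point 1 0 0 = point (x + t) y z" "point x y z + t *s point 0 1 0 = point x (y + t) z"
    "point x y z + t *s point 0 0 1 = point x y (z + t)" for x y z t :: complex
    by (rule point_eqI; simp)+
  have 0: "f (point (of_real a) (of_real b) (of_real c)) = 0" for a b c
  proof -
    have "cvec (point a b c) = point (of_real a) (of_real b) (of_real c)" by (rule point_eqI) (simp_all add: cvec_def)
    then show ?thesis using r[of "point a b c"] by simp
  qed
  have line: "f (u + t *s v) = 0" if "\<And>s::real. f (u + of_real s *s v) = 0" for u v t
  proof -
    obtain p where p: "\<forall>t. f (u + t *s v) = poly p t" using cform_line_poly[OF assms(1)] by blast
    have "p = 0" by (rule poly_real_roots_0) (use that p in metis)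
    then show ?thesis using p by simp
  qed
  have 1: "f (point x (of_real b) (of_real c)) = 0" for x b c
    using line[of "point 0 (of_real b) (of_real c)" "point 1 0 0" x] 0  by (simp add: line0)
  have 2: "f (point x y (of_real c)) = 0" for x y c
    using line[of "point x 0 (of_real c)" "point 0 1 0" y] 1 by (simp add: line0)
  have 3: "f (point x y z) = 0" for x y z
    using line[of "point x y 0" "point 0 0 1" z] 2 by (simp add: line0)
  have "f = 0" using 3 by (metis ext point_eta zero_fun_apply)
  then show False using assms by blast
qed

text \<open>Kronecker substitution: on the curve \<open>(t, t\<^bsup>d+1\<^esup>, 1)\<close> distinct monomials of degree \<open>d\<close>
  become distinct powers of \<open>t\<close>.\<close>

lemma cform_coeffs_unique:
  assumes "(\<Sum>m\<in>mons d. cst (c m) * mon m) = 0" "m \<in> mons d"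
  shows "c m = 0"
proof -
  \<comment> \<open>The base \<open>d + 1\<close> exceeds every exponent, so \<open>e\<close> determines the monomial.\<close>
  define e where "e m = fst m + Suc d * fst (snd m)" for m :: "nat \<times> nat \<times> nat"
  have inj: "inj_on e (mons d)"
  proof (rule inj_onI)
    fix m n assume m: "m \<in> mons d" and n: "n \<in> mons d" and eq: "e m = e n"
    have lt: "fst m < Suc d" "fst n < Suc d" using m n by (auto simp: mons_def)
    have "e m mod Suc d = fst m" "e n mod Suc d = fst n" 
      using lt mod_mult_self2[of "fst m" "Suc d"] mod_mult_self2[of "fst n" "Suc d"] unfolding e_def by (metis mod_less)+
    moreover have "e m div Suc d = fst (snd m)" "e n div Suc d = fst (snd n)" 
      using lt unfolding e_def by (metis div_mult_self2 div_less add_0_left add_0_right nat.distinct(1))+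
    ultimately have "fst m = fst n" "fst (snd m) = fst (snd n)" using eq by metis+
    then show "m = n" using m n by (auto simp: mons_def)
  qed
  define p where "p = (\<Sum>m\<in>mons d. monom (c m) (e m))"
  have "poly p t = (\<Sum>m\<in>mons d. cst (c m) * mon m) (point t (t ^ Suc d) 1)" for t
    by (simp add: p_def poly_sum poly_monom mon_def e_def power_add power_mult power_mult_distrib)
  then have "\<And>t. poly p t = 0" using assms(1) by simp
  then have "p = 0" using poly_all_0_iff_0 by blast
  then have "0 = coeff p (e m)" by simp
  also have "\<dots> = (\<Sum>n\<in>mons d. if n = m then c n else 0)"
    unfolding p_def coeff_sum by (intro sum.cong) (use inj assms(2) in \<open>auto simp: inj_on_def\<close>)
  also have "\<dots> = c m" using assms(2) by simp
  finally show ?thesis by simp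
qed

lemma dependent_forms:
  assumes fin: "finite S" and F: "\<And>s. s \<in> S \<Longrightarrow> F s \<in> cform d" and card: "card (mons d) < card S"
  shows "\<exists>c. (\<exists>s\<in>S. c s \<noteq> 0) \<and> (\<Sum>s\<in>S. cst (c s) * F s) = 0"
proof -
  have "\<forall>s. \<exists>c. s \<in> S \<longrightarrow> F s = (\<Sum>m\<in>mons d. cst (c m) * mon m)" using cform_sum_mon[OF F] by blast
  from choice[OF this] obtain a where a: "\<And>s. s \<in> S \<Longrightarrow> F s = (\<Sum>m\<in>mons d. cst (a s m) * mon m)" by blast
  from underdetermined_system[OF _ fin card, of a] obtain c where
    c: "\<exists>s\<in>S. c s \<noteq> 0" "\<And>m. m \<in> mons d \<Longrightarrow> (\<Sum>s\<in>S. c s * a s m) = 0" by auto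
  have "(\<Sum>s\<in>S. cst (c s) * F s) = (\<Sum>s\<in>S. \<Sum>m\<in>mons d. cst (c s * a s m) * mon m)"
    by (intro sum.cong refl) (simp add: a fun_eq_iff sum_distrib_left mult.assoc)
  also have "\<dots> = (\<Sum>m\<in>mons d. \<Sum>s\<in>S. cst (c s * a s m) * mon m)" by (rule sum.swap)
  also have "\<dots> = (\<Sum>m\<in>mons d. cst (\<Sum>s\<in>S. c s * a s m) * mon m)" by (simp add: fun_eq_iff sum_distrib_right)
  also have "\<dots> = 0" using c(2) by (simp add: fun_eq_iff)
  finally show ?thesis using c(1) by blast
qed

text \<open>A form is sought that vanishes on \<open>T\<close> and whose coefficient vector is orthogonal, for the
  Hermitian product, to those of the \<open>b\<^sub>i\<close>. These are fewer conditions than coefficients. A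
  nonzero vector orthogonal to a family is not in its span.\<close>

lemma form_outside_span:
  assumes T: "finite T" and I: "finite I" "\<And>i. i \<in> I \<Longrightarrow> b i \<in> cform d"
    and card: "card T + card I < card (mons d)"
  shows "\<exists>f\<in>cform d. (\<forall>P\<in>T. f P = 0) \<and> (\<forall>x. f \<noteq> (\<Sum>i\<in>I. cst (x i) * b i))"
proof -
  have "\<forall>i. \<exists>c. i \<in> I \<longrightarrow> b i = (\<Sum>m\<in>mons d. cst (c m) * mon m)" using cform_sum_mon[OF I(2)] by blast
  from choice[OF this] obtain u where u: "\<And>i. i \<in> I \<Longrightarrow> b i = (\<Sum>m\<in>mons d. cst (u i m) * mon m)" by blast
  define E where "E = Inl ` T \<union> Inr ` I"
  define M where "M m e = (case e of Inl P \<Rightarrow> mon m P | Inr i \<Rightarrow> cnj (u i m))" for m e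
  have fE: "finite E" using T I by (simp add: E_def)
  have "card E = card T + card I"
    unfolding E_def using T I by (subst card_Un_disjoint) (auto simp: card_image)
  with card have "card E < card (mons d)" by simp
  from underdetermined_system[OF fE _ this, of M] obtain c where
    c: "\<exists>m\<in>mons d. c m \<noteq> 0" "\<And>e. e \<in> E \<Longrightarrow> (\<Sum>m\<in>mons d. c m * M m e) = 0" by auto
  define f where "f = (\<Sum>m\<in>mons d. cst (c m) * mon m)"
  have "f \<in> cform d" unfolding f_def by (intro cform_sum cform_scale cform_mon)
  moreover have "f P = 0" if "P \<in> T" for P
    using c(2)[of "Inl P"] that by (simp add: E_def M_def f_def)
  moreover have "f \<noteq> (\<Sum>i\<in>I. cst (x i) * b i)" for x
  proof
    assume fx: "f = (\<Sum>i\<in>I. cst (x i) * b i)"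
    have cu: "(\<Sum>m\<in>mons d. c m * cnj (u i m)) = 0" if "i \<in> I" for i
      using c(2)[of "Inr i"] that by (simp add: E_def M_def)
    have "(\<Sum>i\<in>I. cst (x i) * b i) = (\<Sum>i\<in>I. \<Sum>m\<in>mons d. cst (x i * u i m) * mon m)"
      by (intro sum.cong refl) (simp add: u fun_eq_iff sum_distrib_left mult.assoc)
    also have "\<dots> = (\<Sum>m\<in>mons d. \<Sum>i\<in>I. cst (x i * u i m) * mon m)" by (rule sum.swap)
    finally have "(\<Sum>m\<in>mons d. cst (c m - (\<Sum>i\<in>I. x i * u i m)) * mon m) = f - (\<Sum>i\<in>I. cst (x i) * b i)"
      by (simp add: f_def fun_eq_iff left_diff_distrib sum_subtractf sum_distrib_right)
    then have "(\<Sum>m\<in>mons d. cst (c m - (\<Sum>i\<in>I. x i * u i m)) * mon m) = 0" using fx by simp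
    from cform_coeffs_unique[OF this] have cx: "c m = (\<Sum>i\<in>I. x i * u i m)" if "m \<in> mons d" for m
      using that by fastforce
    have "(\<Sum>m\<in>mons d. c m * cnj (c m)) = (\<Sum>m\<in>mons d. \<Sum>i\<in>I. cnj (x i) * (c m * cnj (u i m)))"
    proof (intro sum.cong refl)
      fix m assume "m \<in> mons d"
      have "c m * cnj (\<Sum>i\<in>I. x i * u i m) = (\<Sum>i\<in>I. cnj (x i) * (c m * cnj (u i m)))"
        by (simp add: sum_distrib_left mult.left_commute)
      then show "c m * cnj (c m) = (\<Sum>i\<in>I. cnj (x i) * (c m * cnj (u i m)))" using cx[OF \<open>m \<in> mons d\<close>] by simp
    qed
    also have "\<dots> = (\<Sum>i\<in>I. cnj (x i) * (\<Sum>m\<in>mons d. c m * cnj (u i m)))"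
      by (subst sum.swap) (simp add: sum_distrib_left)
    also have "\<dots> = 0" by (simp add: cu)
    finally have "(\<Sum>m\<in>mons d. of_real ((cmod (c m))\<^sup>2)) = (0::complex)" by (simp only: complex_norm_square)
    then have "(\<Sum>m\<in>mons d. (cmod (c m))\<^sup>2) = 0" by (simp only: of_real_sum[symmetric] of_real_eq_0_iff)
    then have "\<forall>m\<in>mons d. c m = 0" by (subst (asm) sum_nonneg_eq_0_iff) auto
    then show False using c(1) by blast
  qed
  ultimately show ?thesis by blast
qed

lemma cform_X_Suc [simp]: "X1 \<in> cform (Suc 0)" "X2 \<in> cform (Suc 0)" "X3 \<in> cform (Suc 0)"
  using cform_X by simp_all

lemma cform_0_const: assumes "f \<in> cform 0" obtains c where "f = cst c"
proof -
  obtain c where c: "f = (\<lambda>v. \<Sum>m\<in>mons 0. c m * mon m v)" using assms cformE by blast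
  have "mons 0 = {(0,0,0)}" by (auto simp: mons_def)
  then have "f = cst (c (0,0,0))" unfolding c by (simp add: fun_eq_iff mon_def)
  then show ?thesis by (rule that)
qed

section \<open>Restriction to the line at infinity\<close>

text \<open>The homogenization of \<open>p\<close> to degree \<open>d\<close> in the variables \<open>X1\<close> and \<open>X2\<close>. When
  \<open>degree p < d\<close>, it acquires a zero at \<open>(1, 0)\<close>, which \<open>binary_infty\<close> detects.\<close>

definition binary :: "nat \<Rightarrow> complex poly \<Rightarrow> complex ^ 3 \<Rightarrow> complex" where
  "binary d p = (\<Sum>i\<le>d. cst (coeff p i) * (X1 ^ i * X2 ^ (d - i)))"

lemma binary_cform [simp]: "binary d p \<in> cform d"
proof -
  have "X1 ^ i * X2 ^ (d - i) \<in> cform d" if "i \<le> d" for i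
    using cform_mult[OF cform_X_power(1)[of i] cform_X_power(2)[of "d - i"]] that by simp
  then show ?thesis unfolding binary_def by (intro cform_sum cform_scale) simp
qed

lemma binary_apply: "binary d p v = (\<Sum>i\<le>d. coeff p i * v$1 ^ i * v$2 ^ (d - i))"
  by (simp add: binary_def X1_def X2_def algebra_simps)

lemma binary_add: "binary d (p + q) = binary d p + binary d q"
  by (auto simp: binary_def fun_eq_iff sum.distrib algebra_simps)

lemma binary_chart: "degree p \<le> d \<Longrightarrow> binary d p (point x 1 z) = poly p x"
  by (auto simp: binary_apply poly_altdef intro!: sum.mono_neutral_right coeff_eq_0)

lemma binary_infty: "binary d p (point 1 0 z) = coeff p d"
proof -
  have "binary d p (point 1 0 z) = (\<Sum>i\<le>d. if i = d then coeff p i else 0)"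
    unfolding binary_apply by (intro sum.cong) auto
  then show ?thesis by simp
qed

lemma binary_decomp:
  assumes "f \<in> cform (Suc d)"
  shows "\<exists>p g. degree p \<le> Suc d \<and> g \<in> cform d \<and> f = binary (Suc d) p + X3 * g"
  using assms
proof (induction rule: cform_induct)
  case zero
  show ?case by (intro exI[of _ 0] conjI cform_0) (auto simp: binary_def fun_eq_iff)
next
  case (add f f')
  then obtain p g p' g' where "degree p \<le> Suc d" "g \<in> cform d" "f = binary (Suc d) p + X3 * g"
    "degree p' \<le> Suc d" "g' \<in> cform d" "f' = binary (Suc d) p' + X3 * g'" by blast
  then show ?case
    by (intro exI[of _ "p + p'"] exI[of _ "g + g'"] conjI cform_add degree_add_le) (simp_all add: binary_add algebra_simps)
next
  case (mon c m)
  obtain i j k where m: "m = (i, j, k)" by (cases m)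
  have s: "i + j + k = Suc d" using mon by (simp add: m mons_def)
  show ?case
  proof (cases k)
    case 0
    have j: "j = Suc d - i" using s 0 by simp
    have "binary (Suc d) (monom c i) = (\<Sum>l\<le>Suc d. if l = i then cst c * mon m else 0)"
      unfolding binary_def m using j by (intro sum.cong refl) (simp add: mon_eq_X 0 fun_eq_iff)
    also have "\<dots> = cst c * mon m" using s by simp
    finally show ?thesis using s 
      by (intro exI[of _ "monom c i"] exI[of _ 0] conjI cform_0 order.trans[OF degree_monom_le]) simp_all
  next
    case (Suc k')
    have g: "cst c * mon (i, j, k') \<in> cform d" using s Suc by (intro cform_scale cform_mon) (auto simp: mons_def)
    have "cst c * mon m = binary (Suc d) 0 + X3 * (cst c * mon (i, j, k'))"
      by (auto simp: binary_def fun_eq_iff mon_eq_X m Suc)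
    with g show ?thesis by (intro exI[of _ "0 :: complex poly"] exI[of _ "cst c * mon (i, j, k')"] conjI) (simp, assumption+)
  qed
qed

lemma binary_restrict:
  assumes "f \<in> cform d"
  shows "\<exists>p. degree p \<le> d \<and> (\<forall>x y. f (point x y 0) = binary d p (point x y 0))"
proof (cases d)
  case 0
  then obtain c where "f = cst c" using assms cform_0_const by blast
  then show ?thesis using 0 by (intro exI[of _ "[:c:]"]) (simp add: binary_apply)
next
  case (Suc e)
  then show ?thesis using binary_decomp[of f e] assms by (auto simp: X3_def)
qed

lemma vanish_infinity_chart:
  assumes "f \<in> cform d" "\<And>x. f (point x 1 0) = 0"
  shows "f (point x y 0) = 0"
proof -
  obtain p where p: "degree p \<le> d" "\<And>x y. f (point x y 0) = binary d p (point x y 0)" using binary_restrict[OF assms(1)] by blast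
  have "poly p x = 0" for x using binary_chart[OF p(1), of x 0] p(2) assms(2) by simp
  then have "p = 0" using poly_all_0_iff_0 by blast
  then show ?thesis using p by (simp add: binary_apply)
qed

lemma divide_X3:
  assumes "f \<in> cform (Suc d)" "\<And>x y. f (point x y 0) = 0"
  obtains g where "g \<in> cform d" "f = X3 * g"
proof -
  obtain p g where pg: "degree p \<le> Suc d" "g \<in> cform d" "f = binary (Suc d) p + X3 * g" using binary_decomp[OF assms(1)] by blast
  have "poly p x = 0" for x 
  proof -
    have "binary (Suc d) p (point x 1 0) + (X3 * g) (point x 1 0) = 0" using assms(2)[of x 1] pg(3) by simp
    then show ?thesis using binary_chart[OF pg(1), of x 0] by (simp add: X3_def)
  qed
  then have "p = 0" using poly_all_0_iff_0 by blast
  then have "f = X3 * g" using pg by (auto simp: fun_eq_iff binary_def)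
  with pg that show ?thesis by blast
qed

lemma coprime_no_common_root:
  fixes p q :: "complex poly"
  assumes "\<And>x. poly p x \<noteq> 0 \<or> poly q x \<noteq> 0"
  shows "coprime p q"
proof (rule coprimeI)
  fix r assume r: "r dvd p" "r dvd q"
  show "is_unit r"
  proof (rule ccontr)
    assume nu: "\<not> is_unit r"
    show False
    proof (cases "r = 0")
      case True then show ?thesis using r assms[of 0] by auto
    next
      case False
      then have "degree r > 0" using nu is_unit_iff_degree by blast
      then obtain x where "poly r x = 0" using alg_closed_imp_poly_has_root[of r] by auto
      then show ?thesis using r assms[of x] by (auto elim!: dvdE)
    qed
  qed
qed

section \<open>Pencils of cubics without zeros at infinity\<close>

text \<open>Keeping \<open>X3 = 0\<close> free of common zeros does two things: every zero has a representative
  with third coordinate 1, and the restrictions of \<open>q1\<close> and \<open>q2\<close> to that line are coprime, so \<open>X3\<close>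
  is not a zero divisor modulo the ideal of the pencil.\<close>

locale pencil =
  fixes q1 q2 :: "complex ^ 3 \<Rightarrow> complex"
  assumes q1: "q1 \<in> cform 3" and q2: "q2 \<in> cform 3"
    and good: "\<And>v. v \<noteq> 0 \<Longrightarrow> v $ 3 = 0 \<Longrightarrow> q1 v \<noteq> 0 \<or> q2 v \<noteq> 0"
begin

text \<open>A common root of the dehomogenized restrictions would be a common zero \<open>(x, 1, 0)\<close>, and
  two leading coefficients equal to zero would be a common zero \<open>(1, 0, 0)\<close>.\<close>

lemma infinity_polys:
  obtains p1 p2 where "degree p1 \<le> 3" "degree p2 \<le> 3" 
    "\<And>x y. q1 (point x y 0) = binary 3 p1 (point x y 0)" "\<And>x y. q2 (point x y 0) = binary 3 p2 (point x y 0)"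
    "coprime p1 p2" "degree p1 = 3 \<or> degree p2 = 3" "p1 \<noteq> 0" "p2 \<noteq> 0"
proof -
  obtain p1 where p1: "degree p1 \<le> 3" "\<And>x y. q1 (point x y 0) = binary 3 p1 (point x y 0)" 
    using binary_restrict[OF q1] by blast
  obtain p2 where p2: "degree p2 \<le> 3" "\<And>x y. q2 (point x y 0) = binary 3 p2 (point x y 0)" 
    using binary_restrict[OF q2] by blast
  have "poly p1 x \<noteq> 0 \<or> poly p2 x \<noteq> 0" for x
  proof -
    have "point x 1 (0::complex) \<noteq> 0" by (metis point_nth(2) zero_index zero_neq_one)
    from good[OF this] show ?thesis using p1 p2 by (simp add: binary_chart)
  qed
  then have cop: "coprime p1 p2" by (rule coprime_no_common_root)
  have "point 1 0 (0::complex) \<noteq> 0" by (metis point_nth(1) zero_index zero_neq_one)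
  from good[OF this] have "coeff p1 3 \<noteq> 0 \<or> coeff p2 3 \<noteq> 0" using p1 p2 by (simp add: binary_infty)
  then have deg: "degree p1 = 3 \<or> degree p2 = 3" using p1 p2 le_degree by (metis le_antisym)
  have "p1 \<noteq> 0" using cop deg by (metis coprime_0_left_iff degree_0 is_unit_iff_degree zero_neq_numeral)
  moreover have "p2 \<noteq> 0" using cop deg by (metis coprime_0_right_iff degree_0 is_unit_iff_degree zero_neq_numeral)
  ultimately show ?thesis using that p1 p2 cop deg by blast
qed

text \<open>Coprime binary cubics have only the Koszul relation \<open>q2 q1 - q1 q2 = 0\<close> and its multiples.
  Below degree three there is no room for a nonzero multiple.\<close>

lemma binary_syzygy:
  assumes a: "a1 \<in> cform e" "a2 \<in> cform e"
    and z: "\<And>x y. (a1 * q1 + a2 * q2) (point x y 0) = 0"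
  shows "(\<forall>x y. a1 (point x y 0) = 0 \<and> a2 (point x y 0) = 0) \<or>
    (3 \<le> e \<and> (\<exists>b\<in>cform (e - 3). \<forall>x y. (a1 - b * q2) (point x y 0) = 0 \<and> (a2 + b * q1) (point x y 0) = 0))"
proof -
  obtain p1 p2 where p: "degree p1 \<le> 3" "degree p2 \<le> 3" 
    "\<And>x y. q1 (point x y 0) = binary 3 p1 (point x y 0)" "\<And>x y. q2 (point x y 0) = binary 3 p2 (point x y 0)"
    "coprime p1 p2" "degree p1 = 3 \<or> degree p2 = 3" "p1 \<noteq> 0" "p2 \<noteq> 0" using infinity_polys by blast
  obtain r1 where r1: "degree r1 \<le> e" "\<And>x y. a1 (point x y 0) = binary e r1 (point x y 0)" 
    using binary_restrict[OF a(1)] by blast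
  obtain r2 where r2: "degree r2 \<le> e" "\<And>x y. a2 (point x y 0) = binary e r2 (point x y 0)" 
    using binary_restrict[OF a(2)] by blast
  have "poly (r1 * p1 + r2 * p2) x = 0" for x
    using z[of x 1] p r1 r2 by (simp add: binary_chart)
  then have rp: "r1 * p1 + r2 * p2 = 0" using poly_all_0_iff_0 by blast
  then have eq: "r2 * p2 = p1 * (- r1)" by (simp add: algebra_simps add_eq_0_iff)
  then have "p1 dvd p2 * r2" by (metis dvd_triv_left mult.commute)
  then have "p1 dvd r2" using p(5) coprime_dvd_mult_right_iff by blast
  then obtain b where "r2 = p1 * (- b)" by (metis dvdE minus_minus)
  then have b2: "r2 = - (b * p1)" by simp
  with rp have "(r1 - b * p2) * p1 = 0" by (simp add: algebra_simps)
  then have b1: "r1 = b * p2" using p(7) by simp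
  show ?thesis
  proof (cases "b = 0")
    case True
    then show ?thesis using b1 b2 r1 r2 by (simp add: binary_apply)
  next
    case False
    have deg: "degree b + 3 \<le> e"
    proof (cases "degree p1 = 3")
      case True
      then show ?thesis using r2(1) b2 False p by (simp add: degree_mult_eq)
    next
      case False
      then show ?thesis using r1(1) b1 \<open>b \<noteq> 0\<close> p by (simp add: degree_mult_eq)
    qed
    let ?b = "binary (e - 3) b"
    have bc: "?b \<in> cform (e - 3)" by simp
    have c1: "a1 - ?b * q2 \<in> cform e" using a q2 deg by (intro cform_diff cform_mult'[OF bc]) auto
    have c2: "a2 + ?b * q1 \<in> cform e" using a q1 deg by (intro cform_add cform_mult'[OF bc]) auto
    have db: "degree b \<le> e - 3" using deg by simp
    have "(a1 - ?b * q2) (point x y 0) = 0" for x y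
      by (rule vanish_infinity_chart[OF c1]) (simp add: r1 p binary_chart[OF r1(1)] binary_chart[OF db] binary_chart[OF p(2)] b1[symmetric], simp add: b1)
    moreover have "(a2 + ?b * q1) (point x y 0) = 0" for x y
      by (rule vanish_infinity_chart[OF c2]) (simp add: r2 p binary_chart[OF r2(1)] binary_chart[OF db] binary_chart[OF p(1)], simp add: b2)
    ultimately show ?thesis using deg bc by (intro disjI2 conjI bexI[of _ ?b]) auto
  qed
qed

text \<open>The component of degree \<open>e + 3\<close> of the homogeneous ideal generated by \<open>q1\<close> and \<open>q2\<close>; the
  index is the degree of the cofactors.\<close>

definition ideal :: "nat \<Rightarrow> (complex ^ 3 \<Rightarrow> complex) set" where
  "ideal e = {f. \<exists>a\<in>cform e. \<exists>b\<in>cform e. f = a * q1 + b * q2}"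

lemma ideal_I: "a \<in> cform e \<Longrightarrow> b \<in> cform e \<Longrightarrow> a * q1 + b * q2 \<in> ideal e"
  by (auto simp: ideal_def)

lemma ideal_0 [simp]: "0 \<in> ideal e"
  using ideal_I[of 0 e 0] by simp

lemma ideal_add [simp]: assumes "f \<in> ideal e" "g \<in> ideal e" shows "f + g \<in> ideal e"
proof -
  obtain a b a' b' where "a \<in> cform e" "b \<in> cform e" "a' \<in> cform e" "b' \<in> cform e"
    "f = a * q1 + b * q2" "g = a' * q1 + b' * q2" using assms unfolding ideal_def by blast
  then show ?thesis using ideal_I[of "a + a'" e "b + b'"] by (simp add: algebra_simps cform_add)
qed

lemma ideal_mult: assumes "r \<in> cform m" "f \<in> ideal e" shows "r * f \<in> ideal (m + e)"
proof -
  obtain a b where "a \<in> cform e" "b \<in> cform e" "f = a * q1 + b * q2" using assms unfolding ideal_def by blast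
  then show ?thesis using ideal_I[of "r * a" "m + e" "r * b"] assms by (simp add: algebra_simps cform_mult)
qed

lemma ideal_mult': "r \<in> cform m \<Longrightarrow> f \<in> ideal e \<Longrightarrow> n = m + e \<Longrightarrow> r * f \<in> ideal n"
  using ideal_mult by blast

lemma ideal_scale [simp]: "f \<in> ideal e \<Longrightarrow> cst c * f \<in> ideal e"
  using ideal_mult[of "cst c" 0] by simp

lemma ideal_uminus [simp]: assumes "f \<in> ideal e" shows "- f \<in> ideal e"
proof -
  have "cst (-1) * f \<in> ideal e" using assms by (rule ideal_scale)
  also have "cst (-1) * f = - f" by (auto simp: fun_eq_iff)
  finally show ?thesis .
qed

lemma ideal_diff [simp]: "f \<in> ideal e \<Longrightarrow> g \<in> ideal e \<Longrightarrow> f - g \<in> ideal e"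
  using ideal_add[of f e "- g"] by simp

lemma ideal_sum [simp]: "(\<And>i. i \<in> A \<Longrightarrow> f i \<in> ideal e) \<Longrightarrow> (\<Sum>i\<in>A. f i) \<in> ideal e"
  by (induction A rule: infinite_finite_induct) auto

lemma ideal_q: "r \<in> cform e \<Longrightarrow> r * q1 \<in> ideal e" "r \<in> cform e \<Longrightarrow> r * q2 \<in> ideal e"
  using ideal_I[of r e 0] ideal_I[of 0 e r] by auto

lemma ideal_vanish: "f \<in> ideal e \<Longrightarrow> q1 v = 0 \<Longrightarrow> q2 v = 0 \<Longrightarrow> f v = 0"
  by (auto simp: ideal_def)

text \<open>The cofactors in \<open>X3 f = a1 q1 + a2 q2\<close> restrict to a syzygy on the line \<open>X3 = 0\<close>.
  Subtracting the corresponding Koszul relation makes both of them divisible by \<open>X3\<close>, which then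
  cancels.\<close>

lemma cancel_X3_ideal:
  assumes f: "f \<in> cform (e + 3)" and "X3 * f \<in> ideal (Suc e)"
  shows "f \<in> ideal e"
proof -
  obtain a1 a2 where a: "a1 \<in> cform (Suc e)" "a2 \<in> cform (Suc e)" and eq: "X3 * f = a1 * q1 + a2 * q2"
    using assms unfolding ideal_def by blast
  have z: "(a1 * q1 + a2 * q2) (point x y 0) = 0" for x y unfolding eq[symmetric] by (simp add: X3_def)
  have *: "f \<in> ideal e" if H: "b1 \<in> cform (Suc e)" "b2 \<in> cform (Suc e)" "X3 * f = b1 * q1 + b2 * q2"
    "\<forall>x y. b1 (point x y 0) = 0 \<and> b2 (point x y 0) = 0" for b1 b2
  proof -
    obtain c1 where c1: "c1 \<in> cform e" "b1 = X3 * c1" using divide_X3[OF H(1)] H(4) by blast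
    obtain c2 where c2: "c2 \<in> cform e" "b2 = X3 * c2" using divide_X3[OF H(2)] H(4) by blast
    have "X3 * f = X3 * (c1 * q1 + c2 * q2)" using H(3) c1 c2 by (simp add: algebra_simps)
    then have "f = c1 * q1 + c2 * q2" 
      using cform_cancel[OF cform_X(3) X_neq_0(3) f] c1 c2 q1 q2 by simp
    then show ?thesis using c1 c2 by (auto simp: ideal_def)
  qed
  show ?thesis using binary_syzygy[OF a z]
  proof (elim disjE conjE bexE)
    assume "\<forall>x y. a1 (point x y 0) = 0 \<and> a2 (point x y 0) = 0"
    then show ?thesis using *[OF a eq] by blast
  next
    fix b assume e: "3 \<le> Suc e" and b: "b \<in> cform (Suc e - 3)"
      and v: "\<forall>x y. (a1 - b * q2) (point x y 0) = 0 \<and> (a2 + b * q1) (point x y 0) = 0"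
    show ?thesis
    proof (rule *[of "a1 - b * q2" "a2 + b * q1"])
      show "a1 - b * q2 \<in> cform (Suc e)" using a b e q2 by (intro cform_diff cform_mult'[OF b]) auto
      show "a2 + b * q1 \<in> cform (Suc e)" using a b e q1 by (intro cform_add cform_mult'[OF b]) auto
      show "X3 * f = (a1 - b * q2) * q1 + (a2 + b * q1) * q2" by (simp add: eq algebra_simps)
    qed (use v in blast)
  qed
qed

lemma cancel_X3_power_ideal:
  "f \<in> cform (e + 3) \<Longrightarrow> X3 ^ k * f \<in> ideal (k + e) \<Longrightarrow> f \<in> ideal e"
proof (induction k)
  case (Suc k)
  have "X3 ^ k * f \<in> cform (k + e + 3)" using Suc.prems by (intro cform_mult'[of _ k _ "e + 3"]) auto
  moreover have "X3 ^ Suc k * f \<in> ideal (Suc k + e)" by (rule Suc.prems(2))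
  then have "X3 * (X3 ^ k * f) \<in> ideal (Suc (k + e))" by (simp add: mult.assoc)
  ultimately have "X3 ^ k * f \<in> ideal (k + e)" by (rule cancel_X3_ideal)
  then show ?case using Suc by blast
qed auto

text \<open>On \<open>X3 = 0\<close> there are no syzygies in this degree, so both coefficients are divisible by
  \<open>X3\<close>, and the quotients form a syzygy of smaller degree.\<close>

lemma no_low_syzygy:
  assumes "a1 \<in> cform e" "a2 \<in> cform e" "e < 3" "a1 * q1 + a2 * q2 = 0"
  shows "a1 = 0 \<and> a2 = 0"
  using assms
proof (induction e arbitrary: a1 a2)
  case 0
  have "\<forall>x y. a1 (point x y 0) = 0 \<and> a2 (point x y 0) = 0" using binary_syzygy[OF 0(1,2)] 0(4) by auto
  moreover obtain c1 where "a1 = cst c1" using 0(1) cform_0_const by blast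
  moreover obtain c2 where "a2 = cst c2" using 0(2) cform_0_const by blast
  ultimately show ?case by (simp add: fun_eq_iff)
next
  case (Suc e)
  have z: "a1 (point x y 0) = 0 \<and> a2 (point x y 0) = 0" for x y 
    using binary_syzygy[OF Suc.prems(1,2)] Suc.prems(3,4) by auto
  obtain c1 where c1: "c1 \<in> cform e" "a1 = X3 * c1" using divide_X3[OF Suc.prems(1)] z by blast
  obtain c2 where c2: "c2 \<in> cform e" "a2 = X3 * c2" using divide_X3[OF Suc.prems(2)] z by blast
  have "a1 * q1 + a2 * q2 = 0" by (rule Suc.prems(4))
  then have "X3 * (c1 * q1 + c2 * q2) = 0" by (simp add: c1 c2 algebra_simps)
  then have "c1 * q1 + c2 * q2 = 0" 
    using cform_mult_eq_0[of X3 1 "c1 * q1 + c2 * q2" "e + 3"] c1 c2 q1 q2 by auto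
  have "c1 = 0 \<and> c2 = 0" by (rule Suc.IH[OF c1(1) c2(1) _ \<open>c1 * q1 + c2 * q2 = 0\<close>]) (use Suc.prems(3) in simp)
  then have "a1 = 0 \<and> a2 = 0" by (simp add: c1 c2)
  then show ?case .
qed

end

section \<open>A Nullstellensatz for pencils\<close>

text \<open>Bezout coefficients of \<open>P\<close>, with the second one reduced modulo \<open>p1\<close>; the degree of the
  first is then controlled by the equation. This says that the binary forms of degree at least
  five all lie in the ideal of two coprime binary cubics.\<close>

lemma bounded_bezout:
  fixes p1 p2 P :: "complex poly"
  assumes "coprime p1 p2" "degree p1 = 3" "degree p2 \<le> 3" "degree P \<le> e + 3" "2 \<le> e"
  shows "\<exists>A1 A2. degree A1 \<le> e \<and> degree A2 \<le> e \<and> A1 * p1 + A2 * p2 = P"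
proof -
  obtain a b where ab: "a * p1 + b * p2 = 1"
    using assms(1) by (metis bezout_coefficients_fst_snd coprime_imp_gcd_eq_1)
  define A2 where "A2 = (b * P) mod p1"
  define Q where "Q = (b * P) div p1"
  define A1 where "A1 = a * P + p2 * Q"
  have bP: "b * P = Q * p1 + A2" by (simp add: A2_def Q_def)
  have "A1 * p1 + A2 * p2 = a * p1 * P + p2 * (Q * p1 + A2)"
    by (simp add: A1_def algebra_simps)
  also have "\<dots> = (a * p1 + b * p2) * P" by (simp add: bP[symmetric]) (simp add: algebra_simps)
  finally have eq: "A1 * p1 + A2 * p2 = P" using ab by simp
  have p1: "p1 \<noteq> 0" using assms by auto
  have d2: "degree A2 \<le> 2" using degree_mod_less[of p1 "b * P"] p1 assms(2) by (auto simp: A2_def)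
  have "degree (A2 * p2) \<le> e + 3" using degree_mult_le[of A2 p2] d2 assms by linarith
  then have "degree (P - A2 * p2) \<le> e + 3" using assms(4) by (rule degree_diff_le[rotated])
  moreover have "P - A2 * p2 = A1 * p1" using eq by (simp add: algebra_simps)
  ultimately have "degree (A1 * p1) \<le> e + 3" by simp
  then have "degree A1 \<le> e" using p1 assms(2) by (cases "A1 = 0") (auto simp: degree_mult_eq)
  then show ?thesis using d2 eq assms(5) by (intro exI[of _ A1] exI[of _ A2]) auto
qed

text \<open>Taylor expansion of \<open>r\<close> at \<open>P\<close> to order zero, in homogeneous form: the linear forms
  \<open>X1 - P\<^sub>1 X3\<close> and \<open>X2 - P\<^sub>2 X3\<close> generate the ideal of the point.\<close>

lemma point_decomp:
  assumes "r \<in> cform m" "P $ 3 = 1"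
  shows "\<exists>b1\<in>cform (m - 1). \<exists>b2\<in>cform (m - 1).
    r = cst (r P) * X3 ^ m + (X1 - cst (P$1) * X3) * b1 + (X2 - cst (P$2) * X3) * b2"
  using assms(1)
proof (induction m arbitrary: r)
  case 0
  then obtain c where "r = cst c" using cform_0_const by blast
  then have "r = cst (r P) * X3 ^ 0 + (X1 - cst (P$1) * X3) * 0 + (X2 - cst (P$2) * X3) * 0" by simp
  then show ?case using cform_0 by blast
next
  case (Suc m)
  obtain r1 r2 r3 where r: "r1\<in>cform m" "r2\<in>cform m" "r3\<in>cform m" "r = X1 * r1 + X2 * r2 + X3 * r3"
    using cform_Suc_split[OF Suc.prems] by blast
  define l1 where "l1 = X1 - cst (P$1) * X3"
  define l2 where "l2 = X2 - cst (P$2) * X3"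
  let ?s = "cst (P$1) * r1 + cst (P$2) * r2 + r3"
  have "?s \<in> cform m" using r by simp
  obtain b1 b2 where b: "b1\<in>cform (m - 1)" "b2\<in>cform (m - 1)" "?s = cst (?s P) * X3 ^ m + l1 * b1 + l2 * b2"
    using Suc.IH[OF \<open>?s \<in> cform m\<close>] unfolding l1_def l2_def by blast
  have sP: "?s P = r P" using assms(2) by (simp add: r X1_def X2_def X3_def)
  have "r = X3 * ?s + l1 * r1 + l2 * r2" by (simp add: r l1_def l2_def algebra_simps)
  also have "X3 * ?s = X3 * (cst (?s P) * X3 ^ m + l1 * b1 + l2 * b2)" using b(3) by (rule arg_cong)
  also have "\<dots> = cst (r P) * X3 ^ Suc m + l1 * (X3 * b1) + l2 * (X3 * b2)"
    by (simp only: sP) (simp add: algebra_simps)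
  finally have "r = cst (r P) * X3 ^ Suc m + l1 * (X3 * b1) + l2 * (X3 * b2) + l1 * r1 + l2 * r2" .
  also have "\<dots> = cst (r P) * X3 ^ Suc m + l1 * (X3 * b1 + r1) + l2 * (X3 * b2 + r2)"
    by (simp add: algebra_simps)
  finally have eq: "r = cst (r P) * X3 ^ Suc m + l1 * (X3 * b1 + r1) + l2 * (X3 * b2 + r2)" .
  show ?case
  proof (cases m)
    case 0
    have eq0: "r = cst (r P) * X3 ^ Suc 0 + l1 * r1 + l2 * r2"
    proof -
      obtain c where "?s = cst c" using \<open>?s \<in> cform m\<close> 0 cform_0_const by blast
      then have "?s = cst (?s P)" by (metis cst_apply)
      then have "?s = cst (r P)" using sP by metis
      then have "X3 * ?s = cst (r P) * X3" by (simp add: mult.commute)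
      with \<open>r = X3 * ?s + l1 * r1 + l2 * r2\<close> show ?thesis by simp
    qed
    have "r1 \<in> cform (Suc m - 1)" "r2 \<in> cform (Suc m - 1)" using r 0 by simp_all
    then show ?thesis using eq0 0 unfolding l1_def l2_def by blast
  next
    case (Suc k)
    have "X3 * b1 + r1 \<in> cform (Suc m - 1)" "X3 * b2 + r2 \<in> cform (Suc m - 1)" 
      using r b Suc by (auto intro!: cform_add cform_mult'[of X3 1])
    then show ?thesis using eq unfolding l1_def l2_def by blast
  qed
qed

text \<open>The univariate polynomial \<open>c\<close>, of degree at most \<open>N\<close>, evaluated at \<open>L / X3\<close> and multiplied
  by \<open>X3\<^bsup>N\<^esup>\<close>.\<close>

definition homog :: "nat \<Rightarrow> complex poly \<Rightarrow> (complex ^ 3 \<Rightarrow> complex) \<Rightarrow> complex ^ 3 \<Rightarrow> complex" where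
  "homog N c L = (\<Sum>i\<le>N. cst (coeff c i) * (L ^ i * X3 ^ (N - i)))"

lemma homog_cform: "L \<in> cform 1 \<Longrightarrow> homog N c L \<in> cform N"
proof -
  assume L: "L \<in> cform 1"
  have "L ^ i * X3 ^ (N - i) \<in> cform N" if "i \<le> N" for i
    using cform_mult[OF cform_power[OF L, of i] cform_X_power(3)[of "N - i"]] that by simp
  then show ?thesis unfolding homog_def by (intro cform_sum cform_scale) simp
qed

lemma homog_diff: "homog N (p - q) L = homog N p L - homog N q L"
  by (simp add: homog_def fun_eq_iff left_diff_distrib sum_subtractf)

lemma homog_smult: "homog N (smult a p) L = cst a * homog N p L"
  by (simp add: homog_def fun_eq_iff sum_distrib_left mult.assoc)

lemma homog_Suc_low: "degree c \<le> N \<Longrightarrow> homog (Suc N) c L = X3 * homog N c L"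
  by (auto simp: homog_def sum_distrib_left Suc_diff_le coeff_eq_0 cst_def[of 0] zero_fun_def[symmetric] 
      algebra_simps intro!: sum.cong)

lemma homog_Suc_pCons: "homog (Suc N) (pCons 0 c) L = L * homog N c L"
  by (simp add: homog_def sum.atMost_Suc_shift sum_distrib_left cst_def[of 0] zero_fun_def[symmetric] algebra_simps
      del: sum.atMost_Suc)

lemma homog_root: "degree c \<le> N \<Longrightarrow> homog (Suc N) ([:-a, 1:] * c) L = (L - cst a * X3) * homog N c L"
proof -
  assume "degree c \<le> N"
  have "homog (Suc N) ([:-a, 1:] * c) L = homog (Suc N) (pCons 0 c) L - cst a * homog (Suc N) c L"
  proof -
    have "[:-a, 1:] * c = pCons 0 c - smult a c" by simp
    then show ?thesis by (simp only: homog_diff homog_smult)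
  qed
  also have "\<dots> = (L - cst a * X3) * homog N c L"
    using \<open>degree c \<le> N\<close> by (simp add: homog_Suc_pCons homog_Suc_low algebra_simps)
  finally show ?thesis .
qed

context pencil
begin

text \<open>By \<open>bounded_bezout\<close> the restriction of \<open>f\<close> to \<open>X3 = 0\<close> is in the ideal of the restricted
  pencil, so an element of the ideal can be subtracted that makes \<open>f\<close> divisible by \<open>X3\<close>.\<close>

lemma reduce_step:
  assumes f: "f \<in> cform (e + 3)" and e: "2 \<le> e"
  shows "\<exists>g\<in>cform (e + 2). f - X3 * g \<in> ideal e"
proof -
  obtain p1 p2 where p: "degree p1 \<le> 3" "degree p2 \<le> 3" 
    "\<And>x y. q1 (point x y 0) = binary 3 p1 (point x y 0)" "\<And>x y. q2 (point x y 0) = binary 3 p2 (point x y 0)"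
    "coprime p1 p2" "degree p1 = 3 \<or> degree p2 = 3" "p1 \<noteq> 0" "p2 \<noteq> 0" using infinity_polys by blast
  obtain P where P: "degree P \<le> e + 3" "\<And>x y. f (point x y 0) = binary (e + 3) P (point x y 0)" 
    using binary_restrict[OF f] by blast
  have "\<exists>A1 A2. degree A1 \<le> e \<and> degree A2 \<le> e \<and> A1 * p1 + A2 * p2 = P"
    using p(6)
  proof
    assume "degree p1 = 3"
    then show ?thesis using bounded_bezout[OF p(5) _ p(2) P(1) e] by blast
  next
    assume "degree p2 = 3"
    then have "\<exists>A2 A1. degree A2 \<le> e \<and> degree A1 \<le> e \<and> A2 * p2 + A1 * p1 = P" 
      using bounded_bezout[of p2 p1 P e] p P e coprime_commute by blast
    then show ?thesis by (metis add.commute)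
  qed
  then obtain A1 A2 where A: "degree A1 \<le> e" "degree A2 \<le> e" "A1 * p1 + A2 * p2 = P" by blast
  have PA: "poly P x = poly A1 x * poly p1 x + poly A2 x * poly p2 x" for x by (simp add: A(3)[symmetric])
  let ?g = "f - (binary e A1 * q1 + binary e A2 * q2)"
  have gc: "?g \<in> cform (e + 3)" using f q1 q2 by simp
  have "?g (point x y 0) = 0" for x y
    by (rule vanish_infinity_chart[OF gc])
       (simp add: p P PA binary_chart[OF A(1)] binary_chart[OF A(2)] binary_chart[OF P(1)] binary_chart[OF p(1)] binary_chart[OF p(2)])
  moreover have "e + 3 = Suc (e + 2)" by simp
  ultimately obtain g where "g \<in> cform (e + 2)" "?g = X3 * g" using divide_X3 gc by metis
  moreover from this have "f - X3 * g = binary e A1 * q1 + binary e A2 * q2" by (metis add_diff_cancel_left' diff_add_cancel)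
  ultimately show ?thesis using ideal_I by (metis binary_cform)
qed

text \<open>In the chart \<open>X3 = 1\<close> this bounds the dimension of the coordinate ring of the zero set by
  that of the space of quartics.\<close>

lemma reduce_to_quartic:
  "f \<in> cform (4 + k) \<Longrightarrow> \<exists>g\<in>cform 4. f - X3 ^ k * g \<in> ideal (1 + k)"
proof (induction k arbitrary: f)
  case 0
  have "f \<in> cform 4" using 0 by simp
  moreover have "f - X3 ^ 0 * f \<in> ideal (1 + 0)" by simp
  ultimately show ?case by blast
next
  case (Suc k)
  have "f \<in> cform ((k + 2) + 3)" using Suc.prems by (simp add: eval_nat_numeral)
  from reduce_step[OF this] obtain g1 where g1: "g1 \<in> cform (k + 2 + 2)" "f - X3 * g1 \<in> ideal (k + 2)" by auto
  have "k + 2 + 2 = 4 + k" by simp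
  then have "g1 \<in> cform (4 + k)" using g1(1) by (simp only:)
  from Suc.IH[OF this] obtain g where g: "g \<in> cform 4" "g1 - X3 ^ k * g \<in> ideal (1 + k)" by blast
  have "(f - X3 * g1) + X3 * (g1 - X3 ^ k * g) \<in> ideal (k + 2)"
    using g g1 by (intro ideal_add ideal_mult'[of X3 1]) auto
  moreover have "(f - X3 * g1) + X3 * (g1 - X3 ^ k * g) = f - X3 ^ Suc k * g" by (simp add: algebra_simps)
  ultimately have "f - X3 ^ Suc k * g \<in> ideal (1 + Suc k)" by simp
  then show ?case using g(1) by blast
qed

text \<open>The sixteen forms \<open>L\<^bsup>i\<^esup> X3\<^bsup>15-i\<^esup> f\<close> reduce to quartics, which make up a space of dimension
  fifteen. So \<open>c\<close> annihilates \<open>f\<close> under multiplication by \<open>L\<close>, as the minimal polynomial of an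
  endomorphism does.\<close>

lemma homog_relation:
  assumes "L \<in> cform 1" "f \<in> cform (4 + k)"
  shows "\<exists>c. c \<noteq> 0 \<and> degree c \<le> 15 \<and> homog 15 c L * f \<in> ideal (16 + k)"
proof -
  let ?h = "\<lambda>i. L ^ i * X3 ^ (15 - i) * f"
  have "\<exists>g\<in>cform 4. ?h i - X3 ^ (15 + k) * g \<in> ideal (1 + (15 + k))" if "i \<le> 15" for i
  proof (rule reduce_to_quartic)
    have "L ^ i * X3 ^ (15 - i) \<in> cform 15"
      using cform_mult[OF cform_power[OF assms(1), of i] cform_X_power(3)[of "15 - i"]] that by simp
    then show "?h i \<in> cform (4 + (15 + k))" by (rule cform_mult'[OF _ assms(2)]) simp
  qed
  then obtain g where g: "\<And>i. i \<le> 15 \<Longrightarrow> g i \<in> cform 4" "\<And>i. i \<le> 15 \<Longrightarrow> ?h i - X3 ^ (15 + k) * g i \<in> ideal (1 + (15 + k))"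
    by metis
  have "card (mons 4) < card {..15::nat}" using card_mons[of 4] by simp
  from dependent_forms[OF _ _ this, of g] g(1) obtain c i0 where
    c: "i0 \<le> 15" "c i0 \<noteq> 0" and g0: "(\<Sum>i\<le>15. cst (c i) * g i) = 0" by auto
  define p where "p = (\<Sum>i\<le>15. monom (c i) i)"
  have coeff_p: "coeff p i = (if i \<le> 15 then c i else 0)" for i
    by (simp add: p_def coeff_sum)
  have "homog 15 p L * f = (\<Sum>i\<le>15. cst (c i) * ?h i)"
    unfolding homog_def sum_distrib_right by (intro sum.cong refl) (simp add: coeff_p mult.assoc)
  also have "\<dots> = (\<Sum>i\<le>15. cst (c i) * (?h i - X3 ^ (15 + k) * g i)) + X3 ^ (15 + k) * (\<Sum>i\<le>15. cst (c i) * g i)"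
    by (simp add: sum_distrib_left sum.distrib[symmetric] algebra_simps)
  also have "\<dots> = (\<Sum>i\<le>15. cst (c i) * (?h i - X3 ^ (15 + k) * g i))" by (simp add: g0)
  also have "\<dots> \<in> ideal (1 + (15 + k))" using g(2) by (intro ideal_sum ideal_scale) auto
  finally have "homog 15 p L * f \<in> ideal (16 + k)" by (simp add: algebra_simps)
  moreover have "p \<noteq> 0" using coeff_p[of i0] c by auto
  moreover have "degree p \<le> 15" by (rule degree_le) (simp add: coeff_p)
  ultimately show ?thesis by blast
qed

text \<open>A polynomial in \<open>L\<close> sends \<open>f\<close> into the ideal. Peel off its linear factors one by one: the
  last product that is still outside the ideal is an eigenvector of multiplication by \<open>L\<close>. Powers
  of \<open>X3\<close>, which appear when \<open>c\<close> has degree less than \<open>N\<close>, cancel.\<close>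

lemma eigen_multiple:
  assumes L: "L \<in> cform 1" and f: "f \<in> cform (e + 3)" "f \<notin> ideal e"
  shows "c \<noteq> 0 \<Longrightarrow> degree c \<le> N \<Longrightarrow> homog N c L * f \<in> ideal (N + e) \<Longrightarrow>
    \<exists>n v a. v \<in> cform n \<and> v * f \<notin> ideal (n + e) \<and> (L - cst a * X3) * (v * f) \<in> ideal (Suc (n + e))"
proof (induction N arbitrary: c)
  case 0
  then obtain c0 where "c = [:c0:]" "c0 \<noteq> 0" by (metis degree_0_id le_zero_eq pCons_0_0)
  then have "homog 0 c L * f = cst c0 * f" by (simp add: homog_def)
  moreover have "homog 0 c L * f \<in> ideal (0 + e)" by (rule 0(3))
  ultimately have "cst c0 * f \<in> ideal e" by simp
  then have "cst (1 / c0) * (cst c0 * f) \<in> ideal e" by (rule ideal_scale)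
  also have "cst (1 / c0) * (cst c0 * f) = f" using \<open>c0 \<noteq> 0\<close> by (auto simp: fun_eq_iff)
  finally show ?case using f by blast
next
  case (Suc N)
  show ?case
  proof (cases "degree c \<le> N")
    case True
    have "homog N c L * f \<in> cform (N + e + 3)" using homog_cform[OF L] f by (intro cform_mult'[of _ N]) auto
    moreover have "X3 * (homog N c L * f) \<in> ideal (Suc (N + e))" 
    proof -
      have "homog (Suc N) c L * f \<in> ideal (Suc N + e)" by (rule Suc.prems(3))
      then show ?thesis using True by (simp add: homog_Suc_low mult.assoc)
    qed
    ultimately have "homog N c L * f \<in> ideal (N + e)" by (rule cancel_X3_ideal)
    then show ?thesis by (rule Suc.IH[OF Suc.prems(1) True])
  next
    case False
    then have dc: "degree c = Suc N" using Suc.prems by simp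
    then obtain a where "poly c a = 0" using alg_closed_imp_poly_has_root by (metis zero_less_Suc)
    then obtain c' where c': "c = [:-a, 1:] * c'" using poly_eq_0_iff_dvd by blast
    then have "c' \<noteq> 0" using Suc.prems by auto
    then have "degree c' = N" using dc unfolding c' by (subst (asm) degree_mult_eq) auto
    then have h: "homog (Suc N) c L = (L - cst a * X3) * homog N c' L" using c' homog_root by auto
    show ?thesis
    proof (cases "homog N c' L * f \<in> ideal (N + e)")
      case True
      show ?thesis by (rule Suc.IH[OF \<open>c' \<noteq> 0\<close> _ True]) (simp add: \<open>degree c' = N\<close>)
    next
      case False
      have "homog (Suc N) c L * f \<in> ideal (Suc N + e)" by (rule Suc.prems(3))
      then have "(L - cst a * X3) * (homog N c' L * f) \<in> ideal (Suc (N + e))" by (simp add: h mult.assoc)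
      then show ?thesis using False homog_cform[OF L] by blast
    qed
  qed
qed

definition zeros :: "(complex ^ 3) set" where "zeros = {P. P $ 3 = 1 \<and> q1 P = 0 \<and> q2 P = 0}"

text \<open>A homogeneous Nullstellensatz. A multiple \<open>F\<close> of \<open>f\<close> outside the ideal is constructed that
  is a common eigenvector of \<open>X1\<close> and \<open>X2\<close>, with eigenvalues \<open>a\<close> and \<open>b\<close>. Then a form \<open>r\<close> of
  degree \<open>m\<close> acts on \<open>F\<close> as \<open>r(P) X3\<^bsup>m\<^esup>\<close> with \<open>P = (a, b, 1)\<close>, so \<open>r F\<close> can be in the ideal only
  if \<open>r(P) = 0\<close>. This applies to \<open>q1\<close> and \<open>q2\<close>, and to whatever multiplies \<open>f\<close> into the ideal.\<close>

lemma ideal_separating_zero: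
  assumes f: "f \<in> cform (4 + k)" "f \<notin> ideal (1 + k)"
  obtains P where "P \<in> zeros" "\<And>m r. r \<in> cform m \<Longrightarrow> r * f \<in> ideal (m + (1 + k)) \<Longrightarrow> r P = 0"
proof -
  have X: "X1 \<in> cform 1" "X2 \<in> cform 1" by auto
  obtain c where "c \<noteq> 0 \<and> degree c \<le> 15 \<and> homog 15 c X1 * f \<in> ideal (15 + (1 + k))"
    using homog_relation[OF X(1) f(1)] by auto
  moreover have "f \<in> cform ((1 + k) + 3)" using f(1) by (simp add: eval_nat_numeral)
  ultimately obtain n v a where v: "v \<in> cform n" "v * f \<notin> ideal (n + (1 + k))" 
    "(X1 - cst a * X3) * (v * f) \<in> ideal (Suc (n + (1 + k)))"
    using eigen_multiple[OF X(1) _ f(2)] by blast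
  have vf: "v * f \<in> cform (4 + (n + k))" using v(1) f(1) by (intro cform_mult'[of _ n _ "4 + k"]) auto
  have vf': "v * f \<notin> ideal (1 + (n + k))" "v * f \<in> cform ((1 + (n + k)) + 3)" 
    using v(2) vf by (simp_all add: eval_nat_numeral)
  obtain c' where "c' \<noteq> 0 \<and> degree c' \<le> 15 \<and> homog 15 c' X2 * (v * f) \<in> ideal (15 + (1 + (n + k)))"
    using homog_relation[OF X(2) vf] by auto
  then obtain n' v' b where v': "v' \<in> cform n'" "v' * (v * f) \<notin> ideal (n' + (1 + (n + k)))" 
    "(X2 - cst b * X3) * (v' * (v * f)) \<in> ideal (Suc (n' + (1 + (n + k))))"
    using eigen_multiple[OF X(2) vf'(2,1)] by blast
  define F where "F = v' * (v * f)"
  define E where "E = n' + (1 + (n + k))"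
  have F: "F \<notin> ideal E" "F \<in> cform (E + 3)" 
    using v'(2) cform_mult'[OF v'(1) vf'(2), of "E + 3"] by (simp_all add: F_def E_def)
  have F2: "(X2 - cst b * X3) * F \<in> ideal (Suc E)" using v' by (simp add: F_def E_def)
  have "v' * ((X1 - cst a * X3) * (v * f)) \<in> ideal (Suc E)" 
    using v' v by (intro ideal_mult'[of v' n' _ "Suc (n + (1 + k))"]) (auto simp: E_def)
  then have F1: "(X1 - cst a * X3) * F \<in> ideal (Suc E)" by (simp add: F_def algebra_simps)
  define P where "P = point a b 1"
  \<comment> \<open>Modulo the ideal, \<open>r\<close> acts on \<open>F\<close> as the first summand of its decomposition at \<open>P\<close>.\<close>
  have key: "r P = 0" if r: "r \<in> cform m" "r * F \<in> ideal (m + E)" for m r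
  proof (rule ccontr)
    assume nz: "r P \<noteq> 0"
    obtain b1 b2 where b: "b1 \<in> cform (m - 1)" "b2 \<in> cform (m - 1)" 
      "r = cst (r P) * X3 ^ m + (X1 - cst a * X3) * b1 + (X2 - cst b * X3) * b2"
      using point_decomp[OF r(1), of P] by (auto simp: P_def)
    have "cst (r P) * (X3 ^ m * F) \<in> ideal (m + E)"
    proof (cases m)
      case 0
      obtain c where "r = cst c" using r(1) unfolding 0 by (rule cform_0_const)
      then have "r = cst (r P)" by simp
      then show ?thesis using r(2) 0 by (metis mult.left_neutral power_0)
    next
      case (Suc m')
      have "r * F - b1 * ((X1 - cst a * X3) * F) - b2 * ((X2 - cst b * X3) * F) \<in> ideal (m + E)"
        using ideal_mult'[OF b(1) F1, of "m + E"] ideal_mult'[OF b(2) F2, of "m + E"] r(2) Suc by simp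
      moreover have "r * F = cst (r P) * (X3 ^ m * F) + b1 * ((X1 - cst a * X3) * F) + b2 * ((X2 - cst b * X3) * F)"
        by (subst b(3)) (simp only: algebra_simps)
      ultimately show ?thesis by simp
    qed
    then have "cst (1 / r P) * (cst (r P) * (X3 ^ m * F)) \<in> ideal (m + E)" by (rule ideal_scale)
    also have "cst (1 / r P) * (cst (r P) * (X3 ^ m * F)) = X3 ^ m * F" using nz by (auto simp: fun_eq_iff)
    finally show False using cancel_X3_power_ideal[OF F(2)] F(1) by blast
  qed
  have "q1 P = 0" by (rule key[OF q1]) (use F(2) ideal_q in \<open>simp add: mult.commute add.commute\<close>)
  moreover have "q2 P = 0" by (rule key[OF q2]) (use F(2) ideal_q in \<open>simp add: mult.commute add.commute\<close>)
  ultimately have "P \<in> zeros" by (simp add: zeros_def P_def)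
  moreover have "r P = 0" if r: "r \<in> cform m" "r * f \<in> ideal (m + (1 + k))" for m r
  proof (rule key[OF r(1)])
    have "v' * (v * (r * f)) \<in> ideal (m + E)" using r v v' 
      by (intro ideal_mult'[of v' n' _ "n + (m + (1 + k))"] ideal_mult'[of v n]) (auto simp: E_def)
    then show "r * F \<in> ideal (m + E)" by (simp add: F_def algebra_simps)
  qed
  ultimately show ?thesis using that by blast
qed

end

section \<open>Partial derivatives of forms\<close>

text \<open>Forms are functions, so the partial derivative is an ordinary derivative along a
  coordinate axis; \<open>pd_cform_Suc\<close> shows that it is again a form.\<close>

definition pd :: "3 \<Rightarrow> (complex ^ 3 \<Rightarrow> complex) \<Rightarrow> complex ^ 3 \<Rightarrow> complex" where
  "pd i f v = deriv (\<lambda>t. f (v + t *s axis i 1)) 0"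

lemma cform_has_pd:
  assumes "f \<in> cform d"
  shows "((\<lambda>t. f (v + t *s axis i 1)) has_field_derivative pd i f v) (at 0)"
proof -
  obtain p where p: "\<And>t. f (v + t *s axis i 1) = poly p t" using cform_line_poly[OF assms] by blast
  have "(poly p has_field_derivative poly (pderiv p) 0) (at 0)" by (rule poly_DERIV)
  then have "((\<lambda>t. f (v + t *s axis i 1)) has_field_derivative poly (pderiv p) 0) (at 0)" unfolding p .
  then show ?thesis unfolding pd_def by (metis DERIV_imp_deriv)
qed

lemma pd_eqI: "((\<lambda>t. f (v + t *s axis i 1)) has_field_derivative c) (at 0) \<Longrightarrow> pd i f v = c"
  unfolding pd_def by (rule DERIV_imp_deriv)

lemma pd_add: assumes "f \<in> cform d" "g \<in> cform e" shows "pd i (f + g) = pd i f + pd i g"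
proof
  fix v
  show "pd i (f + g) v = (pd i f + pd i g) v"
    by (rule pd_eqI) (use DERIV_add[OF cform_has_pd[OF assms(1)] cform_has_pd[OF assms(2)]] in simp)
qed

lemma pd_mult: assumes "f \<in> cform d" "g \<in> cform e" shows "pd i (f * g) = pd i f * g + f * pd i g"
proof
  fix v
  show "pd i (f * g) v = (pd i f * g + f * pd i g) v"
    by (rule pd_eqI) (use DERIV_mult[OF cform_has_pd[OF assms(1)] cform_has_pd[OF assms(2)], of v i v i] in \<open>simp add: algebra_simps\<close>)
qed

lemma pd_cst [simp]: "pd i (cst c) = 0"
  by (rule ext, rule pd_eqI) simp

lemma pd_coord: "pd i (\<lambda>v. v $ j) = cst (if i = j then 1 else 0)"
proof (rule ext, rule pd_eqI)
  fix v :: "complex ^ 3"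
  have "((\<lambda>t. v $ j + t * (if i = j then 1 else 0)) has_field_derivative (if i = j then 1 else 0)) (at 0)"
    by (auto intro!: derivative_eq_intros)
  then show "((\<lambda>t. (v + t *s axis i 1) $ j) has_field_derivative cst (if i = j then 1 else 0) v) (at 0)"
    by (simp add: axis_def eq_commute)
qed

lemma pd_X [simp]:
  "pd 1 X1 = 1" "pd 1 X2 = 0" "pd 1 X3 = 0" "pd 2 X1 = 0" "pd 2 X2 = 1" "pd 2 X3 = 0" 
proof -
  have X: "X1 = (\<lambda>v. v $ 1)" "X2 = (\<lambda>v. v $ 2)" "X3 = (\<lambda>v. v $ 3)"
    by (auto simp: fun_eq_iff X1_def X2_def X3_def)
  show "pd 1 X1 = 1" "pd 1 X2 = 0" "pd 1 X3 = 0" "pd 2 X1 = 0" "pd 2 X2 = 1" "pd 2 X3 = 0"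
    unfolding X pd_coord by (simp_all add: fun_eq_iff)
qed

lemma pd_scale: assumes "f \<in> cform d" shows "pd i (cst c * f) = cst c * pd i f"
  using pd_mult[OF cform_cst assms, of i c] by simp

lemma pd_diff: assumes "f \<in> cform d" "g \<in> cform e" shows "pd i (f - g) = pd i f - pd i g"
proof -
  have "f - g = f + cst (-1) * g" by (simp add: fun_eq_iff)
  then have "pd i (f - g) = pd i f + cst (-1) * pd i g"
    using pd_add[OF assms(1) cform_scale[OF assms(2)]] pd_scale[OF assms(2)] by metis
  then show ?thesis by (simp add: fun_eq_iff)
qed

lemma pd_X_cst: "\<exists>c. pd i X1 = cst c" "\<exists>c. pd i X2 = cst c" "\<exists>c. pd i X3 = cst c"
proof -
  have X: "X1 = (\<lambda>v. v $ 1)" "X2 = (\<lambda>v. v $ 2)" "X3 = (\<lambda>v. v $ 3)"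
    by (auto simp: fun_eq_iff X1_def X2_def X3_def)
  show "\<exists>c. pd i X1 = cst c" "\<exists>c. pd i X2 = cst c" "\<exists>c. pd i X3 = cst c"
    unfolding X pd_coord by blast+
qed

lemma pd_cform_aux: "\<forall>f\<in>cform d. pd i f \<in> cform (d - 1) \<and> (d = 0 \<longrightarrow> pd i f = 0)"
proof (induction d)
  case 0
  show ?case
  proof
    fix f assume "f \<in> cform 0"
    then obtain c where "f = cst c" by (rule cform_0_const)
    then show "pd i f \<in> cform (0 - 1) \<and> (0 = 0 \<longrightarrow> pd i f = 0)" by simp
  qed
next
  case (Suc d)
  show ?case
  proof
    fix f assume "f \<in> cform (Suc d)"
    then obtain f1 f2 f3 where f: "f1 \<in> cform d" "f2 \<in> cform d" "f3 \<in> cform d" 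
      "f = X1 * f1 + X2 * f2 + X3 * f3" using cform_Suc_split by blast
    have Xf: "X1 * f1 \<in> cform (1 + d)" "X2 * f2 \<in> cform (1 + d)" "X3 * f3 \<in> cform (1 + d)"
      using f by (intro cform_mult cform_X; simp)+
    have eq: "pd i f = (pd i X1 * f1 + X1 * pd i f1) + (pd i X2 * f2 + X2 * pd i f2) + (pd i X3 * f3 + X3 * pd i f3)"
      using pd_add[OF cform_add[OF Xf(1,2)] Xf(3)] pd_add[OF Xf(1,2)]
        pd_mult[OF cform_X(1) f(1)] pd_mult[OF cform_X(2) f(2)] pd_mult[OF cform_X(3) f(3)] f(4) by metis
    have a: "pd i X1 * f1 \<in> cform d" "pd i X2 * f2 \<in> cform d" "pd i X3 * f3 \<in> cform d"
      using pd_X_cst[of i] f cform_scale by metis+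
    have b: "X * pd i g \<in> cform d" if "X \<in> cform 1" "g \<in> cform d" for X g
    proof (cases "d = 0")
      case True
      have "pd i g = 0" using Suc that True by blast
      then show ?thesis by simp
    next
      case False
      then show ?thesis using Suc that by (intro cform_mult'[of _ 1 _ "d - 1"]) auto
    qed
    have "pd i f \<in> cform d" unfolding eq using a b f(1-3) by (intro cform_add) auto
    then show "pd i f \<in> cform (Suc d - 1) \<and> (Suc d = 0 \<longrightarrow> pd i f = 0)" by simp
  qed
qed

lemma pd_cform: "f \<in> cform d \<Longrightarrow> pd i f \<in> cform (d - 1)"
  using pd_cform_aux by blast

lemma pd_cform_Suc: "f \<in> cform (Suc d) \<Longrightarrow> pd i f \<in> cform d"
  using pd_cform[of f "Suc d"] by simp

section \<open>Transversal pencils: Max Noether and Cayley-Bacharach\<close>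

lemma vanishing_decomp:
  assumes "f \<in> cform m" "P $ 3 = 1" "f P = 0"
  obtains b1 b2 where "b1 \<in> cform (m - 1)" "b2 \<in> cform (m - 1)" 
    "f = (X1 - cst (P$1) * X3) * b1 + (X2 - cst (P$2) * X3) * b2"
proof -
  obtain b1 b2 where b: "b1 \<in> cform (m - 1)" "b2 \<in> cform (m - 1)" 
    "f = cst (f P) * X3 ^ m + (X1 - cst (P$1) * X3) * b1 + (X2 - cst (P$2) * X3) * b2"
    using point_decomp[OF assms(1,2)] by blast
  have "cst 0 = 0" by (simp add: fun_eq_iff)
  then have "f = (X1 - cst (P$1) * X3) * b1 + (X2 - cst (P$2) * X3) * b2"
    using b(3) unfolding assms(3) by simp
  then show ?thesis using b that by blast
qed

lemma linear_at_point:
  assumes "P $ 3 = 1"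
  shows "(X1 - cst (P$1) * X3) P = 0" "(X2 - cst (P$2) * X3) P = 0"
    "X1 - cst a * X3 \<in> cform 1" "X2 - cst a * X3 \<in> cform 1"
    "pd 1 (X1 - cst a * X3) = 1" "pd 1 (X2 - cst a * X3) = 0"
    "pd 2 (X1 - cst a * X3) = 0" "pd 2 (X2 - cst a * X3) = 1"
proof -
  show "(X1 - cst (P$1) * X3) P = 0" "(X2 - cst (P$2) * X3) P = 0" 
    using assms by (simp_all add: X1_def X2_def X3_def)
  show "X1 - cst a * X3 \<in> cform 1" "X2 - cst a * X3 \<in> cform 1" by (intro cform_diff cform_scale cform_X)+
  have pdl: "pd i (X - cst a * X3) = pd i X - cst a * pd i X3" if "X \<in> cform 1" for i X
    using pd_diff[OF that cform_scale[OF cform_X(3)]] pd_scale[OF cform_X(3)] by metis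
  show "pd 1 (X1 - cst a * X3) = 1" "pd 1 (X2 - cst a * X3) = 0"
    "pd 2 (X1 - cst a * X3) = 0" "pd 2 (X2 - cst a * X3) = 1" 
    by (simp_all only: pdl[OF cform_X(1)] pdl[OF cform_X(2)] pd_X) simp_all
qed

locale transversal_pencil = pencil +
  assumes transversal: "P \<in> zeros \<Longrightarrow> pd 1 q1 P * pd 2 q2 P - pd 2 q1 P * pd 1 q2 P \<noteq> 0"
begin

text \<open>The matrix that expresses the pencil through generators of the ideal of \<open>P\<close> takes at \<open>P\<close>
  the value of the affine Jacobian matrix.\<close>

lemma pd_at_zero:
  assumes P: "P $ 3 = 1" and a: "a \<in> cform 2" "b \<in> cform 2" 
    and q: "q = (X1 - cst (P$1) * X3) * a + (X2 - cst (P$2) * X3) * b"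
  shows "pd 1 q P = a P" "pd 2 q P = b P"
proof -
  note l = linear_at_point[OF P]
  have "pd i q = (pd i (X1 - cst (P$1) * X3) * a + (X1 - cst (P$1) * X3) * pd i a) + 
     (pd i (X2 - cst (P$2) * X3) * b + (X2 - cst (P$2) * X3) * pd i b)" for i
    unfolding q using pd_add[OF cform_mult[OF l(3) a(1)] cform_mult[OF l(4) a(2)]] 
      pd_mult[OF l(3) a(1)] pd_mult[OF l(4) a(2)] by metis
  then show "pd 1 q P = a P" "pd 2 q P = b P" using l by (simp_all only: plus_fun_apply times_fun_apply) simp_all
qed

text \<open>Suppose \<open>f\<close> is not in the ideal, and let \<open>P\<close> be the zero given by \<open>ideal_separating_zero\<close>.
  All of \<open>f\<close>, \<open>q1\<close>, \<open>q2\<close> are combinations of the two linear forms that cut out \<open>P\<close>, so Cramer's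
  rule puts \<open>r f\<close> into the ideal, with \<open>r\<close> the determinant of the coefficients of \<open>q1\<close> and \<open>q2\<close>.
  Hence \<open>r(P) = 0\<close>, but \<open>r(P)\<close> is the Jacobian determinant, which transversality makes nonzero.\<close>

lemma max_noether:
  assumes f: "f \<in> cform (4 + k)" and van: "\<And>P. P \<in> zeros \<Longrightarrow> f P = 0"
  shows "f \<in> ideal (1 + k)"
proof (rule ccontr)
  assume nf: "f \<notin> ideal (1 + k)"
  obtain P where P: "P \<in> zeros" and key: "\<And>m r. r \<in> cform m \<Longrightarrow> r * f \<in> ideal (m + (1 + k)) \<Longrightarrow> r P = 0"
    using ideal_separating_zero[OF f nf] by blast
  have P3: "P $ 3 = 1" "q1 P = 0" "q2 P = 0" using P by (simp_all add: zeros_def)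
  define l1 where "l1 = X1 - cst (P$1) * X3"
  define l2 where "l2 = X2 - cst (P$2) * X3"
  obtain b1 b2 where b: "b1 \<in> cform (4 + k - 1)" "b2 \<in> cform (4 + k - 1)" "f = l1 * b1 + l2 * b2"
    using vanishing_decomp[OF f P3(1) van[OF P]] unfolding l1_def l2_def by blast
  obtain a11 a12 where a1: "a11 \<in> cform (3 - 1)" "a12 \<in> cform (3 - 1)" "q1 = l1 * a11 + l2 * a12"
    using vanishing_decomp[OF q1 P3(1,2)] unfolding l1_def l2_def by blast
  obtain a21 a22 where a2: "a21 \<in> cform (3 - 1)" "a22 \<in> cform (3 - 1)" "q2 = l1 * a21 + l2 * a22"
    using vanishing_decomp[OF q2 P3(1,3)] unfolding l1_def l2_def by blast
  have a: "a11 \<in> cform 2" "a12 \<in> cform 2" "a21 \<in> cform 2" "a22 \<in> cform 2" using a1 a2 by simp_all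
  have bb: "b1 \<in> cform (3 + k)" "b2 \<in> cform (3 + k)" using b by simp_all
  define r where "r = a11 * a22 - a12 * a21"
  have rc: "r \<in> cform 4" unfolding r_def using a by (intro cform_diff cform_mult'[of _ 2 _ 2]) auto
  have "r * f = (b1 * a22 - b2 * a21) * q1 + (b2 * a11 - b1 * a12) * q2"
    unfolding r_def b(3) a1(3) a2(3) by (simp add: algebra_simps)
  moreover have "b1 * a22 - b2 * a21 \<in> cform (4 + (1 + k))" "b2 * a11 - b1 * a12 \<in> cform (4 + (1 + k))"
    using a bb by (intro cform_diff cform_mult'[of _ "3 + k" _ 2]; simp)+
  ultimately have "r * f \<in> ideal (4 + (1 + k))" using ideal_I by metis
  then have "r P = 0" using key[OF rc] by blast
  moreover have "pd 1 q1 P = a11 P" "pd 2 q1 P = a12 P"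
    using pd_at_zero[OF P3(1) a(1,2) a1(3)[unfolded l1_def l2_def]] by blast+
  moreover have "pd 1 q2 P = a21 P" "pd 2 q2 P = a22 P"
    using pd_at_zero[OF P3(1) a(3,4) a2(3)[unfolded l1_def l2_def]] by blast+
  ultimately show False using transversal[OF P] by (simp add: r_def)
qed

end

context pencil
begin

text \<open>A product of lines through the other points separates \<open>P\<close> from them but may have a large
  degree. Reduction modulo the ideal turns it into a power of \<open>X3\<close> times a quartic, with the same
  values at the zeros because \<open>X3 = 1\<close> there.\<close>

lemma zeros_separated_by_quartics:
  assumes T: "finite T" "T \<subseteq> zeros" and P: "P \<in> T"
  shows "\<exists>f\<in>cform 4. f P = 1 \<and> (\<forall>R\<in>T - {P}. f R = 0)"
proof -
  have sep: "\<exists>l\<in>cform 1. l R = 0 \<and> l P \<noteq> 0" if R: "R \<in> T - {P}" for R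
  proof -
    have 3: "R $ 3 = 1" "P $ 3 = 1" using T P R by (auto simp: zeros_def)
    have "R $ 1 \<noteq> P $ 1 \<or> R $ 2 \<noteq> P $ 2" using R 3 by (auto simp: vec_eq_iff forall_3)
    then show ?thesis
    proof
      assume "R $ 1 \<noteq> P $ 1"
      then show ?thesis using 3 linear_at_point[OF 3(1)]
        by (intro bexI[of _ "X1 - cst (R$1) * X3"]) (simp_all add: X1_def X3_def)
    next
      assume "R $ 2 \<noteq> P $ 2"
      then show ?thesis using 3 linear_at_point[OF 3(1)]
        by (intro bexI[of _ "X2 - cst (R$2) * X3"]) (simp_all add: X2_def X3_def)
    qed
  qed
  have "\<exists>h\<in>cform (card S). h P \<noteq> 0 \<and> (\<forall>R\<in>S. h R = 0)" if "finite S" "S \<subseteq> T - {P}" for S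
    using that
  proof (induction S rule: finite_induct)
    case empty
    show ?case by (intro bexI[of _ 1]) auto
  next
    case (insert R S)
    then obtain h where h: "h \<in> cform (card S)" "h P \<noteq> 0" "\<forall>R\<in>S. h R = 0" by auto
    obtain l where l: "l \<in> cform 1" "l R = 0" "l P \<noteq> 0" using sep[of R] insert by blast
    have "l * h \<in> cform (card (insert R S))" using l h insert by (intro cform_mult'[of l 1]) auto
    then show ?case using h l by (intro bexI[of _ "l * h"]) auto
  qed
  from this[of "T - {P}"] obtain h where h: "h \<in> cform (card (T - {P}))" "h P \<noteq> 0" "\<forall>R\<in>T - {P}. h R = 0"
    using T by auto
  have "X3 ^ 4 * h \<in> cform (4 + card (T - {P}))" using h by (intro cform_mult cform_X_power)
  from reduce_to_quartic[OF this] obtain g where g: "g \<in> cform 4" 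
    "X3 ^ 4 * h - X3 ^ card (T - {P}) * g \<in> ideal (1 + card (T - {P}))" by blast
  have gR: "g R = h R" if "R \<in> T" for R
  proof -
    have R: "q1 R = 0" "q2 R = 0" "R $ 3 = 1" using that T by (auto simp: zeros_def)
    have "(X3 ^ 4 * h - X3 ^ card (T - {P}) * g) R = 0" by (rule ideal_vanish[OF g(2) R(1,2)])
    then show ?thesis using R by (simp add: X3_def)
  qed
  show ?thesis using g(1) h gR P by (intro bexI[of _ "cst (1 / h P) * g"]) auto
qed

lemma card_mons_4_1: "card (mons 4) = 15" "card (mons 1) = 3" "card (mons 3) = 10"
  using card_mons[of 4] card_mons[of 1] card_mons[of 3] by simp_all

lemma linear_span_zero:
  assumes "(\<Sum>m\<in>mons 1. cst (c m) * mon m) * q1 + (\<Sum>m\<in>mons 1. cst (d m) * mon m) * q2 = 0" "m \<in> mons 1"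
  shows "c m = 0 \<and> d m = 0"
proof -
  have "(\<Sum>m\<in>mons 1. cst (c m) * mon m) \<in> cform 1" "(\<Sum>m\<in>mons 1. cst (d m) * mon m) \<in> cform 1"
    by (intro cform_sum cform_scale cform_mon; simp)+
  from no_low_syzygy[OF this _ assms(1)] show ?thesis using cform_coeffs_unique[OF _ assms(2)] by auto
qed

text \<open>The quartics that separate ten zeros would be independent modulo the ideal, whose quartic
  part has dimension six by \<open>no_low_syzygy\<close>; but all quartics make up a space of dimension
  fifteen.\<close>

lemma card_zeros_le:
  assumes T: "finite T" "T \<subseteq> zeros" shows "card T \<le> 9"
proof (rule ccontr)
  assume "\<not> ?thesis"
  then have card: "card T \<ge> 10" by simp
  have "\<forall>P. \<exists>f. P \<in> T \<longrightarrow> f \<in> cform 4 \<and> f P = 1 \<and> (\<forall>R\<in>T - {P}. f R = 0)"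
    using zeros_separated_by_quartics[OF T] by blast
  from choice[OF this] obtain f where f: "\<And>P. P \<in> T \<Longrightarrow> f P \<in> cform 4" "\<And>P. P \<in> T \<Longrightarrow> f P P = 1" 
    "\<And>P R. P \<in> T \<Longrightarrow> R \<in> T \<Longrightarrow> R \<noteq> P \<Longrightarrow> f P R = 0" by blast
  define S where "S = Inl ` T \<union> Inr ` (UNIV \<times> mons 1 :: (bool \<times> nat \<times> nat \<times> nat) set)"
  define F where "F s = (case s of Inl P \<Rightarrow> f P | Inr (b, n) \<Rightarrow> mon n * (if b then q1 else q2))" 
    for s :: "(complex^3) + (bool \<times> nat \<times> nat \<times> nat)"
  have Fc: "F s \<in> cform 4" if "s \<in> S" for s
  proof -
    have "mon n * q \<in> cform 4" if "n \<in> mons 1" "q \<in> cform 3" for n q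
      using cform_mult'[OF cform_mon[OF that(1)] that(2)] by simp
    then show ?thesis using that f(1) q1 q2 by (auto simp: S_def F_def)
  qed
  have fS: "finite S" using T by (simp add: S_def)
  have "card S = card T + 6"
    unfolding S_def using T by (subst card_Un_disjoint) (auto simp: card_image card_cartesian_product card_mons_4_1 simp del: One_nat_def)
  then have "card (mons 4) < card S" using card by (simp add: card_mons_4_1)
  then have "\<exists>c. (\<exists>s\<in>S. c s \<noteq> 0) \<and> (\<Sum>s\<in>S. cst (c s) * F s) = 0"
    by (intro dependent_forms[OF fS Fc])
  then obtain c where c: "\<exists>s\<in>S. c s \<noteq> 0" and F0: "(\<Sum>s\<in>S. cst (c s) * F s) = 0"
    by (elim exE conjE) (rule that)
  note F0
  moreover have "(\<Sum>s\<in>S. cst (c s) * F s) = (\<Sum>P\<in>T. cst (c (Inl P)) * f P) + 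
     ((\<Sum>m\<in>mons 1. cst (c (Inr (True, m))) * mon m) * q1 + (\<Sum>m\<in>mons 1. cst (c (Inr (False, m))) * mon m) * q2)"
  proof -
    have "(\<Sum>s\<in>S. cst (c s) * F s) = (\<Sum>P\<in>T. cst (c (Inl P)) * f P) + 
       (\<Sum>x\<in>UNIV \<times> mons 1. cst (c (Inr x)) * F (Inr x))"
      unfolding S_def using T by (subst sum.union_disjoint) (auto simp: sum.reindex F_def)
    also have "(\<Sum>x\<in>UNIV \<times> mons 1. cst (c (Inr x)) * F (Inr x)) = 
      (\<Sum>b\<in>UNIV. \<Sum>m\<in>mons 1. cst (c (Inr (b, m))) * F (Inr (b, m)))"
      by (simp only: sum.cartesian_product split_def prod.collapse)
    also have "\<dots> = (\<Sum>m\<in>mons 1. cst (c (Inr (True, m))) * mon m) * q1 + (\<Sum>m\<in>mons 1. cst (c (Inr (False, m))) * mon m) * q2"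
      by (simp add: UNIV_bool F_def sum_distrib_right mult.assoc add.commute)
    finally show ?thesis .
  qed
  ultimately have eq: "(\<Sum>P\<in>T. cst (c (Inl P)) * f P) + 
     ((\<Sum>m\<in>mons 1. cst (c (Inr (True, m))) * mon m) * q1 + (\<Sum>m\<in>mons 1. cst (c (Inr (False, m))) * mon m) * q2) = 0"
    by simp
  have c0: "c (Inl R) = 0" if R: "R \<in> T" for R
  proof -
    have z: "q1 R = 0" "q2 R = 0" using R T by (auto simp: zeros_def)
    have "(\<Sum>P\<in>T. c (Inl P) * f P R) = 0" using fun_cong[OF eq, of R] z by simp
    moreover have "(\<Sum>P\<in>T. c (Inl P) * f P R) = (\<Sum>P\<in>T. if P = R then c (Inl P) else 0)"
      using f R by (intro sum.cong refl) auto
    ultimately show ?thesis using R T by simp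
  qed
  then have "(\<Sum>P\<in>T. cst (c (Inl P)) * f P) = 0" by (simp add: fun_eq_iff)
  with eq have eq2: "(\<Sum>m\<in>mons 1. cst (c (Inr (True, m))) * mon m) * q1 + (\<Sum>m\<in>mons 1. cst (c (Inr (False, m))) * mon m) * q2 = 0"
    by simp
  have "c (Inr (b, m)) = 0" if "m \<in> mons 1" for b m
    using linear_span_zero[OF eq2 that] by (cases b) auto
  with c0 c show False by (auto simp: S_def)
qed

lemma finite_zeros: "finite zeros"
proof (rule ccontr)
  assume "infinite zeros"
  then obtain T where "T \<subseteq> zeros" "finite T" "card T = 10" using infinite_arbitrarily_large by blast
  then show False using card_zeros_le[of T] by simp
qed

end

context transversal_pencil
begin

text \<open>With fewer than nine zeros, vanishing at them would leave a quartic outside the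
  six-dimensional quartic part of the ideal, against \<open>max_noether\<close>.\<close>

lemma card_zeros: "card zeros = 9"
proof (rule antisym)
  show "card zeros \<le> 9" by (rule card_zeros_le[OF finite_zeros]) simp
  show "9 \<le> card zeros"
  proof (rule ccontr)
    assume "\<not> ?thesis"
    then have card: "card zeros + card (UNIV \<times> mons 1 :: (bool \<times> nat \<times> nat \<times> nat) set) < card (mons 4)"
      by (simp add: card_cartesian_product card_mons_4_1 del: One_nat_def)
    define b where "b i = mon (snd i) * (if fst i then q1 else q2)" for i :: "bool \<times> nat \<times> nat \<times> nat"
    have bc: "b i \<in> cform 4" if "i \<in> UNIV \<times> mons 1" for i
    proof -
      have "mon (snd i) * q \<in> cform 4" if "q \<in> cform 3" for q
        using cform_mult'[OF cform_mon that, of "snd i" 1 4] \<open>i \<in> _\<close> by (simp add: mem_Times_iff)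
      then show ?thesis using q1 q2 by (simp add: b_def)
    qed
    have fI: "finite (UNIV \<times> mons 1 :: (bool \<times> nat \<times> nat \<times> nat) set)" by simp
    have "\<exists>f\<in>cform 4. (\<forall>P\<in>zeros. f P = 0) \<and> (\<forall>x. f \<noteq> (\<Sum>i\<in>UNIV \<times> mons 1. cst (x i) * b i))"
      by (rule form_outside_span[OF finite_zeros fI bc card])
    then obtain f where
      f: "f \<in> cform 4" "\<And>P. P \<in> zeros \<Longrightarrow> f P = 0" "\<And>x. f \<noteq> (\<Sum>i\<in>UNIV \<times> mons 1. cst (x i) * b i)"
      by (elim bexE conjE) (rule that; blast)
    have "f \<in> ideal (1 + 0)" by (rule max_noether) (use f in auto)
    then obtain A B where AB: "A \<in> cform 1" "B \<in> cform 1" "f = A * q1 + B * q2" unfolding ideal_def by auto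
    obtain \<alpha> where al: "A = (\<Sum>n\<in>mons 1. cst (\<alpha> n) * mon n)" using cform_sum_mon[OF AB(1)] by blast
    obtain \<beta> where be: "B = (\<Sum>n\<in>mons 1. cst (\<beta> n) * mon n)" using cform_sum_mon[OF AB(2)] by blast
    have "(\<Sum>i\<in>UNIV \<times> mons 1. cst (if fst i then \<alpha> (snd i) else \<beta> (snd i)) * b i) =
      (\<Sum>t\<in>UNIV. \<Sum>n\<in>mons 1. cst (if t then \<alpha> n else \<beta> n) * b (t, n))"
      by (simp add: sum.cartesian_product split_def)
    also have "\<dots> = f"
      by (simp add: AB(3) al be b_def UNIV_bool sum_distrib_right mult.assoc add.commute)
    finally show False using f(3)[of "\<lambda>i. if fst i then \<alpha> (snd i) else \<beta> (snd i)"] by simp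
  qed
qed

text \<open>Multiplied by either of the linear forms \<open>l1\<close>, \<open>l2\<close> that cut out \<open>P\<close>, the cubic \<open>f\<close>
  vanishes at all nine points and so lies in the ideal. Comparing \<open>l2 (l1 f)\<close> with \<open>l1 (l2 f)\<close>
  gives syzygies of degree two, which are trivial; hence \<open>l1\<close> divides the cofactors of \<open>l1 f\<close>.\<close>

lemma cayley_bacharach:
  assumes f: "f \<in> cform 3" and P: "P \<in> zeros" and van: "\<And>R. R \<in> zeros - {P} \<Longrightarrow> f R = 0"
  shows "f \<in> ideal 0"
proof -
  have P3: "P $ 3 = 1" using P by (simp add: zeros_def)
  define l1 where "l1 = X1 - cst (P$1) * X3"
  define l2 where "l2 = X2 - cst (P$2) * X3"
  have l: "l1 \<in> cform 1" "l2 \<in> cform 1" "l1 P = 0" "l2 P = 0" 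
    using linear_at_point[OF P3] unfolding l1_def l2_def by blast+
  have lf_ideal: "l * f \<in> ideal (1 + 0)" if "l \<in> cform 1" "l P = 0" for l
  proof (rule max_noether)
    show "l * f \<in> cform (4 + 0)" using that f by (intro cform_mult'[of _ 1 _ 3]) auto
    show "(l * f) R = 0" if "R \<in> zeros" for R using van[of R] \<open>l P = 0\<close> that by (cases "R = P") auto
  qed
  obtain a1 a2 where a: "a1 \<in> cform 1" "a2 \<in> cform 1" "l1 * f = a1 * q1 + a2 * q2"
    using lf_ideal[OF l(1,3)] unfolding ideal_def by auto
  obtain b1 b2 where b: "b1 \<in> cform 1" "b2 \<in> cform 1" "l2 * f = b1 * q1 + b2 * q2"
    using lf_ideal[OF l(2,4)] unfolding ideal_def by auto
  have "l2 * (a1 * q1 + a2 * q2) - l1 * (b1 * q1 + b2 * q2) = l2 * (l1 * f) - l1 * (l2 * f)" using a b by simp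
  then have "(l2 * a1 - l1 * b1) * q1 + (l2 * a2 - l1 * b2) * q2 = 0" by (simp add: algebra_simps)
  moreover have c: "l2 * a1 - l1 * b1 \<in> cform 2" "l2 * a2 - l1 * b2 \<in> cform 2"
    using a b l by (intro cform_diff cform_mult'[of _ 1 _ 1]; simp)+
  ultimately have s: "l2 * a1 - l1 * b1 = 0" "l2 * a2 - l1 * b2 = 0" using no_low_syzygy[OF c] by simp_all
  have prp: "\<exists>c. a = cst c * l1" if H: "a \<in> cform 1" "l2 * a - l1 * b = 0" for a b
  proof -
    obtain c d where cd: "c \<in> cform (1 - 1)" "d \<in> cform (1 - 1)" "a = cst (a P) * X3 ^ 1 + l1 * c + l2 * d"
      using point_decomp[OF H(1) P3] unfolding l1_def l2_def by blast
    have "c \<in> cform 0" "d \<in> cform 0" using cd by simp_all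
    then obtain c' d' where cd': "c = cst c'" "d = cst d'" by (meson cform_0_const)
    have at: "a (point (P$1) (P$2 + t) 1) = a P + t * d'" for t
      by (subst cd(3)) (simp add: cd' l1_def l2_def X1_def X2_def X3_def)
    \<comment> \<open>On the line \<open>l1 = 0\<close> the relation reads \<open>l2 a = 0\<close>.\<close>
    have "a (point (P$1) (P$2 + t) 1) = 0" if "t \<noteq> 0" for t
      using fun_cong[OF \<open>l2 * a - l1 * b = 0\<close>, of "point (P$1) (P$2 + t) 1"] that
      by (simp add: l1_def l2_def X1_def X2_def X3_def)
    from this[of 1] this[of 2] have "a P + d' = 0" "a P + 2 * d' = 0" by (simp_all add: at)
    then have "d' = 0" "a P = 0" by (simp_all add: algebra_simps add_eq_0_iff)
    then have "a = cst c' * l1" by (subst cd(3)) (simp add: cd' fun_eq_iff)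
    then show ?thesis ..
  qed
  obtain c1 where c1: "a1 = cst c1 * l1" using prp[OF a(1) s(1)] by blast
  obtain c2 where c2: "a2 = cst c2 * l1" using prp[OF a(2) s(2)] by blast
  have "l1 * f = l1 * (cst c1 * q1 + cst c2 * q2)" using a(3) by (simp add: c1 c2 algebra_simps)
  moreover have "l1 \<noteq> 0"
  proof
    assume "l1 = 0"
    then have "l1 (point (P$1 + 1) 0 1) = 0" by simp
    then show False by (simp add: l1_def X1_def X3_def)
  qed
  moreover have "cst c1 * q1 + cst c2 * q2 \<in> cform 3" using q1 q2 by simp
  ultimately have "f = cst c1 * q1 + cst c2 * q2" using cform_cancel[OF l(1) _ f] by blast
  then show ?thesis using ideal_I[OF cform_cst cform_cst] by simp
qed

text \<open>Seven points impose at most seven conditions, and the pencil accounts for two dimensions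
  of the ten-dimensional space of cubics. So there is a cubic through the seven points outside the
  pencil, and by Cayley-Bacharach it is nonzero at \<open>R\<close>.\<close>

lemma cubic_interpolation:
  assumes P: "P \<in> zeros" and R: "R \<in> zeros" "R \<noteq> P"
  shows "\<exists>h\<in>cform 3. h R = 1 \<and> (\<forall>Q\<in>zeros - {P, R}. h Q = 0)"
proof (rule ccontr)
  assume neg: "\<not> ?thesis"
  have "card (zeros - {P, R}) + card (UNIV :: bool set) < card (mons 3)"
    using P R card_zeros finite_zeros by (simp add: card_Diff_subset card_mons_4_1)
  moreover have "(if t then q1 else q2) \<in> cform 3" for t using q1 q2 by simp
  moreover have "finite (zeros - {P, R})" using finite_zeros by simp
  ultimately have "\<exists>f\<in>cform 3. (\<forall>Q\<in>zeros - {P, R}. f Q = 0) \<and> (\<forall>x. f \<noteq> (\<Sum>t\<in>UNIV. cst (x t) * (if t then q1 else q2)))"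
    by (intro form_outside_span) simp_all
  then obtain f where
    f: "f \<in> cform 3" "\<And>Q. Q \<in> zeros - {P, R} \<Longrightarrow> f Q = 0" 
      "\<And>x. f \<noteq> (\<Sum>t\<in>UNIV. cst (x t) * (if t then q1 else q2))"
    by (elim bexE conjE) (rule that; blast)
  have fR: "f R = 0"
  proof (rule ccontr)
    assume "f R \<noteq> 0"
    then have "(cst (1 / f R) * f) R = 1" by simp
    moreover have "\<forall>Q\<in>zeros - {P, R}. (cst (1 / f R) * f) Q = 0" using f(2) by simp
    moreover have "cst (1 / f R) * f \<in> cform 3" using f(1) by simp
    ultimately show False using neg by blast
  qed
  have "f Q = 0" if "Q \<in> zeros - {P}" for Q using that f(2) fR by (cases "Q = R") auto
  then have "f \<in> ideal 0" by (rule cayley_bacharach[OF f(1) P])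
  then obtain A B where AB: "A \<in> cform 0" "B \<in> cform 0" "f = A * q1 + B * q2" unfolding ideal_def by blast
  obtain \<alpha> where al: "A = cst \<alpha>" using AB(1) by (rule cform_0_const)
  obtain \<beta> where be: "B = cst \<beta>" using AB(2) by (rule cform_0_const)
  have "f = (\<Sum>t\<in>UNIV. cst (if t then \<alpha> else \<beta>) * (if t then q1 else q2))"
    by (simp add: AB(3) al be UNIV_bool add.commute)
  then show False using f(3)[of "\<lambda>t. if t then \<alpha> else \<beta>"] by contradiction
qed

end

section \<open>Derivations that preserve a pencil\<close>

lemma homog_root_power:
  "degree c \<le> N \<Longrightarrow> homog (N + k) ([:-a, 1:] ^ k * c) L = (L - cst a * X3) ^ k * homog N c L"
proof (induction k)
  case (Suc k)
  have "degree ([:-a, 1:] ^ k * c) \<le> N + k"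
    using Suc.prems degree_mult_le[of "[:-a, 1:] ^ k" c] by (simp add: degree_linear_power)
  then have "homog (Suc (N + k)) ([:-a, 1:] * ([:-a, 1:] ^ k * c)) L = (L - cst a * X3) * homog (N + k) ([:-a, 1:] ^ k * c) L"
    by (rule homog_root)
  also have "homog (N + k) ([:-a, 1:] ^ k * c) L = (L - cst a * X3) ^ k * homog N c L" by (rule Suc.IH[OF Suc.prems])
  finally have "homog (N + Suc k) ([:-a, 1:] ^ Suc k * c) L = (L - cst a * X3) ^ Suc k * homog N c L"
    by (simp only: power_Suc mult.assoc add_Suc_right)
  then show ?case .
qed simp

lemma homog_at_point:
  assumes "L P = a" "P $ 3 = 1" "degree c \<le> N"
  shows "homog N c L P = poly c a"
  using assms by (auto simp: homog_def X3_def poly_altdef intro!: sum.mono_neutral_right coeff_eq_0)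

lemma axis_line: "point x y z + (t::complex) *s axis 1 1 = point (x + t) y z" "point x y z + t *s axis 2 1 = point x (y + t) z"
  by (rule point_eqI; simp add: axis_def)+

lemma pd_0_const:
  assumes f: "f \<in> cform d" and 0: "pd i f = 0"
  shows "f (u + t *s axis i 1) = f u"
proof -
  obtain p where p: "\<And>t. f (u + t *s axis i 1) = poly p t" using cform_line_poly[OF f] by blast
  have "poly (pderiv p) t = 0" for t
  proof -
    have "((\<lambda>s. f ((u + t *s axis i 1) + s *s axis i 1)) has_field_derivative pd i f (u + t *s axis i 1)) (at 0)"
      by (rule cform_has_pd[OF f])
    moreover have "f ((u + t *s axis i 1) + s *s axis i 1) = poly p (t + s)" for s
      unfolding p[symmetric] by (simp add: vector_sadd_rdistrib add.assoc)
    ultimately have "((\<lambda>s. poly p (t + s)) has_field_derivative 0) (at 0)" by (simp add: 0)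
    moreover have "((\<lambda>s. poly p (t + s)) has_field_derivative poly (pderiv p) t) (at 0)"
      using poly_DERIV[of p t] DERIV_shift[of "poly p" "poly (pderiv p) t" 0 t] by (simp add: add.commute)
    ultimately show ?thesis using DERIV_unique by blast
  qed
  then have "pderiv p = 0" using poly_all_0_iff_0 by blast
  then obtain h where "p = [:h:]" using pderiv_iszero by blast
  then show ?thesis using p[of t] p[of 0] by simp
qed

text \<open>Such a form is a multiple of a power of \<open>X3\<close>.\<close>

lemma pd_0_vanish_infinity:
  assumes f: "f \<in> cform (Suc d)" and 0: "pd 1 f = 0" "pd 2 f = 0"
  shows "f (point x y 0) = 0"
proof -
  have "f (point x y 0) = f (point 0 y 0)" using pd_0_const[OF f 0(1), of "point 0 y 0" x] by (simp add: axis_line)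
  also have "\<dots> = f (point 0 0 0)" using pd_0_const[OF f 0(2), of "point 0 0 0" y] by (simp add: axis_line)
  also have "point 0 0 0 = 0 *s (point 0 0 0 :: complex^3)" by (rule point_eqI[symmetric]) simp_all
  also have "f \<dots> = 0" by (subst cform_scaleC[OF f]) simp
  finally show ?thesis .
qed

context pencil
begin

text \<open>Otherwise \<open>X3\<^bsup>4\<^esup>\<close> would be in the ideal; cancelling \<open>X3\<close>, so would \<open>X3\<^bsup>3\<^esup>\<close>, which would be
  a member of the pencil that vanishes at infinity, although \<open>q1\<close> and \<open>q2\<close> are independent there.\<close>

lemma zeros_nonempty: "\<exists>P. P \<in> zeros"
proof -
  have "X3 ^ 4 \<notin> ideal (1 + 0)"
  proof
    assume "X3 ^ 4 \<in> ideal (1 + 0)"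
    moreover have "X3 ^ 4 = X3 * X3 ^ 3" by (simp add: fun_eq_iff power4_eq_xxxx power3_eq_cube)
    ultimately have "X3 * X3 ^ 3 \<in> ideal (Suc 0)" by (metis One_nat_def add_0_right)
    have "X3 ^ 3 \<in> cform (0 + 3)" by simp
    then have "X3 ^ 3 \<in> ideal 0" using \<open>X3 * X3 ^ 3 \<in> ideal (Suc 0)\<close> by (rule cancel_X3_ideal)
    then obtain A B where AB: "A \<in> cform 0" "B \<in> cform 0" "X3 ^ 3 = A * q1 + B * q2" unfolding ideal_def by blast
    obtain a where a: "A = cst a" using AB(1) by (rule cform_0_const)
    obtain b where b: "B = cst b" using AB(2) by (rule cform_0_const)
    have "(A * q1 + B * q2) (point x y 0) = 0" for x y unfolding AB(3)[symmetric] by (simp add: X3_def)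
    from binary_syzygy[OF AB(1,2) this] have "a = 0" "b = 0" by (simp_all add: a b)
    then have "X3 ^ 3 = cst 0" using AB(3) by (simp add: a b fun_eq_iff)
    then have "(X3 ^ 3) (point 0 0 1) = 0" by simp
    then show False by (simp add: X3_def)
  qed
  moreover have "X3 ^ 4 \<in> cform (4 + 0)" by simp
  ultimately show ?thesis using ideal_separating_zero by metis
qed

text \<open>In the local ring of the zero set at \<open>P\<close>, the function \<open>L - L(P)\<close> is nilpotent: in the
  relation of \<open>homog_relation\<close>, all factors that belong to the other roots of \<open>c\<close> are units there.
  The form \<open>g\<close> collects these factors.\<close>

lemma local_annihilator:
  assumes P: "P \<in> zeros" and L: "L \<in> cform 1"
  shows "\<exists>k m g e. g \<in> cform m \<and> g P \<noteq> 0 \<and> (L - cst (L P) * X3) ^ k * g \<in> ideal e \<and> k + m = e + 3"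
proof -
  have P3: "P $ 3 = 1" using P by (simp add: zeros_def)
  have "X3 ^ 4 \<in> cform (4 + 0)" by simp
  from homog_relation[OF L this] obtain c where c: "c \<noteq> 0" "degree c \<le> 15" "homog 15 c L * X3 ^ 4 \<in> ideal (16 + 0)" by blast
  define k where "k = order (L P) c"
  obtain c' where c': "c = [:- L P, 1:] ^ k * c'" "\<not> [:- L P, 1:] dvd c'"
    using order_decomp[OF c(1), of "L P"] unfolding k_def by blast
  have c'0: "c' \<noteq> 0" using c'(2) by auto
  have "degree c = k + degree c'" unfolding c'(1) using c'0 by (subst degree_mult_eq) (auto simp: degree_linear_power)
  then have k: "k \<le> 15" "degree c' \<le> 15 - k" using c(2) by auto
  have "homog 15 c L = (L - cst (L P) * X3) ^ k * homog (15 - k) c' L"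
    using homog_root_power[OF k(2), of k "L P" L] k(1) by (simp add: c'(1))
  then have "(L - cst (L P) * X3) ^ k * (homog (15 - k) c' L * X3 ^ 4) \<in> ideal 16" using c(3) by (simp add: mult.assoc)
  moreover have "homog (15 - k) c' L * X3 ^ 4 \<in> cform (15 - k + 4)" using homog_cform[OF L] by (intro cform_mult) auto
  moreover have "(homog (15 - k) c' L * X3 ^ 4) P \<noteq> 0"
    using homog_at_point[of L P "L P" c', OF refl P3 k(2)] c'(2) P3 by (simp add: X3_def poly_eq_0_iff_dvd)
  moreover have "k + (15 - k + 4) = 16 + 3" using k by simp
  ultimately show ?thesis by blast
qed

text \<open>The derivation \<open>D = \<alpha> \<partial>\<^sub>1 + \<beta> \<partial>\<^sub>2\<close> maps \<open>q1\<close> and \<open>q2\<close> to multiples of themselves, so it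
  preserves the ideal. Let \<open>k\<close> be minimal with \<open>l\<^bsup>k\<^esup> g\<close> in the ideal for some \<open>g\<close> with \<open>g(P) \<noteq> 0\<close>,
  where \<open>l\<close> is a linear form through \<open>P\<close>. Applying \<open>D\<close> puts \<open>l\<^bsup>k-1\<^esup> D(l) g\<^sup>2\<close> into the ideal as
  well, which contradicts minimality unless \<open>D(l)\<close> vanishes at \<open>P\<close>. Taking for \<open>l\<close> the two affine
  coordinates centred at \<open>P\<close> gives \<open>\<alpha>\<close> and \<open>\<beta>\<close>.\<close>

lemma derivation_vanishes:
  assumes ab: "\<alpha> \<in> cform 5" "\<beta> \<in> cform 5" "\<gamma> \<in> cform 4"
    and e1: "\<alpha> * pd 1 q1 + \<beta> * pd 2 q1 + \<gamma> * q1 = 0"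
    and e2: "\<alpha> * pd 1 q2 + \<beta> * pd 2 q2 + \<gamma> * q2 = 0"
    and P: "P \<in> zeros"
  shows "\<alpha> P = 0 \<and> \<beta> P = 0"
proof -
  have P3: "P $ 3 = 1" using P by (simp add: zeros_def)
  define D where "D f = \<alpha> * pd 1 f + \<beta> * pd 2 f" for f
  have Dc: "D f \<in> cform (d + 4)" if f: "f \<in> cform d" for f d
  proof (cases d)
    case 0
    then obtain c where "f = cst c" using f cform_0_const by blast
    then show ?thesis by (simp add: D_def)
  next
    case (Suc d')
    then have "pd 1 f \<in> cform d'" "pd 2 f \<in> cform d'" using f pd_cform_Suc by blast+
    then show ?thesis unfolding D_def using ab Suc by (intro cform_add cform_mult'[of _ 5 _ d']) auto
  qed
  have Dadd: "D (f + g) = D f + D g" if "f \<in> cform d" "g \<in> cform e" for f g d e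
    using pd_add[OF that] by (simp add: D_def algebra_simps)
  have Dmult: "D (f * g) = D f * g + f * D g" if "f \<in> cform d" "g \<in> cform e" for f g d e
    using pd_mult[OF that] by (simp add: D_def algebra_simps)
  have Dq: "D q1 = - (\<gamma> * q1)" "D q2 = - (\<gamma> * q2)"
    using e1 e2 by (simp_all add: D_def eq_neg_iff_add_eq_0)
  have D_ideal: "D f \<in> ideal (e + 4)" if H: "f \<in> ideal e" for f e
  proof -
    obtain A B where AB: "A \<in> cform e" "B \<in> cform e" "f = A * q1 + B * q2" using H unfolding ideal_def by blast
    have "D f = (D A * q1 + A * D q1) + (D B * q2 + B * D q2)"
      unfolding AB(3) using Dadd[OF cform_mult[OF AB(1) q1] cform_mult[OF AB(2) q2]] Dmult[OF AB(1) q1] Dmult[OF AB(2) q2] by simp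
    also have "\<dots> = (D A - \<gamma> * A) * q1 + (D B - \<gamma> * B) * q2" by (simp add: Dq algebra_simps)
    also have "\<dots> \<in> ideal (e + 4)" using Dc[OF AB(1)] Dc[OF AB(2)] ab AB
      by (intro ideal_I cform_diff cform_mult'[of \<gamma> 4 _ e]) auto
    finally show ?thesis .
  qed
  have main: "D l P = 0" if L: "L \<in> cform 1" and l: "l = L - cst (L P) * X3" for L l
  proof (rule ccontr)
    assume nz: "D l P \<noteq> 0"
    define Q where "Q k \<longleftrightarrow> (\<exists>m g e. g \<in> cform m \<and> g P \<noteq> 0 \<and> l ^ k * g \<in> ideal e \<and> k + m = e + 3)" for k
    have "\<exists>k. Q k" using local_annihilator[OF P L] unfolding Q_def l by blast
    then have Q: "Q (LEAST k. Q k)" by (metis LeastI)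
    define k where "k = (LEAST k. Q k)"
    obtain m g e where g: "g \<in> cform m" "g P \<noteq> 0" "l ^ k * g \<in> ideal e" "k + m = e + 3" using Q unfolding Q_def k_def by blast
    have lc: "l \<in> cform 1" unfolding l using L by (intro cform_diff cform_scale cform_X) auto
    have "k \<noteq> 0"
    proof
      assume "k = 0"
      then have "g \<in> ideal e" using g by simp
      then show False using ideal_vanish[of g e P] P g(2) by (simp add: zeros_def)
    qed
    then obtain k' where k': "k = Suc k'" by (cases k) auto
    have lk: "l ^ n \<in> cform n" for n using cform_power[OF lc, of n] by simp
    have Dl: "D (l ^ Suc n) = cst (of_nat (Suc n)) * (l ^ n * D l)" for n
    proof (induction n)
      case 0
      have "cst 1 = 1" by (simp add: fun_eq_iff)
      then show ?case by simp
    next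
      case (Suc n)
      have "D (l ^ Suc (Suc n)) = D l * l ^ Suc n + l * D (l ^ Suc n)"
        using Dmult[OF lc lk[of "Suc n"]] by simp
      also have "\<dots> = cst (of_nat (Suc (Suc n))) * (l ^ Suc n * D l)"
        unfolding Suc by (simp add: fun_eq_iff algebra_simps)
      finally show ?case .
    qed
    \<comment> \<open>Multiplying by \<open>g\<close> and subtracting \<open>D g (l\<^bsup>k\<^esup> g)\<close> removes the term in which \<open>D\<close> hits
      \<open>g\<close>.\<close>
    have "g * D (l ^ k * g) \<in> ideal (m + (e + 4))" using D_ideal[OF g(3)] g(1) by (rule ideal_mult[rotated])
    moreover have "D g * (l ^ k * g) \<in> ideal (m + (e + 4))" using Dc[OF g(1)] g(3) by (rule ideal_mult') simp
    ultimately have "g * D (l ^ k * g) - D g * (l ^ k * g) \<in> ideal (m + (e + 4))" by (rule ideal_diff)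
    moreover have "D (l ^ k * g) = D (l ^ k) * g + l ^ k * D g" by (rule Dmult[OF lk g(1)])
    moreover have "D (l ^ k) = cst (of_nat k) * (l ^ k' * D l)" unfolding k' by (rule Dl)
    ultimately have "cst (of_nat k) * (l ^ k' * (D l * g * g)) \<in> ideal (m + (e + 4))" by (simp add: algebra_simps)
    then have "cst (1 / of_nat k) * (cst (of_nat k) * (l ^ k' * (D l * g * g))) \<in> ideal (m + (e + 4))" by (rule ideal_scale)
    also have "cst (1 / of_nat k) * (cst (of_nat k) * (l ^ k' * (D l * g * g))) = l ^ k' * (D l * g * g)"
      using \<open>k \<noteq> 0\<close> by (simp add: fun_eq_iff)
    finally have "l ^ k' * (D l * g * g) \<in> ideal (m + (e + 4))" .
    moreover have "D l * g * g \<in> cform (1 + 4 + m + m)" using Dc[OF lc] g(1) by (intro cform_mult)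
    moreover have "(D l * g * g) P \<noteq> 0" using nz g(2) by simp
    moreover have "k' + (1 + 4 + m + m) = m + (e + 4) + 3" using g(4) k' by simp
    ultimately have "Q k'" unfolding Q_def by blast
    then have "k \<le> k'" unfolding k_def by (rule Least_le)
    then show False using k' by simp
  qed
  note l = linear_at_point[OF P3]
  have "D (X1 - cst (X1 P) * X3) P = 0" by (rule main[OF cform_X(1) refl])
  moreover have "D (X2 - cst (X2 P) * X3) P = 0" by (rule main[OF cform_X(2) refl])
  ultimately show ?thesis by (simp add: D_def l)
qed

end

section \<open>The map defined by a net of cubics\<close>

locale net =
  fixes w1 w2 w3 :: "complex ^ 3 \<Rightarrow> complex"
  assumes w: "w1 \<in> cform 3" "w2 \<in> cform 3" "w3 \<in> cform 3"
    and base_free: "\<And>v. v \<noteq> 0 \<Longrightarrow> w1 v \<noteq> 0 \<or> w2 v \<noteq> 0 \<or> w3 v \<noteq> 0"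
begin

definition net_map :: "complex ^ 3 \<Rightarrow> complex ^ 3" where "net_map v = point (w1 v) (w2 v) (w3 v)"

lemma net_map_nth [simp]: "net_map v $ 1 = w1 v" "net_map v $ 2 = w2 v" "net_map v $ 3 = w3 v" by (simp_all add: net_map_def)

lemma comp_mon: "m \<in> mons d \<Longrightarrow> mon m \<circ> net_map \<in> cform (3 * d)"
proof -
  assume m: "m \<in> mons d"
  obtain i j k where ijk: "m = (i, j, k)" by (cases m)
  have "mon m \<circ> net_map = w1 ^ i * w2 ^ j * w3 ^ k" by (simp add: ijk fun_eq_iff mon_def)
  moreover have "w1 ^ i * w2 ^ j * w3 ^ k \<in> cform (i * 3 + j * 3 + k * 3)" using w by (intro cform_mult cform_power)
  moreover have "i * 3 + j * 3 + k * 3 = 3 * d" using m by (simp add: ijk mons_def)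
  ultimately show ?thesis by simp
qed

lemma comp_cform: assumes "F \<in> cform d" shows "F \<circ> net_map \<in> cform (3 * d)"
proof -
  obtain c where "F = (\<Sum>m\<in>mons d. cst (c m) * mon m)" using assms cform_sum_mon by blast
  then have "F \<circ> net_map = (\<Sum>m\<in>mons d. cst (c m) * (mon m \<circ> net_map))" by (simp add: fun_eq_iff)
  also have "\<dots> \<in> cform (3 * d)" by (intro cform_sum cform_scale comp_mon)
  finally show ?thesis .
qed

text \<open>Fifteen quartic monomials in \<open>w\<close> restrict to binary forms of degree twelve, which have
  only thirteen coefficients.\<close>

lemma image_of_infinity: "\<exists>G\<in>cform 4. G \<noteq> 0 \<and> (\<forall>x y. G (net_map (point x y 0)) = 0)"
proof -
  have "mon m \<circ> net_map \<in> cform 12" if "m \<in> mons 4" for m using comp_mon[OF that] by simp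
  then have "\<forall>m. \<exists>p. m \<in> mons 4 \<longrightarrow> (\<forall>x y. (mon m \<circ> net_map) (point x y 0) = binary 12 p (point x y 0))"
    using binary_restrict by blast
  from choice[OF this] obtain p where p: "\<And>m x y. m \<in> mons 4 \<Longrightarrow> mon m (net_map (point x y 0)) = binary 12 (p m) (point x y 0)" by auto
  have "card {..12::nat} < card (mons 4)" using card_mons[of 4] by simp
  from underdetermined_system[OF _ _ this, of "\<lambda>m. coeff (p m)"] obtain c where
    c: "\<exists>m\<in>mons 4. c m \<noteq> 0" "\<And>e. e \<le> 12 \<Longrightarrow> (\<Sum>m\<in>mons 4. c m * coeff (p m) e) = 0" by auto
  define G where "G = (\<Sum>m\<in>mons 4. cst (c m) * mon m)"
  have "G \<in> cform 4" unfolding G_def by (intro cform_sum cform_scale cform_mon)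
  moreover have "G \<noteq> 0" using cform_coeffs_unique[of c 4] c(1) unfolding G_def by blast
  moreover have "G (net_map (point x y 0)) = 0" for x y
  proof -
    have "G (net_map (point x y 0)) = (\<Sum>m\<in>mons 4. \<Sum>e\<le>12. c m * coeff (p m) e * (x ^ e * y ^ (12 - e)))"
      by (simp add: G_def p binary_apply sum_distrib_left mult.assoc)
    also have "\<dots> = (\<Sum>e\<le>12. (\<Sum>m\<in>mons 4. c m * coeff (p m) e) * (x ^ e * y ^ (12 - e)))"
      unfolding sum_distrib_right by (rule sum.swap)
    also have "\<dots> = 0" by (simp add: c(2))
    finally show ?thesis .
  qed
  ultimately show ?thesis by blast
qed

definition inf_curve :: "complex ^ 3 \<Rightarrow> complex" where
  "inf_curve = (SOME G. G \<in> cform 4 \<and> G \<noteq> 0 \<and> (\<forall>x y. G (net_map (point x y 0)) = 0))"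

lemma inf_curve: "inf_curve \<in> cform 4" "inf_curve \<noteq> 0" "\<And>x y. inf_curve (net_map (point x y 0)) = 0"
proof -
  have "\<exists>G. G \<in> cform 4 \<and> G \<noteq> 0 \<and> (\<forall>x y. G (net_map (point x y 0)) = 0)" using image_of_infinity by blast
  from someI_ex[OF this] have "inf_curve \<in> cform 4 \<and> inf_curve \<noteq> 0 \<and> (\<forall>x y. inf_curve (net_map (point x y 0)) = 0)" unfolding inf_curve_def .
  then show "inf_curve \<in> cform 4" "inf_curve \<noteq> 0" "\<And>x y. inf_curve (net_map (point x y 0)) = 0" by blast+
qed

text \<open>The pencil of all combinations of the \<open>w\<^sub>i\<close> whose coefficient vector annihilates \<open>c\<close>. Its
  common zeros are the points that \<open>net_map\<close> sends to the projective point \<open>c\<close>.\<close>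

definition pencil1 :: "complex ^ 3 \<Rightarrow> complex ^ 3 \<Rightarrow> complex" where "pencil1 c = cst (c$3) * w1 - cst (c$1) * w3"
definition pencil2 :: "complex ^ 3 \<Rightarrow> complex ^ 3 \<Rightarrow> complex" where "pencil2 c = cst (c$3) * w2 - cst (c$2) * w3"

lemma pencil_zero:
  assumes "c $ 3 \<noteq> 0" "v \<noteq> 0" "pencil1 c v = 0" "pencil2 c v = 0"
  obtains t where "t \<noteq> 0" "net_map v = t *s c"
proof -
  have "w1 v = w3 v / c$3 * c$1" "w2 v = w3 v / c$3 * c$2" using assms by (simp_all add: pencil1_def pencil2_def field_simps)
  then have nv: "net_map v = (w3 v / c$3) *s c" using assms(1) by (simp add: vec_eq_iff forall_3)
  moreover have "w3 v / c$3 \<noteq> 0" 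
  proof
    assume "w3 v / c$3 = 0"
    then have "net_map v = 0" using nv by simp
    then have "w1 v = 0" "w2 v = 0" "w3 v = 0" by (metis net_map_nth zero_index)+
    then show False using base_free[OF assms(2)] by blast
  qed
  ultimately show ?thesis using that by blast
qed

lemma pencil_of_generic:
  assumes "c $ 3 \<noteq> 0" "inf_curve c \<noteq> 0" shows "pencil (pencil1 c) (pencil2 c)"
proof
  show "pencil1 c \<in> cform 3" "pencil2 c \<in> cform 3" unfolding pencil1_def pencil2_def using w by simp_all
  fix v :: "complex ^ 3" assume v: "v \<noteq> 0" "v $ 3 = 0"
  show "pencil1 c v \<noteq> 0 \<or> pencil2 c v \<noteq> 0"
  proof (rule ccontr)
    assume "\<not> ?thesis"
    then obtain t where t: "t \<noteq> 0" "net_map v = t *s c" using pencil_zero[OF assms(1) v(1)] by blast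
    have "v = point (v$1) (v$2) 0" using v by (intro point_eqI) auto
    then have "inf_curve (net_map v) = 0" using inf_curve(3) by metis
    then show False using t assms(2) by (simp add: cform_scaleC[OF inf_curve(1)])
  qed
qed

text \<open>A zero of a pencil over a point off the quartic \<open>inf_curve\<close> serves as \<open>P\<close>, because its
  image is that point.\<close>

lemma generic_pencil_exists: "\<exists>c P. c $ 3 \<noteq> 0 \<and> inf_curve c \<noteq> 0 \<and> P $ 3 = 1 \<and> inf_curve (net_map P) \<noteq> 0 \<and> w3 P \<noteq> 0"
proof -
  have "inf_curve * X3 \<noteq> 0" using cform_mult_eq_0[OF inf_curve(1) cform_X(3)] inf_curve(2) by auto
  then obtain c where c: "c $ 3 \<noteq> 0" "inf_curve c \<noteq> 0" by (auto simp: fun_eq_iff X3_def)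
  interpret pencil "pencil1 c" "pencil2 c" by (rule pencil_of_generic[OF c])
  obtain P where P: "P \<in> zeros" using zeros_nonempty by blast
  then have "P $ 3 = 1" "P \<noteq> 0" "pencil1 c P = 0" "pencil2 c P = 0" by (auto simp: zeros_def)
  then obtain t where t: "t \<noteq> 0" "net_map P = t *s c" using pencil_zero[OF c(1)] by blast
  have "w3 P = t * c $ 3" using t(2) by (metis net_map_nth(3) vector_smult_component)
  moreover have "inf_curve (net_map P) \<noteq> 0" using t c by (simp add: cform_scaleC[OF inf_curve(1)])
  ultimately show ?thesis using c t \<open>P $ 3 = 1\<close> by (intro exI[of _ c] exI[of _ P]) auto
qed

text \<open>The condition on \<open>P\<close> excludes the zeros of a form that is not identically zero
  (\<open>generic_pencil_exists\<close>), and a product of nonzero forms is nonzero.\<close>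

lemma generic_vanishing:
  assumes a: "a \<in> cform d" and van: "\<And>P. P $ 3 = 1 \<Longrightarrow> inf_curve (net_map P) \<noteq> 0 \<Longrightarrow> w3 P \<noteq> 0 \<Longrightarrow> a P = 0"
  shows "a = 0"
proof -
  have GW: "inf_curve \<circ> net_map \<in> cform (3 * 4)" by (rule comp_cform[OF inf_curve(1)])
  have "(a * ((inf_curve \<circ> net_map) * w3 * X3)) v = 0" for v
  proof (cases "v $ 3 = 0")
    case False
    define P where "P = (1 / v$3) *s v"
    have P: "P $ 3 = 1" "v = v$3 *s P" using False by (simp_all add: P_def vec_eq_iff)
    have "(a * ((inf_curve \<circ> net_map) * w3)) P = 0" using van[OF P(1)] by auto
    moreover have "a * ((inf_curve \<circ> net_map) * w3) \<in> cform (d + (3 * 4 + 3))" using a GW w by (intro cform_mult)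
    ultimately have "(a * ((inf_curve \<circ> net_map) * w3)) v = 0" by (subst P(2)) (simp only: cform_scaleC mult_zero_right)
    then show ?thesis by auto
  qed (simp add: X3_def)
  then have "a * ((inf_curve \<circ> net_map) * w3 * X3) = 0" by (simp add: fun_eq_iff)
  moreover have "(inf_curve \<circ> net_map) * w3 * X3 \<in> cform (3 * 4 + 3 + 1)" using GW w by (intro cform_mult cform_X)
  ultimately have "a = 0 \<or> (inf_curve \<circ> net_map) * w3 * X3 = 0" using cform_mult_eq_0[OF a] by blast
  moreover have "(inf_curve \<circ> net_map) * w3 * X3 \<noteq> 0"
  proof
    assume *: "(inf_curve \<circ> net_map) * w3 * X3 = 0"
    obtain P where "P $ 3 = 1" "inf_curve (net_map P) \<noteq> 0" "w3 P \<noteq> 0" using generic_pencil_exists by blast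
    then show False using fun_cong[OF *, of P] by (simp add: X3_def)
  qed
  ultimately show ?thesis by blast
qed

text \<open>The determinant with rows \<open>(w\<^sub>i, \<partial>\<^sub>1 w\<^sub>i, \<partial>\<^sub>2 w\<^sub>i)\<close>. By Euler's identity it is \<open>X3 / 3\<close>
  times the usual Jacobian determinant of \<open>w\<close>. In this form it is directly related to the affine
  Jacobian of a pencil of the net at one of its zeros.\<close>

definition jacobian :: "complex ^ 3 \<Rightarrow> complex" where
  "jacobian = w1 * (pd 1 w2 * pd 2 w3 - pd 2 w2 * pd 1 w3) - pd 1 w1 * (w2 * pd 2 w3 - pd 2 w2 * w3)
    + pd 2 w1 * (w2 * pd 1 w3 - pd 1 w2 * w3)"

lemma pdw: "pd i w1 \<in> cform 2" "pd i w2 \<in> cform 2" "pd i w3 \<in> cform 2"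
  using w pd_cform[of _ 3] by fastforce+

lemma jacobian_cform: "jacobian \<in> cform 7"
proof -
  have m4: "pd i u * pd j v - pd k u' * pd l v' \<in> cform 4" 
    if "pd i u \<in> cform 2" "pd j v \<in> cform 2" "pd k u' \<in> cform 2" "pd l v' \<in> cform 2" for i j k l u v u' v'
    by (rule cform_diff; rule cform_mult'[OF that(1,2)] cform_mult'[OF that(3,4)]; simp)
  have m5: "u * pd j v - pd k u' * v' \<in> cform 5" 
    if "u \<in> cform 3" "pd j v \<in> cform 2" "pd k u' \<in> cform 2" "v' \<in> cform 3" for j k u v u' v'
    by (rule cform_diff; rule cform_mult'[OF that(1,2)] cform_mult'[OF that(3,4)]; simp)
  have "w1 * (pd 1 w2 * pd 2 w3 - pd 2 w2 * pd 1 w3) \<in> cform 7"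
    by (rule cform_mult'[OF w(1) m4[OF pdw(2) pdw(3) pdw(2) pdw(3)]]) simp
  moreover have "pd 1 w1 * (w2 * pd 2 w3 - pd 2 w2 * w3) \<in> cform 7"
    by (rule cform_mult'[OF pdw(1) m5[OF w(2) pdw(3) pdw(2) w(3)]]) simp
  moreover have "pd 2 w1 * (w2 * pd 1 w3 - pd 1 w2 * w3) \<in> cform 7"
    by (rule cform_mult'[OF pdw(1) m5[OF w(2) pdw(3) pdw(2) w(3)]]) simp
  ultimately show ?thesis unfolding jacobian_def by (intro cform_add cform_diff)
qed

lemma pd_pencil: "pd i (pencil1 c) = cst (c$3) * pd i w1 - cst (c$1) * pd i w3"
  "pd i (pencil2 c) = cst (c$3) * pd i w2 - cst (c$2) * pd i w3"
  unfolding pencil1_def pencil2_def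
  using pd_diff[OF cform_scale[OF w(1)] cform_scale[OF w(3)]] pd_diff[OF cform_scale[OF w(2)] cform_scale[OF w(3)]]
    pd_scale[OF w(1)] pd_scale[OF w(2)] pd_scale[OF w(3)] by simp_all

text \<open>The hypothesis says that a derivation, with the given \<open>2 \<times> 2\<close> minors as coefficients, maps
  each \<open>w\<^sub>i\<close> to a common multiple of itself; it therefore preserves the ideal of every pencil of
  the net. A generic point \<open>P\<close> is a zero of the pencil indexed by its own image \<open>net_map P\<close>, so
  the coefficients vanish at \<open>P\<close> by \<open>derivation_vanishes\<close>.\<close>

lemma minors_vanish:
  assumes uv: "u \<in> cform 3" "v \<in> cform 3"
    and det: "\<And>x. x \<in> {w1, w2, w3} \<Longrightarrow> - (u * pd 2 v - v * pd 2 u) * pd 1 x + (u * pd 1 v - v * pd 1 u) * pd 2 x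
       + (pd 1 u * pd 2 v - pd 2 u * pd 1 v) * x = 0"
  shows "u * pd 1 v - v * pd 1 u = 0 \<and> u * pd 2 v - v * pd 2 u = 0"
proof -
  define \<alpha> where "\<alpha> = - (u * pd 2 v - v * pd 2 u)"
  define \<beta> where "\<beta> = u * pd 1 v - v * pd 1 u"
  define \<gamma> where "\<gamma> = pd 1 u * pd 2 v - pd 2 u * pd 1 v"
  have pduv: "pd i u \<in> cform 2" "pd i v \<in> cform 2" for i using uv pd_cform[of _ 3] by fastforce+
  have c: "\<alpha> \<in> cform 5" "\<beta> \<in> cform 5" unfolding \<alpha>_def \<beta>_def using uv pduv
    by (intro cform_uminus cform_diff cform_mult'[of _ 3 _ 2]; simp)+
  have c': "\<gamma> \<in> cform 4" unfolding \<gamma>_def using pduv by (intro cform_diff cform_mult'[of _ 2 _ 2]) simp_all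
  have det': "\<alpha> * pd 1 x + \<beta> * pd 2 x + \<gamma> * x = 0" if "x \<in> {w1, w2, w3}" for x
    using det[OF that] unfolding \<alpha>_def \<beta>_def \<gamma>_def .
  have P: "\<alpha> P = 0 \<and> \<beta> P = 0" if P: "P $ 3 = 1" "inf_curve (net_map P) \<noteq> 0" "w3 P \<noteq> 0" for P
  proof -
    define c where "c = net_map P"
    have c3: "c $ 3 \<noteq> 0" "inf_curve c \<noteq> 0" using P by (simp_all add: c_def)
    interpret pencil "pencil1 c" "pencil2 c" by (rule pencil_of_generic[OF c3])
    have "pencil1 c P = 0" "pencil2 c P = 0" by (simp_all add: pencil1_def pencil2_def c_def)
    then have PZ: "P \<in> zeros" using P(1) by (simp add: zeros_def)
    have "\<alpha> * pd 1 (pencil1 c) + \<beta> * pd 2 (pencil1 c) + \<gamma> * pencil1 c = 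
      cst (c$3) * (\<alpha> * pd 1 w1 + \<beta> * pd 2 w1 + \<gamma> * w1) - cst (c$1) * (\<alpha> * pd 1 w3 + \<beta> * pd 2 w3 + \<gamma> * w3)"
      unfolding pd_pencil by (simp add: pencil1_def algebra_simps)
    then have e1: "\<alpha> * pd 1 (pencil1 c) + \<beta> * pd 2 (pencil1 c) + \<gamma> * pencil1 c = 0" by (simp add: det')
    have "\<alpha> * pd 1 (pencil2 c) + \<beta> * pd 2 (pencil2 c) + \<gamma> * pencil2 c = 
      cst (c$3) * (\<alpha> * pd 1 w2 + \<beta> * pd 2 w2 + \<gamma> * w2) - cst (c$2) * (\<alpha> * pd 1 w3 + \<beta> * pd 2 w3 + \<gamma> * w3)"
      unfolding pd_pencil by (simp add: pencil2_def algebra_simps)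
    then have e2: "\<alpha> * pd 1 (pencil2 c) + \<beta> * pd 2 (pencil2 c) + \<gamma> * pencil2 c = 0" by (simp add: det')
    show ?thesis by (rule derivation_vanishes[OF c c' e1 e2 PZ])
  qed
  have "\<alpha> = 0" by (rule generic_vanishing[OF c(1)]) (use P in blast)
  moreover have "\<beta> = 0" by (rule generic_vanishing[OF c(2)]) (use P in blast)
  ultimately show ?thesis unfolding \<alpha>_def \<beta>_def by simp
qed

text \<open>If the determinant vanished, expansion along each of its rows would give the hypothesis of
  \<open>minors_vanish\<close>, so all minors that contain the column of the \<open>w\<^sub>i\<close> would vanish. For a generic
  pencil these minors combine to syzygies of degree two. Such syzygies are trivial, so the first
  two partial derivatives of the pencil vanish, and \<open>(1, 0, 0)\<close> is a zero at infinity.\<close>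

lemma jacobian_nonzero: "jacobian \<noteq> 0"
proof
  assume J0: "jacobian = 0"
  have m12: "w1 * pd 1 w2 - w2 * pd 1 w1 = 0 \<and> w1 * pd 2 w2 - w2 * pd 2 w1 = 0"
  proof (rule minors_vanish[OF w(1,2)])
    fix x assume "x \<in> {w1, w2, w3}"
    moreover have "- (w1 * pd 2 w2 - w2 * pd 2 w1) * pd 1 w3 + (w1 * pd 1 w2 - w2 * pd 1 w1) * pd 2 w3
       + (pd 1 w1 * pd 2 w2 - pd 2 w1 * pd 1 w2) * w3 = jacobian" by (simp add: jacobian_def algebra_simps)
    ultimately show "- (w1 * pd 2 w2 - w2 * pd 2 w1) * pd 1 x + (w1 * pd 1 w2 - w2 * pd 1 w1) * pd 2 x
       + (pd 1 w1 * pd 2 w2 - pd 2 w1 * pd 1 w2) * x = 0"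
      unfolding J0 by (elim insertE emptyE) (simp_all add: algebra_simps)
  qed
  have m13: "w1 * pd 1 w3 - w3 * pd 1 w1 = 0 \<and> w1 * pd 2 w3 - w3 * pd 2 w1 = 0"
  proof (rule minors_vanish[OF w(1,3)])
    fix x assume "x \<in> {w1, w2, w3}"
    moreover have "- (w1 * pd 2 w3 - w3 * pd 2 w1) * pd 1 w2 + (w1 * pd 1 w3 - w3 * pd 1 w1) * pd 2 w2
       + (pd 1 w1 * pd 2 w3 - pd 2 w1 * pd 1 w3) * w2 = - jacobian" by (simp add: jacobian_def algebra_simps)
    ultimately show "- (w1 * pd 2 w3 - w3 * pd 2 w1) * pd 1 x + (w1 * pd 1 w3 - w3 * pd 1 w1) * pd 2 x
       + (pd 1 w1 * pd 2 w3 - pd 2 w1 * pd 1 w3) * x = 0"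
      unfolding J0 by (elim insertE emptyE) (simp_all add: algebra_simps)
  qed
  have m23: "w2 * pd 1 w3 - w3 * pd 1 w2 = 0 \<and> w2 * pd 2 w3 - w3 * pd 2 w2 = 0"
  proof (rule minors_vanish[OF w(2,3)])
    fix x assume "x \<in> {w1, w2, w3}"
    moreover have "- (w2 * pd 2 w3 - w3 * pd 2 w2) * pd 1 w1 + (w2 * pd 1 w3 - w3 * pd 1 w2) * pd 2 w1
       + (pd 1 w2 * pd 2 w3 - pd 2 w2 * pd 1 w3) * w1 = jacobian" by (simp add: jacobian_def algebra_simps)
    ultimately show "- (w2 * pd 2 w3 - w3 * pd 2 w2) * pd 1 x + (w2 * pd 1 w3 - w3 * pd 1 w2) * pd 2 x
       + (pd 1 w2 * pd 2 w3 - pd 2 w2 * pd 1 w3) * x = 0"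
      unfolding J0 by (elim insertE emptyE) (simp_all add: algebra_simps)
  qed
  obtain c where c: "c $ 3 \<noteq> 0" "inf_curve c \<noteq> 0" using generic_pencil_exists by blast
  interpret pencil "pencil1 c" "pencil2 c" by (rule pencil_of_generic[OF c])
  have pd0: "pd i (pencil1 c) = 0 \<and> pd i (pencil2 c) = 0" if i: "i = 1 \<or> i = 2" for i
  proof -
    \<comment> \<open>A \<open>2 \<times> 2\<close> minor of the pencil is a combination of those of the net.\<close>
    have "pd i (pencil2 c) * pencil1 c + (- pd i (pencil1 c)) * pencil2 c = cst (c$3 * c$3) * (w1 * pd i w2 - w2 * pd i w1)
       - cst (c$3 * c$2) * (w1 * pd i w3 - w3 * pd i w1) + cst (c$1 * c$3) * (w2 * pd i w3 - w3 * pd i w2)"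
      unfolding pd_pencil by (simp add: pencil1_def pencil2_def fun_eq_iff) (simp add: algebra_simps)
    also have "\<dots> = 0" using m12 m13 m23 i by auto
    finally have "pd i (pencil2 c) * pencil1 c + (- pd i (pencil1 c)) * pencil2 c = 0" .
    moreover have "pd i (pencil2 c) \<in> cform 2" "- pd i (pencil1 c) \<in> cform 2" unfolding pd_pencil using pdw by simp_all
    ultimately show ?thesis using no_low_syzygy[of "pd i (pencil2 c)" 2 "- pd i (pencil1 c)"] by simp
  qed
  have "pencil1 c \<in> cform (Suc 2)" "pencil2 c \<in> cform (Suc 2)" using q1 q2 by (simp_all add: eval_nat_numeral)
  then have "pencil1 c (point 1 0 0) = 0" "pencil2 c (point 1 0 0) = 0" using pd_0_vanish_infinity pd0 by blast+
  moreover have "point 1 0 0 \<noteq> (0 :: complex^3)" by (metis point_nth(1) zero_index zero_neq_one)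
  ultimately show False using good[of "point 1 0 0"] by simp
qed

text \<open>The relation \<open>F \<circ> w = jacobian K\<close> is linear in the coefficients of \<open>F\<close> and \<open>K\<close>. For \<open>F\<close> of
  degree 39 and \<open>K\<close> of degree 110 there are 820 + 6216 unknowns and 7021 equations, one for each
  monomial of degree 117; 39 is the smallest degree for which the count succeeds. Since \<open>jacobian\<close>
  is nonzero, \<open>F = 0\<close> would entail \<open>K = 0\<close>.\<close>

lemma image_of_ramification: "\<exists>F\<in>cform 39. F \<noteq> 0 \<and> (\<exists>K. F \<circ> net_map = jacobian * K)"
proof -
  define S where "S = Inl ` mons 39 \<union> Inr ` mons 110"
  define B where "B s = (case s of Inl m \<Rightarrow> mon m \<circ> net_map | Inr n \<Rightarrow> - (jacobian * mon n))" 
    for s :: "(nat \<times> nat \<times> nat) + (nat \<times> nat \<times> nat)"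
  have Bc: "B s \<in> cform 117" if "s \<in> S" for s
  proof -
    have "mon m \<circ> net_map \<in> cform 117" if "m \<in> mons 39" for m using comp_mon[OF that] by simp
    moreover have "- (jacobian * mon n) \<in> cform 117" if "n \<in> mons 110" for n
      using cform_mult'[OF jacobian_cform cform_mon[OF that], of 117] by (intro cform_uminus) simp
    ultimately show ?thesis using that by (auto simp: S_def B_def)
  qed
  have fS: "finite S" by (simp add: S_def)
  have "card S = card (mons 39) + card (mons 110)"
    unfolding S_def by (subst card_Un_disjoint) (auto simp: card_image)
  then have "card (mons 117) < card S" using card_mons[of 39] card_mons[of 110] card_mons[of 117] by simp
  then have "\<exists>c. (\<exists>s\<in>S. c s \<noteq> 0) \<and> (\<Sum>s\<in>S. cst (c s) * B s) = 0"
    by (intro dependent_forms[OF fS Bc])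
  then obtain c where c: "\<exists>s\<in>S. c s \<noteq> 0" and 0: "(\<Sum>s\<in>S. cst (c s) * B s) = 0"
    by (elim exE conjE) (rule that)
  define F where "F = (\<Sum>m\<in>mons 39. cst (c (Inl m)) * mon m)"
  define K where "K = (\<Sum>n\<in>mons 110. cst (c (Inr n)) * mon n)"
  have "(\<Sum>s\<in>S. cst (c s) * B s) = (\<Sum>m\<in>mons 39. cst (c (Inl m)) * (mon m \<circ> net_map)) + (\<Sum>n\<in>mons 110. cst (c (Inr n)) * - (jacobian * mon n))"
    unfolding S_def by (subst sum.union_disjoint) (auto simp: sum.reindex B_def)
  also have "\<dots> = (F \<circ> net_map) - jacobian * K"
    by (simp add: F_def K_def fun_eq_iff sum_negf sum_distrib_left algebra_simps)
  finally have FK: "F \<circ> net_map = jacobian * K" using 0 by simp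
  have Fc: "F \<in> cform 39" unfolding F_def by (intro cform_sum cform_scale cform_mon)
  have Kc: "K \<in> cform 110" unfolding K_def by (intro cform_sum cform_scale cform_mon)
  have "F \<noteq> 0"
  proof (rule notI)
    assume F0: "F = 0"
    have "F \<circ> net_map = 0" unfolding F0 by (rule ext) simp
    then have "jacobian * K = 0" unfolding FK .
    then have "K = 0" using cform_mult_eq_0[OF jacobian_cform Kc] jacobian_nonzero by blast
    then have "c (Inr n) = 0" if "n \<in> mons 110" for n using cform_coeffs_unique[OF _ that, of "\<lambda>n. c (Inr n)"] by (simp only: K_def)
    moreover have "c (Inl m) = 0" if "m \<in> mons 39" for m using cform_coeffs_unique[OF _ that, of "\<lambda>n. c (Inl n)"] F0 by (simp only: F_def)
    ultimately show False using c by (auto simp: S_def)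
  qed
  then show ?thesis by (intro bexI[of _ F] exI[of _ K] conjI FK Fc)
qed

text \<open>A zero \<open>P\<close> of the pencil has \<open>net_map P\<close> proportional to \<open>c\<close>. If \<open>c\<close> avoids the curve \<open>F\<close>,
  then \<open>P\<close> is not on the ramification curve, and there the Jacobian of the pencil is a nonzero
  multiple of \<open>jacobian\<close>.\<close>

theorem generic_transversal_pencil:
  "\<exists>x. x $ 3 \<noteq> 0 \<and> transversal_pencil (pencil1 (cvec x)) (pencil2 (cvec x))"
proof -
  obtain F where F: "F \<in> cform 39" "F \<noteq> 0" "\<exists>K. F \<circ> net_map = jacobian * K" using image_of_ramification by (elim bexE conjE)
  obtain K where K: "F \<circ> net_map = jacobian * K" using F(3) by (elim exE)
  have GX: "inf_curve * X3 \<noteq> 0" using cform_mult_eq_0[OF inf_curve(1) cform_X(3)] inf_curve(2) by auto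
  have GXc: "inf_curve * X3 \<in> cform (4 + 1)" using inf_curve(1) by (intro cform_mult cform_X)
  have "F * (inf_curve * X3) \<noteq> 0" using cform_mult_eq_0[OF F(1) GXc] GX F(2) by blast
  moreover have "F * (inf_curve * X3) \<in> cform (39 + (4 + 1))" using F(1) GXc by (rule cform_mult)
  ultimately obtain x where x: "(F * (inf_curve * X3)) (cvec x) \<noteq> 0" using cform_real_nonzero by blast
  define c where "c = cvec x"
  have c: "F c \<noteq> 0" "inf_curve c \<noteq> 0" "c $ 3 \<noteq> 0" using x by (auto simp: c_def X3_def)
  interpret pencil "pencil1 c" "pencil2 c" by (rule pencil_of_generic[OF c(3,2)])
  have "transversal_pencil (pencil1 c) (pencil2 c)"
  proof
    fix P assume P: "P \<in> zeros"
    then have "P \<noteq> 0" "pencil1 c P = 0" "pencil2 c P = 0" by (auto simp: zeros_def)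
    then obtain t where t: "t \<noteq> 0" "net_map P = t *s c" using pencil_zero[OF c(3)] by blast
    have wP: "w1 P = t * c$1" "w2 P = t * c$2" "w3 P = t * c$3" using t(2) by (metis net_map_nth vector_smult_component)+
    have "F (net_map P) \<noteq> 0" using t c(1) by (simp add: cform_scaleC[OF F(1)])
    then have "jacobian P \<noteq> 0" using fun_cong[OF K, of P] by auto
    \<comment> \<open>With \<open>w(P) = t c\<close> in the first column, row operations reduce the determinant to the
      Jacobian of the pencil.\<close>
    moreover have "t * (pd 1 (pencil1 c) P * pd 2 (pencil2 c) P - pd 2 (pencil1 c) P * pd 1 (pencil2 c) P) = c$3 * jacobian P"
      unfolding pd_pencil jacobian_def by (simp add: wP algebra_simps)
    ultimately show "pd 1 (pencil1 c) P * pd 2 (pencil2 c) P - pd 2 (pencil1 c) P * pd 1 (pencil2 c) P \<noteq> 0" using c(3) by auto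
  qed
  moreover have "x $ 3 \<noteq> 0" using c(3) by (simp add: c_def cvec_def)
  ultimately show ?thesis unfolding c_def by blast
qed

end

section \<open>Real forms and their complex values\<close>

definition expo :: "nat \<times> nat \<times> nat \<Rightarrow> (3 \<Rightarrow>\<^sub>0 nat)" where
  "expo m = Poly_Mapping.single 1 (fst m) + Poly_Mapping.single 2 (fst (snd m)) + Poly_Mapping.single 3 (snd (snd m))"

lemma lookup_expo [simp]: "Poly_Mapping.lookup (expo m) 1 = fst m" "Poly_Mapping.lookup (expo m) 2 = fst (snd m)"
  "Poly_Mapping.lookup (expo m) 3 = snd (snd m)"
  by (simp_all add: expo_def lookup_add lookup_single when_def)

lemma expo_lookup: "expo (Poly_Mapping.lookup k 1, Poly_Mapping.lookup k 2, Poly_Mapping.lookup k 3) = k"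
proof (rule poly_mapping_eqI)
  fix i :: 3
  show "Poly_Mapping.lookup (expo (Poly_Mapping.lookup k 1, Poly_Mapping.lookup k 2, Poly_Mapping.lookup k 3)) i = Poly_Mapping.lookup k i"
    using exhaust_3[of i] by (elim disjE) simp_all
qed

lemma expo_inj: "expo m = expo n \<longleftrightarrow> m = n"
  by (metis lookup_expo prod_eqI)

lemma monom_degree_3: "monom_degree (k :: 3 \<Rightarrow>\<^sub>0 nat) = Poly_Mapping.lookup k 1 + Poly_Mapping.lookup k 2 + Poly_Mapping.lookup k 3"
  by (simp add: monom_degree_def sum_3)

lemma expo_mons: "expo m \<in> {k. monom_degree k = d} \<longleftrightarrow> m \<in> mons d"
  by (cases m) (simp add: monom_degree_3 mons_def)

lemma expo_image: "expo ` mons d = {k. monom_degree k = d}"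
proof
  show "expo ` mons d \<subseteq> {k. monom_degree k = d}" using expo_mons by blast
  show "{k. monom_degree k = d} \<subseteq> expo ` mons d"
  proof
    fix k :: "3 \<Rightarrow>\<^sub>0 nat" assume "k \<in> {k. monom_degree k = d}"
    then have "(Poly_Mapping.lookup k 1, Poly_Mapping.lookup k 2, Poly_Mapping.lookup k 3) \<in> mons d"
      by (simp add: monom_degree_3 mons_def)
    then show "k \<in> expo ` mons d" using expo_lookup by (metis image_eqI)
  qed
qed

lemma eval_superset:
  assumes "finite S" "Poly_Mapping.keys f \<subseteq> S"
  shows "eval_mpoly f x = (\<Sum>m\<in>S. of_real (Poly_Mapping.lookup f m) * (\<Prod>i\<in>UNIV. (x $ i) ^ Poly_Mapping.lookup m i))"
  unfolding eval_mpoly_def using assms by (intro sum.mono_neutral_left) (auto simp: in_keys_iff)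

lemma eval_add: "eval_mpoly (f + g) x = eval_mpoly f x + eval_mpoly g x"
proof -
  let ?S = "Poly_Mapping.keys f \<union> Poly_Mapping.keys g"
  have "Poly_Mapping.keys (f + g) \<subseteq> ?S" by (rule Poly_Mapping.keys_add)
  then show ?thesis
    by (subst (1 2 3) eval_superset[of ?S]) (auto simp: lookup_add sum.distrib[symmetric] algebra_simps)
qed

lemma eval_zero [simp]: "eval_mpoly 0 x = 0"
  by (simp add: eval_mpoly_def)

lemma eval_sum: "eval_mpoly (\<Sum>i\<in>A. f i) x = (\<Sum>i\<in>A. eval_mpoly (f i) x)"
  by (induction A rule: infinite_finite_induct) (auto simp: eval_add)

lemma eval_single: "eval_mpoly (Poly_Mapping.single m c) x = of_real c * (\<Prod>i\<in>UNIV. (x $ i) ^ Poly_Mapping.lookup m i)"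
  by (cases "c = 0") (simp_all add: eval_mpoly_def)

lemma mpoly_sum_single: "(f :: 'n::finite real_mpoly) = (\<Sum>m\<in>Poly_Mapping.keys f. Poly_Mapping.single m (Poly_Mapping.lookup f m))"
proof (rule poly_mapping_eqI)
  fix k
  have "(\<Sum>m\<in>Poly_Mapping.keys f. Poly_Mapping.lookup (Poly_Mapping.single m (Poly_Mapping.lookup f m)) k) = 
    (\<Sum>m\<in>Poly_Mapping.keys f. if m = k then Poly_Mapping.lookup f m else 0)"
    by (intro sum.cong refl) (simp add: lookup_single when_def)
  then show "Poly_Mapping.lookup f k = Poly_Mapping.lookup (\<Sum>m\<in>Poly_Mapping.keys f. Poly_Mapping.single m (Poly_Mapping.lookup f m)) k"
    by (simp add: lookup_sum in_keys_iff)
qed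

lemma eval_mult: "eval_mpoly (f * g) x = eval_mpoly f x * eval_mpoly g x"
proof -
  have s: "eval_mpoly (Poly_Mapping.single m a * Poly_Mapping.single n b) x = 
     eval_mpoly (Poly_Mapping.single m a) x * eval_mpoly (Poly_Mapping.single n b) x" for m n a b
    by (simp add: mult_single eval_single lookup_add power_add prod.distrib)
  let ?F = "\<lambda>m. Poly_Mapping.single m (Poly_Mapping.lookup f m)"
  let ?G = "\<lambda>m. Poly_Mapping.single m (Poly_Mapping.lookup g m)"
  have "f * g = (\<Sum>m\<in>Poly_Mapping.keys f. ?F m) * (\<Sum>n\<in>Poly_Mapping.keys g. ?G n)"
    using mpoly_sum_single[of f] mpoly_sum_single[of g] by simp
  also have "\<dots> = (\<Sum>m\<in>Poly_Mapping.keys f. \<Sum>n\<in>Poly_Mapping.keys g. ?F m * ?G n)" by (rule sum_product)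
  finally have "eval_mpoly (f * g) x = (\<Sum>m\<in>Poly_Mapping.keys f. \<Sum>n\<in>Poly_Mapping.keys g. eval_mpoly (?F m) x * eval_mpoly (?G n) x)"
    by (simp only: eval_sum s)
  also have "\<dots> = eval_mpoly (\<Sum>m\<in>Poly_Mapping.keys f. ?F m) x * eval_mpoly (\<Sum>n\<in>Poly_Mapping.keys g. ?G n) x"
    unfolding eval_sum by (rule sum_product[symmetric])
  finally show ?thesis using mpoly_sum_single[of f] mpoly_sum_single[of g] by simp
qed

abbreviation scl :: "real \<Rightarrow> 'n::finite real_mpoly \<Rightarrow> 'n real_mpoly" where "scl c f \<equiv> Poly_Mapping.map ((*) c) f"

lemma lookup_scl [simp]: "Poly_Mapping.lookup (scl c f) m = c * Poly_Mapping.lookup f m"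
  by (simp add: Poly_Mapping.map.rep_eq when_def)

lemma eval_scl: "eval_mpoly (scl c f) x = of_real c * eval_mpoly f x"
proof -
  have "Poly_Mapping.keys (scl c f) \<subseteq> Poly_Mapping.keys f" by (auto simp: in_keys_iff)
  then show ?thesis
    by (subst eval_superset[of "Poly_Mapping.keys f"]) (auto simp: eval_mpoly_def sum_distrib_left mult.assoc)
qed

lemma eval_diff: "eval_mpoly (f - g) x = eval_mpoly f x - eval_mpoly g x"
  using eval_add[of "f - g" g x] by simp

lemma forms_0 [simp]: "0 \<in> forms d" by (simp add: forms_def)

lemma forms_iff: "f \<in> forms d \<longleftrightarrow> (\<forall>m. Poly_Mapping.lookup f m \<noteq> 0 \<longrightarrow> monom_degree m = d)"
  by (auto simp: forms_def in_keys_iff)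

lemma forms_add [simp]: "f \<in> forms d \<Longrightarrow> g \<in> forms d \<Longrightarrow> f + g \<in> forms d"
  unfolding forms_iff lookup_add by (metis add_0)

lemma forms_diff [simp]: "f \<in> forms d \<Longrightarrow> g \<in> forms d \<Longrightarrow> f - g \<in> forms d"
  unfolding forms_iff lookup_minus by (metis diff_zero)

lemma forms_scl [simp]: "f \<in> forms d \<Longrightarrow> scl c f \<in> forms d"
  unfolding forms_iff by simp

lemma forms_sum: "(\<And>i. i \<in> A \<Longrightarrow> f i \<in> forms d) \<Longrightarrow> (\<Sum>i\<in>A. f i) \<in> forms d"
  by (induction A rule: infinite_finite_induct) auto

lemma monom_degree_add: "monom_degree (m + n) = monom_degree m + monom_degree n"
  by (simp add: monom_degree_def lookup_add sum.distrib)

lemma forms_mult [simp]: "f \<in> forms d \<Longrightarrow> g \<in> forms e \<Longrightarrow> f * g \<in> forms (d + e)"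
  using Poly_Mapping.keys_mult[of f g] by (fastforce simp: forms_def monom_degree_add)

lemma forms_single: "m \<in> mons d \<Longrightarrow> Poly_Mapping.single (expo m) c \<in> forms d"
  unfolding forms_iff using expo_mons[of m d] by (auto simp: lookup_single when_def)

lemma prod_UNIV_3: "prod f (UNIV :: 3 set) = f 1 * f 2 * (f 3 :: 'a::comm_monoid_mult)"
proof -
  have "(2::3) \<noteq> 1" "(3::3) \<noteq> 1" "(3::3) \<noteq> 2" by simp_all
  then show ?thesis unfolding UNIV_3 by (simp add: mult.assoc)
qed

lemma mon_expo: "(\<Prod>i\<in>UNIV. (v $ i) ^ Poly_Mapping.lookup (expo m) i) = mon m v" for v :: "complex ^ 3"
  by (simp only: prod_UNIV_3 lookup_expo mon_def)

lemma eval_form: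
  assumes "f \<in> forms d"
  shows "eval_mpoly f = (\<Sum>m\<in>mons d. cst (of_real (Poly_Mapping.lookup f (expo m))) * mon m)"
proof
  fix v :: "complex ^ 3"
  have "Poly_Mapping.keys f \<subseteq> expo ` mons d" using assms by (auto simp: forms_def expo_image)
  then have "eval_mpoly f v = (\<Sum>k\<in>expo ` mons d. of_real (Poly_Mapping.lookup f k) * (\<Prod>i\<in>UNIV. (v $ i) ^ Poly_Mapping.lookup k i))"
    by (intro eval_superset) auto
  also have "\<dots> = (\<Sum>m\<in>mons d. of_real (Poly_Mapping.lookup f (expo m)) * (\<Prod>i\<in>UNIV. (v $ i) ^ Poly_Mapping.lookup (expo m) i))"
    by (subst sum.reindex) (auto simp: inj_on_def expo_inj)
  finally show "eval_mpoly f v = (\<Sum>m\<in>mons d. cst (of_real (Poly_Mapping.lookup f (expo m))) * mon m) v"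
    by (simp add: mon_expo)
qed

lemma eval_cform: "f \<in> forms d \<Longrightarrow> (eval_mpoly f :: complex ^ 3 \<Rightarrow> complex) \<in> cform d"
  by (subst eval_form) (auto intro!: cform_sum cform_scale cform_mon)

lemma eval_inject:
  assumes "f \<in> forms d" "(eval_mpoly f :: complex ^ 3 \<Rightarrow> complex) = 0" shows "f = 0"
proof (rule poly_mapping_eqI)
  fix k
  show "Poly_Mapping.lookup f k = Poly_Mapping.lookup 0 k"
  proof (cases "monom_degree k = d")
    case True
    then obtain m where m: "m \<in> mons d" "k = expo m" using expo_image[of d] by blast
    have "(\<Sum>m\<in>mons d. cst (of_real (Poly_Mapping.lookup f (expo m))) * mon m) = 0" using eval_form[OF assms(1)] assms(2) by simp
    from cform_coeffs_unique[OF this m(1)] show ?thesis using m by simp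
  next
    case False
    then show ?thesis using assms(1) by (auto simp: forms_iff)
  qed
qed

lemma eval_cvec: "eval_mpoly f (cvec x) = complex_of_real (eval_mpoly f x)"
  by (simp add: eval_mpoly_def cvec_def)

text \<open>This transfers identities from values at real points to formal polynomials.\<close>

lemma eval_real_inject:
  assumes "f \<in> forms d" "\<And>x :: real ^ 3. eval_mpoly f x = 0" shows "f = 0"
proof (rule eval_inject[OF assms(1)], rule ccontr)
  assume "eval_mpoly f \<noteq> (0 :: complex ^ 3 \<Rightarrow> complex)"
  then obtain x where "eval_mpoly f (cvec x) \<noteq> (0 :: complex)" using cform_real_nonzero[OF eval_cform[OF assms(1)]] by blast
  then show False by (simp add: eval_cvec assms(2))
qed

definition conjv :: "complex ^ 3 \<Rightarrow> complex ^ 3" where "conjv v = (\<chi> i. cnj (v $ i))"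

lemma conjv_nth [simp]: "conjv v $ i = cnj (v $ i)" by (simp add: conjv_def)
lemma conjv_conjv [simp]: "conjv (conjv v) = v" by (simp add: vec_eq_iff)
lemma conjv_eq_iff: "conjv v = w \<longleftrightarrow> v = conjv w" by (metis conjv_conjv)

lemma eval_conjv: "eval_mpoly f (conjv v) = cnj (eval_mpoly f v)"
  by (simp add: eval_mpoly_def cnj_sum cnj_prod)

lemma cform_Re_Im:
  assumes "F \<in> cform d"
  obtains a b where "a \<in> forms d" "b \<in> forms d" "\<And>v. F v = eval_mpoly a v + \<i> * eval_mpoly b v"
proof -
  obtain c where c: "F = (\<Sum>m\<in>mons d. cst (c m) * mon m)" using cform_sum_mon[OF assms] by blast
  define a where "a = (\<Sum>m\<in>mons d. Poly_Mapping.single (expo m) (Re (c m)))"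
  define b where "b = (\<Sum>m\<in>mons d. Poly_Mapping.single (expo m) (Im (c m)))"
  have "a \<in> forms d" "b \<in> forms d" unfolding a_def b_def by (intro forms_sum forms_single; assumption)+
  moreover have "F v = eval_mpoly a v + \<i> * eval_mpoly b v" for v
  proof -
    have "c m * mon m v = of_real (Re (c m)) * mon m v + \<i> * (of_real (Im (c m)) * mon m v)" for m
      by (subst complex_eq[of "c m"]) (simp add: algebra_simps)
    then show ?thesis
      by (simp add: c a_def b_def eval_sum eval_single mon_expo sum.distrib sum_distrib_left)
  qed
  ultimately show ?thesis using that by blast
qed

lemma Re_Im_zero:
  assumes "a \<in> forms d" "b \<in> forms d" "\<And>v :: complex ^ 3. eval_mpoly a v + \<i> * eval_mpoly b v = 0"
  shows "a = 0 \<and> b = 0"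
proof -
  have "complex_of_real (eval_mpoly a x) + \<i> * complex_of_real (eval_mpoly b x) = 0" for x :: "real ^ 3"
    using assms(3)[of "cvec x"] by (simp add: eval_cvec)
  then have "eval_mpoly a x = 0 \<and> eval_mpoly b x = 0" for x :: "real ^ 3"
    by (metis complex_eq_0 Im_complex_of_real Re_complex_of_real Complex_eq complex.sel mult.commute zero_complex.sel)
  then show ?thesis using eval_real_inject assms by blast
qed

section \<open>Perturbation of semidefinite forms\<close>

text \<open>Along \<open>u + t v\<close> the quadratic form is linear in \<open>t\<close> and bounded below, hence constant.\<close>

lemma psd_kernel:
  fixes B :: "'a::real_vector \<Rightarrow> 'a \<Rightarrow> real"
  assumes B: "bilinear B" and sym: "\<And>u v. B u v = B v u" and psd: "\<And>v. 0 \<le> B v v" and v: "B v v = 0"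
  shows "B v u = 0"
proof (rule ccontr)
  assume nz: "B v u \<noteq> 0"
  \<comment> \<open>This choice makes the value -1.\<close>
  define t where "t = - (B u u + 1) / (2 * B v u)"
  have "0 \<le> B (u + t *\<^sub>R v) (u + t *\<^sub>R v)" by (rule psd)
  also have "\<dots> = B u u + 2 * t * B v u + t * t * B v v"
    by (simp add: bilinear_ladd[OF B] bilinear_radd[OF B] bilinear_lmul[OF B] bilinear_rmul[OF B] sym[of u v] algebra_simps)
  also have "\<dots> = -1" using nz v by (simp add: t_def field_simps)
  finally show False by simp
qed

lemma psd_kernel_subspace:
  fixes B :: "'a::real_vector \<Rightarrow> 'a \<Rightarrow> real"
  assumes B: "bilinear B" and sym: "\<And>u v. B u v = B v u" and psd: "\<And>v. 0 \<le> B v v"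
  shows "subspace {v. B v v = 0}"
  unfolding subspace_def
  using psd_kernel[OF B sym psd]
  by (auto simp: bilinear_ladd[OF B] bilinear_radd[OF B] bilinear_lmul[OF B] bilinear_rmul[OF B] bilinear_lzero[OF B])

text \<open>Both forms descend to the orthogonal complement of the kernel of \<open>B\<close>. On its unit sphere,
  which is compact, \<open>B\<close> has a positive minimum.\<close>

lemma psd_perturb:
  fixes B M :: "'a::euclidean_space \<Rightarrow> 'a \<Rightarrow> real"
  assumes B: "bilinear B" and symB: "\<And>u v. B u v = B v u" and psd: "\<And>v. 0 \<le> B v v"
    and M: "bilinear M" and symM: "\<And>u v. M u v = M v u" and van: "\<And>u v. B v v = 0 \<Longrightarrow> M v u = 0"
  shows "\<exists>e>0. \<forall>v. 0 \<le> B v v + e * M v v"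
proof -
  define N where "N = {v. B v v = 0}"
  have N: "subspace N" unfolding N_def by (rule psd_kernel_subspace[OF B symB psd])
  define S where "S = sphere 0 1 \<inter> {u. \<forall>w\<in>N. w \<bullet> u = 0}"
  have "{u. \<forall>w\<in>N. w \<bullet> u = 0} = (\<Inter>w\<in>N. {u. w \<bullet> u = 0})" by auto
  then have "closed {u. \<forall>w\<in>N. w \<bullet> u = 0}" by (auto intro: closed_hyperplane)
  then have cS: "compact S" unfolding S_def by (intro compact_Int_closed compact_sphere)
  have contB: "continuous_on S (\<lambda>v. B v v)" 
    using B bilinear_conv_bounded_bilinear[of B] by (auto intro!: bounded_bilinear.continuous_on[of B] continuous_intros)
  have contM: "continuous_on S (\<lambda>v. M v v)" 
    using M bilinear_conv_bounded_bilinear[of M] by (auto intro!: bounded_bilinear.continuous_on[of M] continuous_intros)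
  have decomp: "\<exists>y. (\<forall>w\<in>N. w \<bullet> y = 0) \<and> B v v = B y y \<and> M v v = M y y" for v
  proof -
    obtain x y where xy: "x \<in> span N" "\<And>w. w \<in> span N \<Longrightarrow> orthogonal y w" "v = x + y"
      using orthogonal_subspace_decomp_exists by metis
    have x: "x \<in> N" using xy(1) N span_eq_iff by blast
    then have Bx: "B x x = 0" by (simp add: N_def)
    have "B v v = B y y" using psd_kernel[OF B symB psd Bx] 
      by (simp add: xy(3) bilinear_ladd[OF B] bilinear_radd[OF B] symB[of y x])
    moreover have "M v v = M y y" using van[OF Bx] 
      by (simp add: xy(3) bilinear_ladd[OF M] bilinear_radd[OF M] symM[of y x])
    moreover have "\<forall>w\<in>N. w \<bullet> y = 0" using xy(2) span_base by (auto simp: orthogonal_def inner_commute)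
    ultimately show ?thesis by blast
  qed
  have nzS: "(1 / norm y) *\<^sub>R y \<in> S" if "\<forall>w\<in>N. w \<bullet> y = 0" "y \<noteq> 0" for y
    using that by (simp add: S_def)
  \<comment> \<open>By homogeneity it suffices to treat the unit sphere of the complement.\<close>
  have suff: "\<exists>e>0. \<forall>v. 0 \<le> B v v + e * M v v" if e: "e > 0" "\<And>u. u \<in> S \<Longrightarrow> 0 \<le> B u u + e * M u u" for e
  proof (intro exI conjI allI)
    show "e > 0" by fact
    fix v
    obtain y where y: "\<forall>w\<in>N. w \<bullet> y = 0" "B v v = B y y" "M v v = M y y" using decomp by blast
    show "0 \<le> B v v + e * M v v"
    proof (cases "y = 0")
      case True
      then show ?thesis using y by (simp add: bilinear_lzero[OF B] bilinear_lzero[OF M])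
    next
      case False
      define u where "u = (1 / norm y) *\<^sub>R y"
      have "y = norm y *\<^sub>R u" using False by (simp add: u_def)
      then have yu: "K y y = (norm y)\<^sup>2 * K u u" if "bilinear K" for K :: "'a \<Rightarrow> 'a \<Rightarrow> real"
        using bilinear_lmul[OF that, of "norm y" u "norm y *\<^sub>R u"] bilinear_rmul[OF that, of u "norm y" u]
        by (simp add: power2_eq_square)
      note By = yu[OF B] and My = yu[OF M]
      have "B y y + e * M y y = (norm y)\<^sup>2 * (B u u + e * M u u)" by (simp add: By My algebra_simps)
      moreover have "0 \<le> B u u + e * M u u" using e(2) nzS[OF y(1) False] by (simp add: u_def)
      ultimately show ?thesis using y by simp
    qed
  qed
  show ?thesis
  proof (cases "S = {}")
    case True
    then show ?thesis using suff[of 1] by simp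
  next
    case False
    obtain u0 where u0: "u0 \<in> S" "\<And>u. u \<in> S \<Longrightarrow> B u0 u0 \<le> B u u"
      using continuous_attains_inf[OF cS False contB] by blast
    obtain u1 where u1: "u1 \<in> S" "\<And>u. u \<in> S \<Longrightarrow> M u1 u1 \<le> M u u"
      using continuous_attains_inf[OF cS False contM] by blast
    have "u0 \<notin> N" using u0(1) unfolding S_def by (auto simp: norm_eq_1)
    then have pos: "B u0 u0 > 0" using psd[of u0] by (auto simp: N_def less_le)
    define e where "e = B u0 u0 / (\<bar>M u1 u1\<bar> + 1)"
    have e: "e > 0" using pos by (simp add: e_def)
    have "0 \<le> B u u + e * M u u" if "u \<in> S" for u
    proof -
      have "e * (- \<bar>M u1 u1\<bar>) \<le> e * M u u" using u1(2)[OF that] e by (intro mult_left_mono) auto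
      moreover have "e * \<bar>M u1 u1\<bar> \<le> B u0 u0" using pos by (simp add: e_def field_simps)
      ultimately show ?thesis using u0(2)[OF that] by linarith
    qed
    then show ?thesis using suff[OF e] by blast
  qed
qed

text \<open>Take the largest \<open>t\<close> for which \<open>B + t M\<close> is still semidefinite; it exists because \<open>M\<close> is
  negative somewhere. If the kernel had not grown, \<open>psd_perturb\<close> would allow a larger \<open>t\<close>.\<close>

lemma psd_perturb_to_boundary:
  fixes B M :: "'a::euclidean_space \<Rightarrow> 'a \<Rightarrow> real"
  assumes B: "bilinear B" and symB: "\<And>u v. B u v = B v u" and psd: "\<And>v. 0 \<le> B v v"
    and M: "bilinear M" and symM: "\<And>u v. M u v = M v u" and van: "\<And>u v. B v v = 0 \<Longrightarrow> M v u = 0"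
    and neg: "M v0 v0 < 0"
  shows "\<exists>t\<ge>0. (\<forall>v. 0 \<le> B v v + t * M v v) \<and> {v. B v v = 0} \<subset> {v. B v v + t * M v v = 0}"
proof -
  define T where "T = {t. 0 \<le> t \<and> (\<forall>v. 0 \<le> B v v + t * M v v)}"
  have T0: "0 \<in> T" using psd by (simp add: T_def)
  have bdd: "bdd_above T"
  proof
    fix t assume "t \<in> T"
    then have "0 \<le> B v0 v0 + t * M v0 v0" by (simp add: T_def)
    then show "t \<le> B v0 v0 / (- M v0 v0)" using neg by (simp add: field_simps)
  qed
  have "closed T"
  proof -
    have "T = {0..} \<inter> (\<Inter>v. {t. 0 \<le> B v v + t * M v v})" by (auto simp: T_def)
    moreover have "closed {t. 0 \<le> B v v + t * M v v}" for v
      by (intro closed_Collect_le continuous_intros)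
    ultimately show ?thesis by (simp add: closed_INT closed_Int)
  qed
  define t where "t = Sup T"
  have t: "t \<in> T" unfolding t_def using closed_contains_Sup[OF _ bdd \<open>closed T\<close>] T0 by blast
  define B' where "B' u v = B u v + t * M u v" for u v
  have B': "bilinear B'" unfolding bilinear_def B'_def
    using B M unfolding bilinear_def by (auto intro!: linear_compose_add linear_compose_scale_right simp: linear_iff algebra_simps)
  have psd': "\<And>v. 0 \<le> B' v v" using t by (simp add: T_def B'_def)
  have sym': "\<And>u v. B' u v = B' v u" using symB symM unfolding B'_def by metis
  have sub: "{v. B v v = 0} \<subseteq> {v. B' v v = 0}" using van by (auto simp: B'_def)
  have "{v. B v v = 0} \<noteq> {v. B' v v = 0}"
  proof
    assume eq: "{v. B v v = 0} = {v. B' v v = 0}"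
    have van': "\<And>u v. B' v v = 0 \<Longrightarrow> M v u = 0" using van eq by blast
    obtain e where e: "e > 0" "\<forall>v. 0 \<le> B' v v + e * M v v" using psd_perturb[OF B' sym' psd' M symM van'] by blast
    then have "t + e \<in> T" using t by (simp add: T_def B'_def algebra_simps)
    then have "t + e \<le> t" unfolding t_def by (rule cSup_upper[OF _ bdd])
    then show False using e by simp
  qed
  with sub have "{v. B v v = 0} \<subset> {v. B' v v = 0}" by blast
  then show ?thesis using t unfolding B'_def T_def by blast
qed

section \<open>Coordinates on cubics and sextics\<close>

lemma card_mons_3_6: "card (mons 3) = 10" "card (mons 6) = 28"
  using card_mons[of 3] card_mons[of 6] by simp_all

text \<open>Arbitrary enumerations of the monomials. They identify cubics and sextics with Euclidean
  spaces, where compactness and separation theorems are available; a functional on sextics becomes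
  an inner product with \<open>\<kappa>\<close>.\<close>

definition cubic_index :: "10 \<Rightarrow> nat \<times> nat \<times> nat" where "cubic_index = (SOME f. bij_betw f UNIV (mons 3))"
definition sextic_index :: "28 \<Rightarrow> nat \<times> nat \<times> nat" where "sextic_index = (SOME f. bij_betw f UNIV (mons 6))"

lemma bij_cubic_index: "bij_betw cubic_index UNIV (mons 3)"
proof -
  have "\<exists>f. bij_betw f (UNIV :: 10 set) (mons 3)" by (intro finite_same_card_bij) (simp_all add: card_mons_3_6)
  from someI_ex[OF this] show ?thesis unfolding cubic_index_def .
qed

lemma bij_sextic_index: "bij_betw sextic_index UNIV (mons 6)"
proof -
  have "\<exists>f. bij_betw f (UNIV :: 28 set) (mons 6)" by (intro finite_same_card_bij) (simp_all add: card_mons_3_6)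
  from someI_ex[OF this] show ?thesis unfolding sextic_index_def .
qed

definition cubic :: "real ^ 10 \<Rightarrow> 3 real_mpoly" where "cubic v = (\<Sum>i\<in>UNIV. Poly_Mapping.single (expo (cubic_index i)) (v $ i))"
definition \<kappa> :: "3 real_mpoly \<Rightarrow> real ^ 28" where "\<kappa> f = (\<chi> i. Poly_Mapping.lookup f (expo (sextic_index i)))"

lemma cubic_forms [simp]: "cubic v \<in> forms 3"
  unfolding cubic_def using bij_cubic_index by (intro forms_sum forms_single) (auto simp: bij_betw_def)

lemma lookup_cubic: "Poly_Mapping.lookup (cubic v) (expo (cubic_index j)) = v $ j"
proof -
  have "Poly_Mapping.lookup (cubic v) (expo (cubic_index j)) = (\<Sum>i\<in>UNIV. if i = j then v $ i else 0)"
    unfolding cubic_def lookup_sum using bij_cubic_index 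
    by (intro sum.cong refl) (auto simp: lookup_single when_def expo_inj bij_betw_def inj_on_def)
  then show ?thesis by simp
qed

lemma forms_cubic: assumes "f \<in> forms 3" obtains v where "f = cubic v"
proof
  show "f = cubic (\<chi> i. Poly_Mapping.lookup f (expo (cubic_index i)))" (is "f = cubic ?v")
  proof (rule poly_mapping_eqI)
    fix k
    show "Poly_Mapping.lookup f k = Poly_Mapping.lookup (cubic ?v) k"
    proof (cases "monom_degree k = 3")
      case True
      then obtain m where "m \<in> mons 3" "k = expo m" using expo_image[of 3] by blast
      moreover obtain j where "m = cubic_index j" using \<open>m \<in> mons 3\<close> bij_cubic_index by (auto simp: bij_betw_def)
      ultimately show ?thesis by (simp add: lookup_cubic)
    next
      case False
      then show ?thesis using assms cubic_forms[of ?v] unfolding forms_iff by metis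
    qed
  qed
qed

lemma cubic_add: "cubic (u + v) = cubic u + cubic v"
  by (simp add: cubic_def single_add sum.distrib)

lemma scl_sum: "scl c (\<Sum>i\<in>A. f i) = (\<Sum>i\<in>A. scl c (f i))"
  by (rule poly_mapping_eqI) (simp add: lookup_sum sum_distrib_left)

lemma scl_single: "scl c (Poly_Mapping.single m a) = Poly_Mapping.single m (c * a)"
  by (rule poly_mapping_eqI) (simp add: lookup_single when_def)

lemma cubic_scale: "cubic (c *\<^sub>R v) = scl c (cubic v)"
  by (simp add: cubic_def scl_sum scl_single)

lemma scl_mult: "scl c f * g = scl c (f * g)" "f * scl c g = scl c (f * g)"
  by (simp_all add: mult_map_scale_conv_mult mult_ac)

lemma \<kappa>_add: "\<kappa> (f + g) = \<kappa> f + \<kappa> g" by (simp add: \<kappa>_def vec_eq_iff lookup_add)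
lemma \<kappa>_diff: "\<kappa> (f - g) = \<kappa> f - \<kappa> g" by (simp add: \<kappa>_def vec_eq_iff lookup_minus)
lemma \<kappa>_scl: "\<kappa> (scl c f) = c *\<^sub>R \<kappa> f" by (simp add: \<kappa>_def vec_eq_iff)
lemma \<kappa>_0 [simp]: "\<kappa> 0 = 0" by (simp add: \<kappa>_def vec_eq_iff)

lemma \<kappa>_inject: assumes "f \<in> forms 6" "\<kappa> f = 0" shows "f = 0"
proof (rule poly_mapping_eqI)
  fix k
  show "Poly_Mapping.lookup f k = Poly_Mapping.lookup 0 k"
  proof (cases "monom_degree k = 6")
    case True
    then obtain m where m: "m \<in> mons 6" "k = expo m" using expo_image[of 6] by blast
    obtain j where "m = sextic_index j" using m(1) bij_sextic_index by (auto simp: bij_betw_def)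
    then have "Poly_Mapping.lookup f k = \<kappa> f $ j" using m by (simp add: \<kappa>_def)
    then show ?thesis using assms by simp
  next
    case False
    then show ?thesis using assms(1) unfolding forms_iff by auto
  qed
qed

lemma bilinear_square: "bilinear (\<lambda>u v. \<kappa> (cubic u * cubic v))"
  unfolding bilinear_def linear_iff by (simp add: cubic_add cubic_scale \<kappa>_add \<kappa>_scl scl_mult algebra_simps)

definition ev_functional :: "complex \<Rightarrow> complex ^ 3 \<Rightarrow> real ^ 28" where
  "ev_functional \<eta> z = (\<chi> i. Re (\<eta> * mon (sextic_index i) z))"

lemma ev_functional: assumes "f \<in> forms 6" shows "ev_functional \<eta> z \<bullet> \<kappa> f = Re (\<eta> * eval_mpoly f z)"
proof -
  have "eval_mpoly f z = (\<Sum>m\<in>mons 6. of_real (Poly_Mapping.lookup f (expo m)) * mon m z)"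
    by (subst eval_form[OF assms]) simp
  also have "\<dots> = (\<Sum>i\<in>UNIV. of_real (Poly_Mapping.lookup f (expo (sextic_index i))) * mon (sextic_index i) z)"
    by (rule sum.reindex_bij_betw[OF bij_sextic_index, symmetric])
  finally have "Re (\<eta> * eval_mpoly f z) = (\<Sum>i\<in>UNIV. Re (\<eta> * mon (sextic_index i) z) * Poly_Mapping.lookup f (expo (sextic_index i)))"
    by (simp add: sum_distrib_left sum_distrib_right Re_sum algebra_simps)
  then show ?thesis by (simp add: ev_functional_def \<kappa>_def inner_vec_def)
qed

section \<open>The cone of sums of squares\<close>

lemma sos_add: assumes "r \<in> sos_forms d" "s \<in> sos_forms d" shows "r + s \<in> sos_forms d"
proof -
  obtain k :: nat and q where q: "\<forall>i<k. q i \<in> forms d" "r = (\<Sum>i<k. (q i)\<^sup>2)" using assms(1) unfolding sos_forms_def by blast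
  obtain k' :: nat and q' where q': "\<forall>i<k'. q' i \<in> forms d" "s = (\<Sum>i<k'. (q' i)\<^sup>2)" using assms(2) unfolding sos_forms_def by blast
  define Q where "Q i = (if i < k then q i else q' (i - k))" for i
  have "(\<Sum>i<k + k'. (Q i)\<^sup>2) = (\<Sum>i<k. (Q i)\<^sup>2) + (\<Sum>i\<in>{k..<k + k'}. (Q i)\<^sup>2)"
    by (subst sum.union_disjoint[symmetric]) (auto intro: sum.cong)
  also have "(\<Sum>i<k. (Q i)\<^sup>2) = r" by (simp add: Q_def q)
  also have "(\<Sum>i\<in>{k..<k + k'}. (Q i)\<^sup>2) = s" unfolding q'
    by (rule sum.reindex_bij_witness[of _ "\<lambda>i. i + k" "\<lambda>i. i - k"]) (auto simp: Q_def)
  finally have "r + s = (\<Sum>i<k + k'. (Q i)\<^sup>2)" by simp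
  moreover have "\<forall>i<k + k'. Q i \<in> forms d" using q q' by (auto simp: Q_def)
  moreover have "r + s \<in> forms (2 * d)" using assms by (simp add: sos_forms_def)
  ultimately show ?thesis unfolding sos_forms_def by blast
qed

lemma sos_square: assumes "q \<in> forms d" shows "q\<^sup>2 \<in> sos_forms d"
  unfolding sos_forms_def using assms forms_mult[OF assms assms]
  by (auto simp: power2_eq_square mult_2 intro!: exI[of _ 1] exI[of _ "\<lambda>_. q"])

lemma sos_scale: fixes r :: "'n::finite real_mpoly" assumes "r \<in> sos_forms d" "0 \<le> c" shows "scl c r \<in> sos_forms d"
proof -
  obtain k :: nat and q where q: "\<forall>i<k. q i \<in> forms d" "r = (\<Sum>i<k. (q i)\<^sup>2)" using assms(1) unfolding sos_forms_def by blast
  have "scl a (scl b f) = scl (a * b) f" for a b and f :: "'n real_mpoly" by (rule poly_mapping_eqI) simp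
  then have "(scl (sqrt c) f)\<^sup>2 = scl c (f\<^sup>2)" for f :: "'n real_mpoly"
    using assms(2) by (simp add: power2_eq_square scl_mult)
  then have "scl c r = (\<Sum>i<k. (scl (sqrt c) (q i))\<^sup>2)" by (simp add: q scl_sum)
  moreover have "scl c r \<in> forms (2 * d)" using assms by (simp add: sos_forms_def)
  ultimately show ?thesis unfolding sos_forms_def using q(1) by (auto intro!: exI[of _ k] exI[of _ "\<lambda>i. scl (sqrt c) (q i)"])
qed

text \<open>The squares of cubics from the unit sphere form a compact set whose convex hull does not
  contain 0, since every such square is positive at some real point. So the cone over the hull is
  closed. It consists of sums of squares, and \<open>p\<close> can be separated from it.\<close>

lemma separating_functional:
  assumes p: "p \<in> forms 6" "p \<notin> sos_forms 3"
  obtains a where "a \<bullet> \<kappa> p < 0" "\<And>v. 0 \<le> a \<bullet> \<kappa> (cubic v * cubic v)"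
proof -
  define S where "S = (\<lambda>v. \<kappa> (cubic v * cubic v)) ` sphere 0 1"
  have "continuous_on (sphere 0 1) (\<lambda>v. \<kappa> (cubic v * cubic v))"
    using bilinear_square bilinear_conv_bounded_bilinear[of "\<lambda>u v. \<kappa> (cubic u * cubic v)"]
    by (auto intro!: bounded_bilinear.continuous_on[of "\<lambda>u v. \<kappa> (cubic u * cubic v)"] continuous_intros)
  then have "compact S" unfolding S_def by (intro compact_continuous_image compact_sphere)
  then have cH: "compact (convex hull S)" by (rule compact_convex_hull)
  have CC: "cubic v * cubic v \<in> forms 6" for v using forms_mult[OF cubic_forms cubic_forms] by simp
  \<comment> \<open>A convex set that contains \<open>S\<close> but not 0.\<close>
  define T where "T = {y. (\<forall>x. 0 \<le> ev_functional 1 (cvec x) \<bullet> y) \<and> (\<exists>x. 0 < ev_functional 1 (cvec x) \<bullet> y)}"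
  have evS: "ev_functional 1 (cvec x) \<bullet> \<kappa> (cubic v * cubic v) = (eval_mpoly (cubic v) x)\<^sup>2" for x v
    by (simp add: ev_functional[OF CC] eval_mult eval_cvec power2_eq_square)
  have "S \<subseteq> T"
  proof
    fix y assume "y \<in> S"
    then obtain v where v: "norm v = 1" "y = \<kappa> (cubic v * cubic v)" by (auto simp: S_def)
    have "\<exists>x. eval_mpoly (cubic v) x \<noteq> (0::real)"
    proof (rule ccontr)
      assume "\<not> ?thesis"
      then have "cubic v = 0" using eval_real_inject[OF cubic_forms] by blast
      then have "v $ j = 0" for j using lookup_cubic[of v j] by simp
      then have "v = 0" by (simp add: vec_eq_iff)
      then show False using v by simp
    qed
    then show "y \<in> T" by (auto simp: T_def v evS)
  qed
  moreover have "convex T"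
  proof (rule convexI)
    fix y z u v assume yz: "y \<in> T" "z \<in> T" "0 \<le> (u::real)" "0 \<le> v" "u + v = 1"
    then have nn: "0 \<le> ev_functional 1 (cvec x) \<bullet> y" "0 \<le> ev_functional 1 (cvec x) \<bullet> z" for x by (auto simp: T_def)
    have "\<exists>x. 0 < ev_functional 1 (cvec x) \<bullet> (u *\<^sub>R y + v *\<^sub>R z)"
    proof (cases "u = 0")
      case True
      then show ?thesis using yz by (auto simp: T_def)
    next
      case False
      obtain x where "0 < ev_functional 1 (cvec x) \<bullet> y" using yz by (auto simp: T_def)
      then have "0 < u * (ev_functional 1 (cvec x) \<bullet> y) + v * (ev_functional 1 (cvec x) \<bullet> z)"
        using False yz nn[of x] by (intro add_pos_nonneg mult_pos_pos mult_nonneg_nonneg) auto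
      then show ?thesis by (auto simp: inner_add_right)
    qed
    then show "u *\<^sub>R y + v *\<^sub>R z \<in> T" using nn yz by (auto simp: T_def inner_add_right)
  qed
  ultimately have "convex hull S \<subseteq> T" by (rule hull_minimal)
  then have "0 \<notin> convex hull S" by (auto simp: T_def)
  then have cl: "closed (conic hull (convex hull S))" using closed_conic_hull cH by blast
  have cv: "convex (conic hull (convex hull S))" by (intro convex_conic_hull convex_convex_hull)
  define Q where "Q = \<kappa> ` sos_forms 3"
  have Qadd: "y + z \<in> Q" if H: "y \<in> Q" "z \<in> Q" for y z 
  proof -
    obtain r s where "r \<in> sos_forms 3" "s \<in> sos_forms 3" "y = \<kappa> r" "z = \<kappa> s" using H unfolding Q_def by blast
    then show ?thesis unfolding Q_def using sos_add[of r 3 s] by (auto simp: \<kappa>_add intro!: image_eqI[of _ _ "r + s"])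
  qed
  have Qscale: "c *\<^sub>R y \<in> Q" if H: "y \<in> Q" "0 \<le> c" for y c
  proof -
    obtain r where "r \<in> sos_forms 3" "y = \<kappa> r" using H unfolding Q_def by blast
    then show ?thesis unfolding Q_def using sos_scale[of r 3 c] H(2) by (auto simp: \<kappa>_scl intro!: image_eqI[of _ _ "scl c r"])
  qed
  have "S \<subseteq> Q" using sos_square[OF cubic_forms] by (auto simp: S_def Q_def power2_eq_square)
  moreover have "convex Q" by (rule convexI) (simp add: Qadd Qscale)
  ultimately have "convex hull S \<subseteq> Q" by (rule hull_minimal)
  then have KQ: "conic hull (convex hull S) \<subseteq> Q" using Qscale by (auto simp: conic_hull_explicit)
  have "\<kappa> p \<notin> conic hull (convex hull S)"
  proof
    assume "\<kappa> p \<in> conic hull (convex hull S)"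
    then obtain r where r: "r \<in> sos_forms 3" "\<kappa> p = \<kappa> r" using KQ by (auto simp: Q_def)
    then have "p - r = 0" using p(1) by (intro \<kappa>_inject) (auto simp: \<kappa>_diff sos_forms_def)
    then show False using p(2) r by simp
  qed
  from separating_hyperplane_closed_point[OF cv cl this] obtain a b where
    ab: "a \<bullet> \<kappa> p < b" "\<And>y. y \<in> conic hull (convex hull S) \<Longrightarrow> b < a \<bullet> y" by blast
  have KS: "c *\<^sub>R y \<in> conic hull (convex hull S)" if "y \<in> S" "0 \<le> c" for y c
    using that hull_inc[of y S convex] by (auto simp: conic_hull_explicit)
  obtain e :: "real ^ 10" where e: "norm e = 1" using vector_choose_size[of 1] by auto
  have "\<kappa> (cubic e * cubic e) \<in> S" using e by (auto simp: S_def)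
  from ab(2)[OF KS[OF this, of 0]] have b0: "b < 0" by simp
  have pos: "0 \<le> a \<bullet> y" if "y \<in> S" for y
  proof (rule ccontr)
    assume "\<not> ?thesis"
    then have neg: "a \<bullet> y < 0" by simp
    then have "0 \<le> b / (a \<bullet> y)" using b0 by (simp add: divide_nonpos_neg)
    from ab(2)[OF KS[OF that this]] show False using neg by simp
  qed
  \<comment> \<open>Squares scale quadratically, so the unit sphere suffices.\<close>
  have "0 \<le> a \<bullet> \<kappa> (cubic v * cubic v)" for v
  proof (cases "v = 0")
    case True
    have "cubic 0 = 0" by (simp add: cubic_def)
    then show ?thesis using True by simp
  next
    case False
    define u where "u = (1 / norm v) *\<^sub>R v"
    have u: "norm u = 1" "v = norm v *\<^sub>R u" using False by (simp_all add: u_def)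
    have "\<kappa> (cubic v * cubic v) = norm v *\<^sub>R norm v *\<^sub>R \<kappa> (cubic u * cubic u)" by (subst (1 2) u(2)) (simp add: cubic_scale scl_mult \<kappa>_scl)
    moreover have "0 \<le> a \<bullet> \<kappa> (cubic u * cubic u)" using u by (intro pos) (auto simp: S_def)
    ultimately show ?thesis by simp
  qed
  then show ?thesis using that ab(1) b0 by (meson less_trans)
qed

section \<open>A functional whose kernel has no common zero\<close>

text \<open>Two complex numbers that do not lie on opposite rays fit, after a rotation, into a half
  plane, the first of them into its interior.\<close>

lemma half_planes:
  fixes A B :: complex
  assumes "A \<noteq> 0" and neg: "\<not> (\<exists>s>0. B = - of_real s * A)"
  shows "\<exists>\<eta>. Re (\<eta> * A) < 0 \<and> Re (\<eta> * B) \<le> 0"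
proof -
  define D where "D = B / A"
  have B: "B = D * A" using assms(1) by (simp add: D_def)
  show ?thesis
  proof (cases "Re D \<ge> 0")
    case True
    then show ?thesis using assms(1) by (intro exI[of _ "- 1 / A"]) (simp add: B)
  next
    case False
    have y: "Im D \<noteq> 0"
    proof
      assume "Im D = 0"
      then have "D = - of_real (- Re D)" by (simp add: complex_eq_iff)
      then show False using neg False B by (metis neg_0_less_iff_less not_le)
    qed
    \<comment> \<open>With this slope \<open>Re (\<eta> B) = 0\<close>.\<close>
    define \<tau> where "\<tau> = - Re D / Im D"
    have "Re ((Complex (-1) \<tau> / A) * A) < 0" using assms(1) by simp
    moreover have "Re ((Complex (-1) \<tau> / A) * B) \<le> 0" using assms(1) y by (simp add: B \<tau>_def)
    ultimately show ?thesis by blast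
  qed
qed

text \<open>For a nonzero coordinate \<open>z\<^sub>i\<close>, consider the monomials \<open>z\<^sub>i\<^sup>2 z\<^sub>j\<close>. If \<open>half_planes\<close>
  applied to none of them, \<open>p(z)\<close> would be a negative multiple of each nonzero \<open>(z\<^sub>i\<^sup>2 z\<^sub>j)\<^sup>2\<close>.
  Then all ratios \<open>z\<^sub>j / z\<^sub>i\<close> would be real, so \<open>z\<close> would be a multiple of a real point, at which
  \<open>p\<close> would be negative.\<close>

lemma test_cubic:
  fixes p :: "3 real_mpoly"
  assumes p: "p \<in> psd_forms 3" and z: "z \<noteq> 0"
  obtains q \<eta> where "q \<in> forms 3" "Re (\<eta> * (eval_mpoly q z)\<^sup>2) < 0" "Re (\<eta> * eval_mpoly p z) \<le> 0"
proof -
  have pf: "p \<in> forms 6" and pp: "\<And>x :: real ^ 3. eval_mpoly p x \<ge> 0" using p by (simp_all add: psd_forms_def)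
  obtain i where i: "z $ i \<noteq> 0" using z by (auto simp: vec_eq_iff)
  define q where "q j = Poly_Mapping.single (Poly_Mapping.single i (2::nat) + Poly_Mapping.single j 1) (1::real)" for j
  have q: "q j \<in> forms 3" for j
    unfolding forms_iff q_def by (simp add: lookup_single when_def monom_degree_add) (simp add: monom_degree_def lookup_single when_def)
  have ps: "(\<Prod>l\<in>UNIV. (z $ l) ^ Poly_Mapping.lookup (Poly_Mapping.single k n) l) = (z $ k) ^ n" for k :: 3 and n
  proof -
    have "(\<Prod>l\<in>UNIV. (z $ l) ^ Poly_Mapping.lookup (Poly_Mapping.single k n) l) = (\<Prod>l\<in>UNIV. if l = k then (z $ l) ^ n else 1)"
      by (intro prod.cong refl) (simp add: lookup_single when_def)
    then show ?thesis by simp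
  qed
  have qz: "eval_mpoly (q j) z = (z $ i)\<^sup>2 * z $ j" for j
    unfolding q_def eval_single lookup_add power_add prod.distrib ps by simp
  have "\<exists>j. (z $ j \<noteq> 0) \<and> \<not> (\<exists>s>0. eval_mpoly p z = - of_real s * (eval_mpoly (q j) z)\<^sup>2)"
  proof (rule ccontr)
    assume "\<not> ?thesis"
    then have *: "\<exists>s>0. eval_mpoly p z = - of_real s * (eval_mpoly (q j) z)\<^sup>2" if "z $ j \<noteq> 0" for j using that by blast
    obtain s where s: "s > 0" "eval_mpoly p z = - of_real s * (z $ i) ^ 6"
      using *[OF i] by (auto simp: qz power_mult_distrib power_mult[symmetric] power_add[symmetric])
    have real: "z $ j / z $ i \<in> \<real>" for j
    proof (cases "z $ j = 0")
      case False
      obtain s' where s': "s' > 0" "eval_mpoly p z = - of_real s' * ((z $ i)\<^sup>2 * z $ j)\<^sup>2"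
        using *[OF False] by (auto simp: qz)
      have "of_real s' * ((z $ i)\<^sup>2 * z $ j)\<^sup>2 = of_real s * (z $ i) ^ 6" using s s' by simp
      then have "(z $ i) ^ 4 * (of_real s' * (z $ j)\<^sup>2) = (z $ i) ^ 4 * (of_real s * (z $ i)\<^sup>2)"
        by (simp add: power_mult_distrib power_mult[symmetric] power_add[symmetric] mult.left_commute)
      then have "of_real s' * (z $ j)\<^sup>2 = of_real s * (z $ i)\<^sup>2" using i by simp
      then have "(z $ j / z $ i)\<^sup>2 = of_real (s / s')" using s'(1) i by (simp add: field_simps)
      also have "\<dots> = (of_real (sqrt (s / s')))\<^sup>2" using s s' by (simp flip: of_real_power)
      finally have "z $ j / z $ i = of_real (sqrt (s / s')) \<or> z $ j / z $ i = - of_real (sqrt (s / s'))"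
        by (simp add: power2_eq_iff)
      then show ?thesis by auto
    qed simp
    define r where "r = (\<chi> j. Re (z $ j / z $ i))"
    have "z = z $ i *s cvec r" using i real by (simp add: vec_eq_iff cvec_def r_def of_real_Re)
    then have "eval_mpoly p z = (z $ i) ^ 6 * eval_mpoly p (cvec r)" using cform_scaleC[OF eval_cform[OF pf]] by metis
    also have "\<dots> = (z $ i) ^ 6 * of_real (eval_mpoly p r)" by (simp add: eval_cvec)
    finally have "(z $ i) ^ 6 * of_real (eval_mpoly p r) = (z $ i) ^ 6 * of_real (- s)" using s by (simp add: mult.commute)
    then have "complex_of_real (eval_mpoly p r) = of_real (- s)" using i by (simp del: of_real_minus)
    then have "eval_mpoly p r = - s" by (simp only: of_real_eq_iff)
    then show False using pp[of r] s by simp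
  qed
  then obtain j where j: "z $ j \<noteq> 0" "\<not> (\<exists>s>0. eval_mpoly p z = - of_real s * (eval_mpoly (q j) z)\<^sup>2)" by blast
  have "(eval_mpoly (q j) z)\<^sup>2 \<noteq> 0" using i j by (simp add: qz)
  from half_planes[OF this j(2)] show ?thesis using that q by blast
qed

text \<open>The functional is chosen with a kernel of maximal dimension. At a common zero \<open>z\<close> of the
  kernel, the functional of \<open>test_cubic\<close> vanishes against the kernel, so it could be added up to
  the boundary of the semidefinite cone: the kernel would grow, and the value at \<open>p\<close> would stay
  negative.\<close>

theorem separating_functional_base_free:
  fixes p :: "3 real_mpoly"
  assumes p: "p \<in> psd_forms 3" "p \<notin> sos_forms 3"
  obtains a where "a \<bullet> \<kappa> p < 0" "\<And>q. q \<in> forms 3 \<Longrightarrow> 0 \<le> a \<bullet> \<kappa> (q * q)"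
    "\<And>z :: complex ^ 3. z \<noteq> 0 \<Longrightarrow> \<exists>q\<in>forms 3. (\<forall>r\<in>forms 3. a \<bullet> \<kappa> (q * r) = 0) \<and> eval_mpoly q z \<noteq> 0"
proof -
  have pf: "p \<in> forms 6" using p(1) by (simp add: psd_forms_def)
  define B where "B a u v = a \<bullet> \<kappa> (cubic u * cubic v)" for a u v
  have bB: "bilinear (B a)" for a
    using bilinear_square unfolding bilinear_def B_def linear_iff by (simp add: inner_add_right)
  have sB: "B a u v = B a v u" for a u v by (simp add: B_def mult.commute)
  have Badd: "B (a + t *\<^sub>R b) u v = B a u v + t * B b u v" for a b t u v by (simp add: B_def inner_add_left)
  define N where "N a = {v. B a v v = 0}" for a
  define Good where "Good a \<longleftrightarrow> a \<bullet> \<kappa> p < 0 \<and> (\<forall>v. 0 \<le> B a v v)" for a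
  have "\<exists>a. Good a" using separating_functional[OF pf p(2)] unfolding Good_def B_def by metis
  then obtain a0 where "Good a0" ..
  \<comment> \<open>The cubics have dimension ten, so a maximum exists.\<close>
  moreover have "dim (N a) < 11" for a using dim_subset_UNIV[of "N a"] by simp
  ultimately obtain a where a: "Good a" "\<And>b. Good b \<Longrightarrow> dim (N b) \<le> dim (N a)"
    using ex_has_greatest_nat[of Good a0 "\<lambda>a. dim (N a)" 11] by (metis less_imp_le)
  have psd: "\<And>v. 0 \<le> B a v v" and ap: "a \<bullet> \<kappa> p < 0" using a(1) by (simp_all add: Good_def)
  have "\<exists>q\<in>forms 3. (\<forall>r\<in>forms 3. a \<bullet> \<kappa> (q * r) = 0) \<and> eval_mpoly q z \<noteq> 0" if z: "z \<noteq> 0" for z :: "complex ^ 3"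
  proof (rule ccontr)
    assume "\<not> ?thesis"
    then have com: "eval_mpoly q z = 0" if "q \<in> forms 3" "\<And>r. r \<in> forms 3 \<Longrightarrow> a \<bullet> \<kappa> (q * r) = 0" for q using that by blast
    obtain q \<eta> where q: "q \<in> forms 3" "Re (\<eta> * (eval_mpoly q z)\<^sup>2) < 0" "Re (\<eta> * eval_mpoly p z) \<le> 0"
      using test_cubic[OF p(1) z] by blast
    define b where "b = ev_functional \<eta> z"
    have CC: "cubic u * cubic v \<in> forms 6" for u v using forms_mult[OF cubic_forms cubic_forms] by simp
    have bB': "B b u v = Re (\<eta> * (eval_mpoly (cubic u) z * eval_mpoly (cubic v) z))" for u v
      by (simp add: B_def b_def ev_functional[OF CC] eval_mult)
    have van: "B b v u = 0" if v: "B a v v = 0" for u v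
    proof -
      have "a \<bullet> \<kappa> (cubic v * r) = 0" if "r \<in> forms 3" for r
      proof -
        obtain w where "r = cubic w" using forms_cubic[OF \<open>r \<in> forms 3\<close>] by blast
        then show ?thesis using psd_kernel[OF bB sB psd v, of w] by (simp add: B_def)
      qed
      then have "eval_mpoly (cubic v) z = 0" by (intro com) auto
      then show ?thesis by (simp add: bB')
    qed
    obtain v0 where "q = cubic v0" using forms_cubic[OF q(1)] by blast
    then have neg: "B b v0 v0 < 0" using q(2) by (simp add: bB' power2_eq_square)
    obtain t where t: "t \<ge> 0" "\<forall>v. 0 \<le> B a v v + t * B b v v" "{v. B a v v = 0} \<subset> {v. B a v v + t * B b v v = 0}"
      using psd_perturb_to_boundary[OF bB sB psd bB sB van neg] by blast
    define c where "c = a + t *\<^sub>R b"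
    have "c \<bullet> \<kappa> p = a \<bullet> \<kappa> p + t * Re (\<eta> * eval_mpoly p z)" by (simp add: c_def inner_add_left b_def ev_functional[OF pf])
    moreover have "t * Re (\<eta> * eval_mpoly p z) \<le> 0" using t(1) q(3) by (simp add: mult_nonneg_nonpos)
    ultimately have "Good c" using ap t(2) unfolding Good_def c_def Badd by auto
    then have le: "dim (N c) \<le> dim (N a)" by (rule a(2))
    have psub: "N a \<subset> N c" using t(3) unfolding N_def c_def Badd .
    have sub: "subspace (N a)" unfolding N_def by (rule psd_kernel_subspace[OF bB sB psd])
    have "subspace (N c)" unfolding N_def by (rule psd_kernel_subspace[OF bB sB]) (use \<open>Good c\<close> in \<open>simp add: Good_def\<close>)
    then have "N a = N c" using subspace_dim_equal[OF sub _ _ le] psub by blast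
    then show False using psub by blast
  qed
  moreover have "0 \<le> a \<bullet> \<kappa> (q * q)" if q: "q \<in> forms 3" for q
  proof -
    obtain w where "q = cubic w" using forms_cubic[OF q] by blast
    then show ?thesis using psd[of w] by (simp add: B_def)
  qed
  ultimately show ?thesis using that ap by blast
qed

lemma \<kappa>_sum: "\<kappa> (\<Sum>i\<in>A. g i) = (\<Sum>i\<in>A. \<kappa> (g i))"
  by (induction A rule: infinite_finite_induct) (simp_all add: \<kappa>_add)

lemma \<kappa>_uminus: "\<kappa> (- f) = - \<kappa> f"
  using \<kappa>_diff[of 0 f] by simp

section \<open>A transversal pencil in a base point free system\<close>

text \<open>Perturb a member that works for all points but one by a real multiple of a member that is
  nonzero at the remaining one; only finitely many multiples fail.\<close>

lemma avoid_zeros: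
  fixes T :: "(complex ^ 3) set" and K :: "3 real_mpoly set"
  assumes add: "\<And>f g. f \<in> K \<Longrightarrow> g \<in> K \<Longrightarrow> f + g \<in> K" and scale: "\<And>c f. f \<in> K \<Longrightarrow> scl c f \<in> K" and "0 \<in> K"
    and "finite T" and "\<And>v. v \<in> T \<Longrightarrow> \<exists>q\<in>K. eval_mpoly q v \<noteq> 0"
  shows "\<exists>q\<in>K. \<forall>v\<in>T. eval_mpoly q v \<noteq> 0"
  using assms(4,5)
proof (induction T rule: finite_induct)
  case empty
  then show ?case using \<open>0 \<in> K\<close> by blast
next
  case (insert v T)
  then obtain q where q: "q \<in> K" "\<forall>v\<in>T. eval_mpoly q v \<noteq> 0" by blast
  obtain u where u: "u \<in> K" "eval_mpoly u v \<noteq> 0" using insert.prems by blast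
  \<comment> \<open>The bad multiples: where \<open>u\<close> vanishes, the default value of division is harmless.\<close>
  define bad where "bad = insert 0 ((\<lambda>v. Re (- eval_mpoly q v / eval_mpoly u v)) ` insert v T)"
  have "finite bad" using insert by (simp add: bad_def)
  then obtain e where e: "e \<notin> bad" using ex_new_if_finite[OF infinite_UNIV_char_0[where 'a=real]] by blast
  have "eval_mpoly (q + scl e u) x \<noteq> 0" if x: "x \<in> insert v T" for x
  proof
    assume "eval_mpoly (q + scl e u) x = 0"
    then have *: "eval_mpoly q x + of_real e * eval_mpoly u x = 0" by (simp add: eval_add eval_scl)
    show False
    proof (cases "eval_mpoly u x = 0")
      case True
      then have "eval_mpoly q x = 0" "x \<noteq> v" using * u by auto
      then show False using q x by auto
    next
      case False
      then have "of_real e = - eval_mpoly q x / eval_mpoly u x" using * by (simp add: field_simps add_eq_0_iff)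
      then have "e = Re (- eval_mpoly q x / eval_mpoly u x)" by (metis Re_complex_of_real)
      then show False using e x unfolding bad_def by blast
    qed
  qed
  moreover have "q + scl e u \<in> K" using add scale q u by blast
  ultimately show ?case by blast
qed

text \<open>Three members without common zero are found one after the other: \<open>u1\<close> has finitely many
  zeros at infinity, \<open>u2\<close> avoids them, so \<open>u1\<close> and \<open>u2\<close> have finitely many common zeros, and \<open>u3\<close>
  avoids those. A generic real pencil of their net is transversal.\<close>

theorem transversal_pencil_exists:
  fixes K :: "3 real_mpoly set"
  assumes K: "K \<subseteq> forms 3" and add: "\<And>f g. f \<in> K \<Longrightarrow> g \<in> K \<Longrightarrow> f + g \<in> K" 
    and scale: "\<And>c f. f \<in> K \<Longrightarrow> scl c f \<in> K" and "0 \<in> K"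
    and free: "\<And>v :: complex ^ 3. v \<noteq> 0 \<Longrightarrow> \<exists>q\<in>K. eval_mpoly q v \<noteq> 0"
  shows "\<exists>q1\<in>K. \<exists>q2\<in>K. transversal_pencil (eval_mpoly q1) (eval_mpoly q2)"
proof -
  have avoid: "\<exists>q\<in>K. \<forall>v\<in>T. eval_mpoly q v \<noteq> 0" 
    if "finite T" "\<And>v. v \<in> T \<Longrightarrow> \<exists>q\<in>K. eval_mpoly q v \<noteq> 0" for T :: "(complex ^ 3) set"
    using add scale \<open>0 \<in> K\<close> that by (rule avoid_zeros)
  have cf: "eval_mpoly q \<in> cform 3" if "q \<in> K" for q using K that eval_cform by blast
  have nz: "point 1 0 0 \<noteq> (0 :: complex^3)" "point x 1 0 \<noteq> (0 :: complex^3)" for x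
    by (simp_all add: vec_eq_iff forall_3)
  obtain u1 where u1: "u1 \<in> K" "eval_mpoly u1 (point 1 0 0 :: complex^3) \<noteq> 0" using free[OF nz(1)] by blast
  define f1 :: "complex ^ 3 \<Rightarrow> complex" where "f1 = eval_mpoly u1"
  have "f1 \<in> cform 3" unfolding f1_def by (rule cf[OF u1(1)])
  then obtain p :: "complex poly" where p: "degree p \<le> 3" "\<And>x y. f1 (point x y 0) = binary 3 p (point x y 0)"
    using binary_restrict[of f1 3] by blast
  have "coeff p 3 \<noteq> 0" using u1(2) p(2)[of 1 0] by (simp add: binary_infty f1_def)
  then have "p \<noteq> 0" by auto
  then have fin: "finite {x. poly p x = 0}" by (rule poly_roots_finite)
  have "\<exists>q\<in>K. \<forall>v\<in>(\<lambda>x. point x 1 0) ` {x. poly p x = 0}. eval_mpoly q v \<noteq> (0 :: complex)"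
    by (rule avoid) (use fin free nz in auto)
  then obtain u2 where u2: "u2 \<in> K" "\<And>x. poly p x = 0 \<Longrightarrow> eval_mpoly u2 (point x 1 0 :: complex^3) \<noteq> 0" by auto
  interpret U: pencil "eval_mpoly u1" "eval_mpoly u2"
  proof
    show "eval_mpoly u1 \<in> cform 3" "eval_mpoly u2 \<in> cform 3" using cf u1 u2 by blast+
    fix v :: "complex ^ 3" assume v: "v \<noteq> 0" "v $ 3 = 0"
    show "eval_mpoly u1 v \<noteq> 0 \<or> eval_mpoly u2 v \<noteq> 0"
    proof (cases "v $ 2 = 0")
      case True
      then have v1: "v $ 1 \<noteq> 0" "v = v $ 1 *s point 1 0 0" using v by (auto simp: vec_eq_iff forall_3)
      have "eval_mpoly u1 v = (v $ 1) ^ 3 * (eval_mpoly u1 (point 1 0 0) :: complex)" by (subst v1(2)) (rule cform_scaleC[OF cf[OF u1(1)]])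
      then show ?thesis using u1 v1 by simp
    next
      case False
      define x where "x = v $ 1 / v $ 2"
      have vx: "v = v $ 2 *s point x 1 0" using False v by (auto simp: vec_eq_iff forall_3 x_def)
      have e1: "eval_mpoly u1 v = (v $ 2) ^ 3 * (eval_mpoly u1 (point x 1 0) :: complex)" by (subst vx) (rule cform_scaleC[OF cf[OF u1(1)]])
      have e2: "eval_mpoly u2 v = (v $ 2) ^ 3 * (eval_mpoly u2 (point x 1 0) :: complex)" by (subst vx) (rule cform_scaleC[OF cf[OF u2(1)]])
      have "f1 (point x 1 0) = poly p x" using p(2)[of x 1] binary_chart[OF p(1), of x 0] by simp
      then show ?thesis using e1 e2 u2(2)[of x] False unfolding f1_def by auto
    qed
  qed
  have "\<exists>q\<in>K. \<forall>v\<in>U.zeros. eval_mpoly q v \<noteq> (0 :: complex)"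
  proof (rule avoid[OF U.finite_zeros])
    fix v assume "v \<in> U.zeros"
    then have "v \<noteq> 0" by (auto simp: U.zeros_def)
    then show "\<exists>q\<in>K. eval_mpoly q v \<noteq> 0" by (rule free)
  qed
  then obtain u3 where u3: "u3 \<in> K" "\<And>v. v \<in> U.zeros \<Longrightarrow> eval_mpoly u3 v \<noteq> 0" by blast
  interpret N: net "eval_mpoly u1" "eval_mpoly u2" "eval_mpoly u3"
  proof
    show "eval_mpoly u1 \<in> cform 3" "eval_mpoly u2 \<in> cform 3" "eval_mpoly u3 \<in> cform 3" using cf u1 u2 u3 by blast+
    fix v :: "complex ^ 3" assume v: "v \<noteq> 0"
    show "eval_mpoly u1 v \<noteq> 0 \<or> eval_mpoly u2 v \<noteq> 0 \<or> eval_mpoly u3 v \<noteq> 0"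
    proof (rule ccontr)
      assume "\<not> ?thesis"
      then have 0: "eval_mpoly u1 v = 0" "eval_mpoly u2 v = 0" "eval_mpoly u3 v = 0" by simp_all
      then have v3: "v $ 3 \<noteq> 0" using U.good[OF v] by blast
      define P where "P = (1 / v $ 3) *s v"
      have sc: "eval_mpoly q P = (1 / v $ 3) ^ 3 * eval_mpoly q v" if "q \<in> K" for q
        unfolding P_def by (rule cform_scaleC[OF cf[OF that]])
      have "P $ 3 = 1" using v3 by (simp add: P_def)
      moreover have "eval_mpoly u1 P = 0" "eval_mpoly u2 P = 0" "eval_mpoly u3 P = 0" 
        using sc[OF u1(1)] sc[OF u2(1)] sc[OF u3(1)] 0 by simp_all
      ultimately show False using u3(2)[of P] by (simp add: U.zeros_def)
    qed
  qed
  obtain x where x: "transversal_pencil (N.pencil1 (cvec x)) (N.pencil2 (cvec x))" using N.generic_transversal_pencil by blast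
  define q1 where "q1 = scl (x $ 3) u1 + scl (- x $ 1) u3"
  define q2 where "q2 = scl (x $ 3) u2 + scl (- x $ 2) u3"
  have "q1 \<in> K" "q2 \<in> K" unfolding q1_def q2_def by (intro add scale u1 u2 u3)+
  moreover have "eval_mpoly q1 = N.pencil1 (cvec x)" "eval_mpoly q2 = N.pencil2 (cvec x)"
    by (simp_all add: fun_eq_iff q1_def q2_def N.pencil1_def N.pencil2_def eval_add eval_scl cvec_def)
  ultimately show ?thesis using x by metis
qed

section \<open>Functionals supported on the nine points\<close>

text \<open>The functional is \<open>f \<mapsto> a \<bullet> \<kappa> f\<close>, and the pencil consists of real cubics of its kernel.\<close>

locale real_pencil = transversal_pencil "eval_mpoly q1" "eval_mpoly q2" for q1 q2 :: "3 real_mpoly" +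
  fixes a :: "real ^ 28"
  assumes forms_q: "q1 \<in> forms 3" "q2 \<in> forms 3"
    and kill: "\<And>r. r \<in> forms 3 \<Longrightarrow> a \<bullet> \<kappa> (q1 * r) = 0" "\<And>r. r \<in> forms 3 \<Longrightarrow> a \<bullet> \<kappa> (q2 * r) = 0"
begin

lemma zeros_conjv: "P \<in> zeros \<Longrightarrow> conjv P \<in> zeros"
  by (simp add: zeros_def eval_conjv)

lemma bij_conjv: "bij_betw conjv zeros zeros"
  by (rule bij_betwI[of _ _ _ conjv]) (auto simp: zeros_conjv)

text \<open>Let \<open>r\<^sub>P + \<i> s\<^sub>P\<close> be a sextic that is 1 at \<open>P\<close> and 0 at the other zeros, with real forms
  \<open>r\<^sub>P\<close> and \<open>s\<^sub>P\<close>; the weight of \<open>P\<close> is the value there of the functional, extended complex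
  linearly. A sextic minus its interpolation vanishes at all zeros, so it is in the ideal, and
  there the functional is zero. The functional is only defined on real forms, therefore real and
  imaginary parts are followed separately.\<close>

lemma representation_exists:
  "\<exists>\<mu>. \<forall>f\<in>forms 6. complex_of_real (a \<bullet> \<kappa> f) = (\<Sum>P\<in>zeros. \<mu> P * eval_mpoly f P)"
proof -
  have "\<forall>P. \<exists>rs. P \<in> zeros \<longrightarrow> fst rs \<in> forms 6 \<and> snd rs \<in> forms 6 \<and> 
     (\<forall>R\<in>zeros. eval_mpoly (fst rs) R + \<i> * eval_mpoly (snd rs) R = (if R = P then 1 else 0))"
  proof
    fix P
    show "\<exists>rs. P \<in> zeros \<longrightarrow> fst rs \<in> forms 6 \<and> snd rs \<in> forms 6 \<and> 
     (\<forall>R\<in>zeros. eval_mpoly (fst rs) R + \<i> * eval_mpoly (snd rs) R = (if R = P then 1 else 0))"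
    proof (cases "P \<in> zeros")
      case True
      obtain f where f: "f \<in> cform 4" "f P = 1" "\<forall>R\<in>zeros - {P}. f R = 0"
        using zeros_separated_by_quartics[OF finite_zeros subset_refl True] by blast
      have "X3 ^ 2 * f \<in> cform 6" using f(1) by (intro cform_mult'[of "X3 ^ 2" 2]) simp_all
      then obtain r s where rs: "r \<in> forms 6" "s \<in> forms 6" "\<And>v. (X3 ^ 2 * f) v = eval_mpoly r v + \<i> * eval_mpoly s v"
        using cform_Re_Im by blast
      have "eval_mpoly r R + \<i> * eval_mpoly s R = (if R = P then 1 else 0)" if "R \<in> zeros" for R
        unfolding rs(3)[symmetric] using f that by (auto simp: zeros_def X3_def)
      then show ?thesis using rs by (intro exI[of _ "(r, s)"]) simp
    qed blast
  qed
  from choice[OF this] obtain rs where rs: "\<And>P. P \<in> zeros \<Longrightarrow> fst (rs P) \<in> forms 6" "\<And>P. P \<in> zeros \<Longrightarrow> snd (rs P) \<in> forms 6"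
    "\<And>P R. P \<in> zeros \<Longrightarrow> R \<in> zeros \<Longrightarrow> eval_mpoly (fst (rs P)) R + \<i> * eval_mpoly (snd (rs P)) R = (if R = P then 1 else 0)" by blast
  define r where "r P = fst (rs P)" for P
  define s where "s P = snd (rs P)" for P
  have r: "r P \<in> forms 6" "s P \<in> forms 6" if "P \<in> zeros" for P using rs that by (simp_all add: r_def s_def)
  define \<mu> where "\<mu> P = complex_of_real (a \<bullet> \<kappa> (r P)) + \<i> * complex_of_real (a \<bullet> \<kappa> (s P))" for P
  have "complex_of_real (a \<bullet> \<kappa> f) = (\<Sum>P\<in>zeros. \<mu> P * eval_mpoly f P)" if f: "f \<in> forms 6" for f
  proof -
    define c where "c P = (eval_mpoly f P :: complex)" for P
    define F where "F = eval_mpoly f - (\<Sum>P\<in>zeros. cst (c P) * (eval_mpoly (r P) + cst \<i> * eval_mpoly (s P)))"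
    have "F \<in> cform (4 + 2)" unfolding F_def using f r eval_cform[of _ 6]
      by (intro cform_diff cform_sum cform_scale cform_add) auto
    moreover have "F R = 0" if R: "R \<in> zeros" for R
    proof -
      have "(\<Sum>P\<in>zeros. c P * (eval_mpoly (r P) R + \<i> * eval_mpoly (s P) R)) = (\<Sum>P\<in>zeros. if P = R then c P else 0)"
        using rs(3)[OF _ R] by (intro sum.cong refl) (simp add: r_def s_def)
      then show ?thesis using R finite_zeros by (simp add: F_def c_def)
    qed
    ultimately have "F \<in> ideal (1 + 2)" by (rule max_noether)
    moreover have "1 + 2 = (3 :: nat)" by simp
    ultimately have "F \<in> ideal 3" by (simp only:)
    then obtain A B where AB: "A \<in> cform 3" "B \<in> cform 3" "F = A * eval_mpoly q1 + B * eval_mpoly q2"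
      unfolding ideal_def by blast
    obtain A1 A2 where A: "A1 \<in> forms 3" "A2 \<in> forms 3" "\<And>v. A v = eval_mpoly A1 v + \<i> * eval_mpoly A2 v"
      using cform_Re_Im[OF AB(1)] by blast
    obtain B1 B2 where B: "B1 \<in> forms 3" "B2 \<in> forms 3" "\<And>v. B v = eval_mpoly B1 v + \<i> * eval_mpoly B2 v"
      using cform_Re_Im[OF AB(2)] by blast
    define f1 where "f1 = f - (\<Sum>P\<in>zeros. scl (Re (c P)) (r P) - scl (Im (c P)) (s P)) - (q1 * A1 + q2 * B1)"
    define f2 where "f2 = 0 - (\<Sum>P\<in>zeros. scl (Re (c P)) (s P) + scl (Im (c P)) (r P)) - (q1 * A2 + q2 * B2)"
    have six: "g * h \<in> forms 6" if "g \<in> forms 3" "h \<in> forms 3" for g h :: "3 real_mpoly"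
      using forms_mult[OF that] by simp
    have sums: "(\<Sum>P\<in>zeros. scl (Re (c P)) (r P) - scl (Im (c P)) (s P)) \<in> forms 6"
      "(\<Sum>P\<in>zeros. scl (Re (c P)) (s P) + scl (Im (c P)) (r P)) \<in> forms 6" by (rule forms_sum, simp add: r)+
    have f12: "f1 \<in> forms 6" "f2 \<in> forms 6" unfolding f1_def f2_def
      by (rule forms_diff[OF forms_diff[OF f sums(1)] forms_add[OF six[OF forms_q(1) A(1)] six[OF forms_q(2) B(1)]]],
          rule forms_diff[OF forms_diff[OF forms_0 sums(2)] forms_add[OF six[OF forms_q(1) A(2)] six[OF forms_q(2) B(2)]]])
    have "eval_mpoly f1 v + \<i> * eval_mpoly f2 v = F v - (A v * eval_mpoly q1 v + B v * eval_mpoly q2 v)" for v :: "complex ^ 3"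
    proof -
      define U where "U P = of_real (Re (c P)) * eval_mpoly (r P) v - of_real (Im (c P)) * eval_mpoly (s P) v" for P
      define V where "V P = of_real (Re (c P)) * eval_mpoly (s P) v + of_real (Im (c P)) * eval_mpoly (r P) v" for P
      have "c P * (x + \<i> * y) = (of_real (Re (c P)) * x - of_real (Im (c P)) * y) + \<i> * (of_real (Re (c P)) * y + of_real (Im (c P)) * x)" for P x y
        by (subst complex_eq[of "c P"]) (simp add: algebra_simps)
      then have "c P * (eval_mpoly (r P) v + \<i> * eval_mpoly (s P) v) = U P + \<i> * V P" for P unfolding U_def V_def .
      then have "(\<Sum>P\<in>zeros. c P * (eval_mpoly (r P) v + \<i> * eval_mpoly (s P) v)) = (\<Sum>P\<in>zeros. U P) + \<i> * (\<Sum>P\<in>zeros. V P)"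
        by (simp only: sum.distrib sum_distrib_left)
      moreover have "(\<Sum>P\<in>zeros. U P) = eval_mpoly (\<Sum>P\<in>zeros. scl (Re (c P)) (r P) - scl (Im (c P)) (s P)) v"
        by (simp only: eval_sum eval_diff eval_scl U_def)
      moreover have "(\<Sum>P\<in>zeros. V P) = eval_mpoly (\<Sum>P\<in>zeros. scl (Re (c P)) (s P) + scl (Im (c P)) (r P)) v"
        by (simp only: eval_sum eval_add eval_scl V_def)
      moreover have "F v = eval_mpoly f v - (\<Sum>P\<in>zeros. c P * (eval_mpoly (r P) v + \<i> * eval_mpoly (s P) v))"
        by (simp add: F_def)
      ultimately show ?thesis
        unfolding f1_def f2_def A(3) B(3) eval_diff eval_add eval_mult eval_zero by (simp add: algebra_simps)
    qed
    then have "eval_mpoly f1 v + \<i> * eval_mpoly f2 v = 0" for v :: "complex ^ 3" using AB(3) by simp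
    then have "f1 = 0" "f2 = 0" using Re_Im_zero[OF f12] by blast+
    then have "a \<bullet> \<kappa> f1 = 0" "a \<bullet> \<kappa> f2 = 0" by simp_all
    then have "a \<bullet> \<kappa> f = (\<Sum>P\<in>zeros. Re (c P) * (a \<bullet> \<kappa> (r P)) - Im (c P) * (a \<bullet> \<kappa> (s P)))"
      "0 = (\<Sum>P\<in>zeros. Re (c P) * (a \<bullet> \<kappa> (s P)) + Im (c P) * (a \<bullet> \<kappa> (r P)))"
      using kill A(1,2) B(1,2)
      by (simp_all add: f1_def f2_def \<kappa>_diff \<kappa>_add \<kappa>_scl \<kappa>_sum \<kappa>_uminus inner_diff_right inner_add_right inner_sum_right)
    then show ?thesis
      by (simp add: complex_eq_iff \<mu>_def Re_sum Im_sum c_def[symmetric] mult.commute)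
  qed
  then show ?thesis by blast
qed

text \<open>The functional is real and conjugation permutes the zeros, so the weights can be averaged
  with their conjugates.\<close>

lemma symmetric_representation:
  obtains \<nu> where "\<And>f. f \<in> forms 6 \<Longrightarrow> complex_of_real (a \<bullet> \<kappa> f) = (\<Sum>P\<in>zeros. \<nu> P * eval_mpoly f P)"
    "\<And>P. \<nu> (conjv P) = cnj (\<nu> P)"
proof -
  obtain \<mu> where \<mu>: "\<And>f. f \<in> forms 6 \<Longrightarrow> complex_of_real (a \<bullet> \<kappa> f) = (\<Sum>P\<in>zeros. \<mu> P * eval_mpoly f P)"
    using representation_exists by blast
  define \<nu> where "\<nu> P = (\<mu> P + cnj (\<mu> (conjv P))) / 2" for P
  have "complex_of_real (a \<bullet> \<kappa> f) = (\<Sum>P\<in>zeros. \<nu> P * eval_mpoly f P)" if f: "f \<in> forms 6" for f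
  proof -
    have "(\<Sum>P\<in>zeros. cnj (\<mu> (conjv P)) * eval_mpoly f P) = (\<Sum>P\<in>zeros. cnj (\<mu> P) * eval_mpoly f (conjv P))"
      using sum.reindex_bij_betw[OF bij_conjv, of "\<lambda>P. cnj (\<mu> (conjv P)) * eval_mpoly f P"] by simp
    also have "\<dots> = cnj (\<Sum>P\<in>zeros. \<mu> P * eval_mpoly f P)" by (simp add: eval_conjv)
    also have "\<dots> = complex_of_real (a \<bullet> \<kappa> f)" by (simp add: \<mu>[OF f, symmetric])
    finally have "(\<Sum>P\<in>zeros. cnj (\<mu> (conjv P)) * eval_mpoly f P) = complex_of_real (a \<bullet> \<kappa> f)" .
    then have "(\<Sum>P\<in>zeros. \<mu> P * eval_mpoly f P) + (\<Sum>P\<in>zeros. cnj (\<mu> (conjv P)) * eval_mpoly f P) = 2 * complex_of_real (a \<bullet> \<kappa> f)"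
      by (simp add: \<mu>[OF f, symmetric])
    then show ?thesis by (simp add: \<nu>_def sum.distrib[symmetric] sum_divide_distrib[symmetric] distrib_right[symmetric])
  qed
  moreover have "\<nu> (conjv P) = cnj (\<nu> P)" for P by (simp add: \<nu>_def add.commute)
  ultimately show ?thesis using that by blast
qed

text \<open>Twice the real part of a complex interpolating cubic. Its values at a zero \<open>S\<close> involve
  those of the complex cubic at \<open>S\<close> and at its conjugate, which is why both \<open>Q\<close> and its conjugate
  are left unconstrained. At a real point \<open>R\<close> the two summands add up.\<close>

lemma real_cubic_interpolation:
  assumes Q: "Q \<in> zeros" and R: "R \<in> zeros" "R \<noteq> Q"
  obtains g where "g \<in> forms 3" "\<And>S. S \<in> zeros \<Longrightarrow> S \<noteq> Q \<Longrightarrow> S \<noteq> conjv Q \<Longrightarrow> 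
     eval_mpoly g S = (if S = R then y else 0) + (if S = conjv R then cnj y else 0)"
proof -
  obtain h0 where h0: "h0 \<in> cform 3" "h0 R = 1" "\<forall>S\<in>zeros - {Q, R}. h0 S = 0" using cubic_interpolation[OF Q R] by blast
  define h where "h = cst y * h0"
  have h: "h \<in> cform 3" "\<And>S. S \<in> zeros \<Longrightarrow> S \<noteq> Q \<Longrightarrow> h S = (if S = R then y else 0)"
    using h0 by (auto simp: h_def)
  obtain r s where rs: "r \<in> forms 3" "s \<in> forms 3" "\<And>v. h v = eval_mpoly r v + \<i> * eval_mpoly s v"
    using cform_Re_Im[OF h(1)] by blast
  have ev: "eval_mpoly (scl 2 r) v = h v + cnj (h (conjv v))" for v
    by (simp add: rs(3) eval_scl eval_conjv)
  show ?thesis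
  proof
    show "scl 2 r \<in> forms 3" using rs by simp
    fix S assume S: "S \<in> zeros" "S \<noteq> Q" "S \<noteq> conjv Q"
    then have "conjv S \<in> zeros" "conjv S \<noteq> Q" using zeros_conjv by auto
    then show "eval_mpoly (scl 2 r) S = (if S = R then y else 0) + (if S = conjv R then cnj y else 0)"
      using h(2) S by (simp add: ev conjv_eq_iff)
  qed
qed

lemma square_value:
  assumes \<nu>: "\<And>f. f \<in> forms 6 \<Longrightarrow> complex_of_real (a \<bullet> \<kappa> f) = (\<Sum>P\<in>zeros. \<nu> P * eval_mpoly f P)"
    and g: "g \<in> forms 3" and T: "T \<subseteq> zeros" "\<And>S. S \<in> zeros - T \<Longrightarrow> \<nu> S * (eval_mpoly g S)\<^sup>2 = 0"
  shows "complex_of_real (a \<bullet> \<kappa> (g * g)) = (\<Sum>S\<in>T. \<nu> S * (eval_mpoly g S)\<^sup>2)"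
proof -
  have "g * g \<in> forms 6" using forms_mult[OF g g] by simp
  then have "complex_of_real (a \<bullet> \<kappa> (g * g)) = (\<Sum>S\<in>zeros. \<nu> S * (eval_mpoly g S)\<^sup>2)"
    by (simp add: \<nu> eval_mult power2_eq_square)
  also have "\<dots> = (\<Sum>S\<in>T. \<nu> S * (eval_mpoly g S)\<^sup>2)"
    using T by (intro sum.mono_neutral_right finite_zeros) auto
  finally show ?thesis .
qed

lemma square_root_exists: "\<exists>y :: complex. y\<^sup>2 = w"
  by (intro exI[of _ "csqrt w"]) simp

text \<open>When \<open>P\<close> and its conjugate have weight zero, the values of a cubic there do not matter,
  and a real cubic can be prescribed at the remaining seven points. A nonreal point among these
  with nonzero weight would give a square of value -2, so only real points carry weight; their
  weights are values at squares, hence nonnegative. As \<open>p\<close> is nonnegative at real points, so is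
  the functional at \<open>p\<close>.\<close>

lemma weight_nonzero:
  assumes \<nu>: "\<And>f. f \<in> forms 6 \<Longrightarrow> complex_of_real (a \<bullet> \<kappa> f) = (\<Sum>P\<in>zeros. \<nu> P * eval_mpoly f P)"
    and sym: "\<And>P. \<nu> (conjv P) = cnj (\<nu> P)"
    and psd: "\<And>g. g \<in> forms 3 \<Longrightarrow> 0 \<le> a \<bullet> \<kappa> (g * g)"
    and p: "p \<in> psd_forms 3" "a \<bullet> \<kappa> p < 0"
    and P: "P \<in> zeros" "conjv P \<noteq> P"
  shows "\<nu> P \<noteq> 0"
proof
  assume nu0: "\<nu> P = 0"
  then have nuc: "\<nu> (conjv P) = 0" by (simp add: sym)
  have pf: "p \<in> forms 6" and pp: "\<And>x :: real ^ 3. eval_mpoly p x \<ge> 0" using p(1) by (simp_all add: psd_forms_def)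
  have nonreal0: "\<nu> R = 0" if R: "R \<in> zeros" "conjv R \<noteq> R" for R
  proof (cases "R = P \<or> R = conjv P")
    case True
    then show ?thesis using nu0 nuc by auto
  next
    case False
    show ?thesis
    proof (rule ccontr)
      assume nz: "\<nu> R \<noteq> 0"
      \<comment> \<open>With \<open>\<nu> R y\<^sup>2 = -1\<close>, the pair contributes -2 to the value at the square.\<close>
      obtain y where y: "y\<^sup>2 = - 1 / \<nu> R" using square_root_exists by blast
      obtain g where g: "g \<in> forms 3" "\<And>S. S \<in> zeros \<Longrightarrow> S \<noteq> P \<Longrightarrow> S \<noteq> conjv P \<Longrightarrow> 
         eval_mpoly g S = (if S = R then y else 0) + (if S = conjv R then cnj y else 0)"
        using real_cubic_interpolation[OF P(1) R(1)] False by metis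
      have "complex_of_real (a \<bullet> \<kappa> (g * g)) = (\<Sum>S\<in>{R, conjv R}. \<nu> S * (eval_mpoly g S)\<^sup>2)"
      proof (rule square_value[OF \<nu> g(1)])
        show "{R, conjv R} \<subseteq> zeros" using R zeros_conjv by simp
        fix S assume "S \<in> zeros - {R, conjv R}"
        then show "\<nu> S * (eval_mpoly g S)\<^sup>2 = 0" using g(2)[of S] nu0 nuc by (cases "S = P \<or> S = conjv P") auto
      qed
      also have "\<dots> = \<nu> R * y\<^sup>2 + cnj (\<nu> R) * (cnj y)\<^sup>2"
      proof -
        have "conjv R \<noteq> P" "conjv R \<noteq> conjv P" "conjv R \<in> zeros" using False R zeros_conjv by (auto simp: conjv_eq_iff)
        then have "eval_mpoly g R = y" "eval_mpoly g (conjv R) = cnj y" using g(2)[of R] g(2)[of "conjv R"] False R by auto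
        then show ?thesis using R(2) by (auto simp: sym)
      qed
      also have "\<dots> = \<nu> R * y\<^sup>2 + cnj (\<nu> R * y\<^sup>2)" by simp
      also have "\<dots> = - 2" using nz by (simp add: y)
      finally have "complex_of_real (a \<bullet> \<kappa> (g * g)) = of_real (- 2)" by simp
      then have "a \<bullet> \<kappa> (g * g) = - 2" by (simp only: of_real_eq_iff)
      then show False using psd[OF g(1)] by simp
    qed
  qed
  have real_pos: "Re (\<nu> R * eval_mpoly p R) \<ge> 0" if R: "R \<in> zeros" for R
  proof (cases "conjv R = R")
    case False
    then show ?thesis using nonreal0[OF R] by simp
  next
    case True
    have ne: "R \<noteq> P" "R \<noteq> conjv P" using True P by (auto simp: conjv_eq_iff)
    \<comment> \<open>The value one half is doubled because \<open>R\<close> is its own conjugate.\<close>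
    obtain g where g: "g \<in> forms 3" "\<And>S. S \<in> zeros \<Longrightarrow> S \<noteq> P \<Longrightarrow> S \<noteq> conjv P \<Longrightarrow> 
       eval_mpoly g S = (if S = R then 1/2 else 0) + (if S = conjv R then cnj (1/2) else 0)"
      using real_cubic_interpolation[OF P(1) R ne(1)] by metis
    have "complex_of_real (a \<bullet> \<kappa> (g * g)) = (\<Sum>S\<in>{R}. \<nu> S * (eval_mpoly g S)\<^sup>2)"
    proof (rule square_value[OF \<nu> g(1)])
      show "{R} \<subseteq> zeros" using R by simp
      fix S assume "S \<in> zeros - {R}"
      then show "\<nu> S * (eval_mpoly g S)\<^sup>2 = 0" using g(2)[of S] nu0 nuc True by (cases "S = P \<or> S = conjv P") auto
    qed
    also have "\<dots> = \<nu> R" using g(2)[OF R ne] True by simp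
    finally have nuR: "\<nu> R = complex_of_real (a \<bullet> \<kappa> (g * g))" by simp
    define x where "x = (\<chi> i. Re (R $ i))"
    have "cnj (R $ i) = R $ i" for i using True by (metis conjv_nth)
    then have "R = cvec x" by (simp add: vec_eq_iff cvec_def x_def complex_eq_iff)
    then have "eval_mpoly p R = complex_of_real (eval_mpoly p x)" by (simp add: eval_cvec)
    then show ?thesis using nuR psd[OF g(1)] pp[of x] by simp
  qed
  have "a \<bullet> \<kappa> p = Re (\<Sum>R\<in>zeros. \<nu> R * eval_mpoly p R)" by (simp flip: \<nu>[OF pf])
  also have "\<dots> \<ge> 0" unfolding Re_sum by (intro sum_nonneg real_pos)
  finally show False using p(2) by simp
qed

text \<open>The number of nonreal zeros is even and nine is odd, so there is a real zero \<open>Q\<close>. Suppose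
  there are two conjugate pairs. For each pair there is a real cubic that vanishes at all other
  zeros except \<open>Q\<close> and whose square has a negative contribution from the pair. A combination of
  the two cubics that also vanishes at \<open>Q\<close> has a square with negative value.\<close>

theorem card_nonreal_le_2:
  assumes psd: "\<And>g. g \<in> forms 3 \<Longrightarrow> 0 \<le> a \<bullet> \<kappa> (g * g)"
    and p: "p \<in> psd_forms 3" "a \<bullet> \<kappa> p < 0"
  shows "card {P \<in> zeros. conjv P \<noteq> P} \<le> 2"
proof (rule ccontr)
  assume big: "\<not> ?thesis"
  obtain \<nu> where \<nu>: "\<And>f. f \<in> forms 6 \<Longrightarrow> complex_of_real (a \<bullet> \<kappa> f) = (\<Sum>P\<in>zeros. \<nu> P * eval_mpoly f P)"
    and sym: "\<And>P. \<nu> (conjv P) = cnj (\<nu> P)" using symmetric_representation by blast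
  have nz: "\<nu> P \<noteq> 0" if "P \<in> zeros" "conjv P \<noteq> P" for P
    by (rule weight_nonzero[OF \<nu> sym psd p that])
  define NR where "NR = {P \<in> zeros. conjv P \<noteq> P}"
  \<comment> \<open>One point from each conjugate pair; as \<open>P\<^sub>3 = 1\<close>, the imaginary parts of the first two
    coordinates decide.\<close>
  define A where "A = {P \<in> NR. Im (P $ 1) > 0 \<or> (Im (P $ 1) = 0 \<and> Im (P $ 2) > 0)}"
  have fin: "finite NR" "finite A" using finite_zeros by (simp_all add: NR_def A_def)
  have disj: "A \<inter> conjv ` A = {}" by (auto simp: A_def)
  have un: "NR = A \<union> conjv ` A"
  proof
    show "A \<union> conjv ` A \<subseteq> NR" by (auto simp: A_def NR_def zeros_conjv conjv_eq_iff)
    show "NR \<subseteq> A \<union> conjv ` A"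
    proof
      fix P assume P: "P \<in> NR"
      have "P \<in> A \<or> conjv P \<in> A"
      proof (rule ccontr)
        assume "\<not> ?thesis"
        moreover have "conjv P \<in> NR" using P by (auto simp: NR_def zeros_conjv conjv_eq_iff)
        ultimately have "Im (P $ 1) = 0" "Im (P $ 2) = 0" using P by (auto simp: A_def)
        moreover have "P $ 3 = 1" using P by (simp add: NR_def zeros_def)
        ultimately have "conjv P = P" by (simp add: vec_eq_iff forall_3 complex_eq_iff)
        then show False using P by (simp add: NR_def)
      qed
      then show "P \<in> A \<union> conjv ` A" by (metis UnCI conjv_conjv image_eqI)
    qed
  qed
  have "inj_on conjv A" by (rule inj_onI) (metis conjv_conjv)
  then have cNR: "card NR = 2 * card A" using fin disj unfolding un by (subst card_Un_disjoint) (auto simp: card_image)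
  then have "card NR \<noteq> card zeros" unfolding card_zeros by presburger
  then have "NR \<noteq> zeros" by blast
  then obtain Q where Q: "Q \<in> zeros" "conjv Q = Q" by (auto simp: NR_def)
  have "card A \<ge> 2" using big cNR by (simp add: NR_def)
  then obtain P1 P2 where PA: "P1 \<in> A" "P2 \<in> A" "P1 \<noteq> P2"
    by (metis card_2_iff' card_le_Suc0_iff_eq fin(2) not_less_eq_eq numeral_2_eq_2)
  have c12: "conjv P1 \<noteq> P2" "conjv P1 \<notin> A" "conjv P2 \<notin> A" using PA disj by (auto simp: conjv_eq_iff)
  have PZ: "P1 \<in> zeros" "P2 \<in> zeros" "conjv P1 \<noteq> P1" "conjv P2 \<noteq> P2" using PA by (auto simp: A_def NR_def)
  have ne: "P1 \<noteq> Q" "P2 \<noteq> Q" using PZ Q by auto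
  obtain y1 where y1: "y1\<^sup>2 = - 1 / \<nu> P1" using square_root_exists by blast
  obtain y2 where y2: "y2\<^sup>2 = - 1 / \<nu> P2" using square_root_exists by blast
  obtain g1 where g1: "g1 \<in> forms 3" "\<And>S. S \<in> zeros \<Longrightarrow> S \<noteq> Q \<Longrightarrow> S \<noteq> conjv Q \<Longrightarrow> 
     eval_mpoly g1 S = (if S = P1 then y1 else 0) + (if S = conjv P1 then cnj y1 else 0)"
    using real_cubic_interpolation[OF Q(1) PZ(1) ne(1)] by metis
  obtain g2 where g2: "g2 \<in> forms 3" "\<And>S. S \<in> zeros \<Longrightarrow> S \<noteq> Q \<Longrightarrow> S \<noteq> conjv Q \<Longrightarrow> 
     eval_mpoly g2 S = (if S = P2 then y2 else 0) + (if S = conjv P2 then cnj y2 else 0)"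
    using real_cubic_interpolation[OF Q(1) PZ(2) ne(2)] by metis
  have "cnj (eval_mpoly g Q) = eval_mpoly g Q" for g using eval_conjv[of g Q] Q(2) by simp
  then have real: "eval_mpoly g Q = of_real (Re (eval_mpoly g Q))" for g by (simp add: complex_eq_iff)
  define t1 where "t1 = Re (eval_mpoly g1 Q)"
  define t2 where "t2 = Re (eval_mpoly g2 Q)"
  \<comment> \<open>A nontrivial relation between the values at \<open>Q\<close>.\<close>
  define s1 where "s1 = (if t1 = 0 then 1 else t2)"
  define s2 where "s2 = (if t1 = 0 then 0 else - t1)"
  have s: "s1 * t1 + s2 * t2 = 0" "s1\<^sup>2 + s2\<^sup>2 > 0" by (auto simp: s1_def s2_def sum_power2_gt_zero_iff)
  define g where "g = scl s1 g1 + scl s2 g2"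
  have g: "g \<in> forms 3" using g1 g2 by (simp add: g_def)
  have gS: "eval_mpoly g S = of_real s1 * eval_mpoly g1 S + of_real s2 * eval_mpoly g2 S" for S :: "complex ^ 3"
    by (simp add: g_def eval_add eval_scl)
  have "eval_mpoly g Q = of_real (s1 * t1 + s2 * t2)" unfolding gS
    by (subst (1 2) real) (simp add: t1_def t2_def)
  then have gQ: "eval_mpoly g Q = 0" using s by simp
  have cQ: "conjv P1 \<noteq> Q" "conjv P2 \<noteq> Q" using ne Q by (auto simp: conjv_eq_iff)
  have d: "P1 \<noteq> conjv P2" "conjv P1 \<noteq> conjv P2" using c12 PA by (auto simp: conjv_eq_iff)
  note D = ne PZ(3,4) PA(3) c12(1) cQ d
  note D = D D[THEN not_sym]
  have "complex_of_real (a \<bullet> \<kappa> (g * g)) = (\<Sum>S\<in>{P1, conjv P1, P2, conjv P2}. \<nu> S * (eval_mpoly g S)\<^sup>2)"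
  proof (rule square_value[OF \<nu> g])
    show "{P1, conjv P1, P2, conjv P2} \<subseteq> zeros" using PZ zeros_conjv by simp
    fix S assume S: "S \<in> zeros - {P1, conjv P1, P2, conjv P2}"
    show "\<nu> S * (eval_mpoly g S)\<^sup>2 = 0"
    proof (cases "S = Q")
      case True then show ?thesis by (simp add: gQ)
    next
      case False
      then show ?thesis using S g1(2)[of S] g2(2)[of S] Q by (simp add: gS)
    qed
  qed
  also have "\<dots> = \<nu> P1 * (eval_mpoly g P1)\<^sup>2 + \<nu> (conjv P1) * (eval_mpoly g (conjv P1))\<^sup>2 +
     (\<nu> P2 * (eval_mpoly g P2)\<^sup>2 + \<nu> (conjv P2) * (eval_mpoly g (conjv P2))\<^sup>2)"
    using D by simp
  also have "eval_mpoly g P1 = of_real s1 * y1" using g1(2)[OF PZ(1)] g2(2)[OF PZ(1)] D Q(2) by (simp add: gS)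
  also have "eval_mpoly g P2 = of_real s2 * y2" using g1(2)[OF PZ(2)] g2(2)[OF PZ(2)] D Q(2) by (simp add: gS)
  also have "eval_mpoly g (conjv P1) = cnj (of_real s1 * y1)" 
    using g1(2)[OF zeros_conjv[OF PZ(1)]] g2(2)[OF zeros_conjv[OF PZ(1)]] D Q(2) by (simp add: gS)
  also have "eval_mpoly g (conjv P2) = cnj (of_real s2 * y2)" 
    using g1(2)[OF zeros_conjv[OF PZ(2)]] g2(2)[OF zeros_conjv[OF PZ(2)]] D Q(2) by (simp add: gS)
  also have "\<nu> P1 * (of_real s1 * y1)\<^sup>2 + \<nu> (conjv P1) * (cnj (of_real s1 * y1))\<^sup>2 + (\<nu> P2 * (of_real s2 * y2)\<^sup>2 + \<nu> (conjv P2) * (cnj (of_real s2 * y2))\<^sup>2)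
     = (of_real s1)\<^sup>2 * (\<nu> P1 * y1\<^sup>2 + cnj (\<nu> P1 * y1\<^sup>2)) + (of_real s2)\<^sup>2 * (\<nu> P2 * y2\<^sup>2 + cnj (\<nu> P2 * y2\<^sup>2))"
    by (simp add: sym power_mult_distrib algebra_simps)
  also have "\<dots> = of_real (- 2 * (s1\<^sup>2 + s2\<^sup>2))" using nz PZ by (simp add: y1 y2 algebra_simps)
  finally have "a \<bullet> \<kappa> (g * g) = - 2 * (s1\<^sup>2 + s2\<^sup>2)" by (simp only: of_real_eq_iff)
  then show False using psd[OF g] s(2) by simp
qed

end

section \<open>The certificate\<close>

lemma affine_rep_scale:
  fixes z P :: "complex ^ 3"
  assumes "affine_rep z \<gamma>" "affine_rep P \<gamma>"
  obtains k where "k \<noteq> 0" "z = k *s P"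
proof -
  have "z \<in> vec.span {P}" using assms vec.span_base[of z "{z}"] by (simp add: affine_rep_def)
  then obtain k where "z = k *s P" by (auto simp: vec.span_singleton)
  moreover have "k \<noteq> 0" using \<open>z = k *s P\<close> assms by (auto simp: affine_rep_def)
  ultimately show ?thesis using that by blast
qed

context real_pencil
begin

lemma affine_rep_zeros: "P \<in> zeros \<Longrightarrow> affine_rep P (vec.span {P})"
  by (auto simp: affine_rep_def zeros_def)

lemma inj_span_zeros: "inj_on (\<lambda>P. vec.span {P}) zeros"
proof (rule inj_onI)
  fix P R assume PR: "P \<in> zeros" "R \<in> zeros" "vec.span {P} = vec.span {R}"
  then have "affine_rep P (vec.span {R})" using affine_rep_zeros by metis
  then obtain k where k: "P = k *s R" using affine_rep_scale[OF _ affine_rep_zeros[OF PR(2)]] by blast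
  have "k = 1" using arg_cong[OF k, of "\<lambda>v. v $ 3"] PR by (simp add: zeros_def)
  then show "P = R" using k by (simp add: vec_eq_iff)
qed

lemma common_zeros_eq: "common_zeros q1 q2 = (\<lambda>P. vec.span {P}) ` zeros"
proof
  show "(\<lambda>P. vec.span {P}) ` zeros \<subseteq> common_zeros q1 q2"
  proof
    fix \<gamma> assume "\<gamma> \<in> (\<lambda>P. vec.span {P}) ` zeros"
    then obtain P where P: "P \<in> zeros" "\<gamma> = vec.span {P}" by blast
    have "\<gamma> \<in> proj_space" using affine_rep_zeros[OF P(1)] P(2) by (auto simp: proj_space_def)
    moreover have "eval_mpoly q1 z = 0 \<and> eval_mpoly q2 z = 0" if "z \<in> \<gamma>" for z
      using that P cform_scaleC[OF q1] cform_scaleC[OF q2] by (auto simp: vec.span_singleton zeros_def)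
    ultimately show "\<gamma> \<in> common_zeros q1 q2" by (simp add: common_zeros_def)
  qed
  show "common_zeros q1 q2 \<subseteq> (\<lambda>P. vec.span {P}) ` zeros"
  proof
    fix \<gamma> assume g: "\<gamma> \<in> common_zeros q1 q2"
    then obtain z where z: "z \<noteq> 0" "\<gamma> = vec.span {z}" by (auto simp: common_zeros_def proj_space_def affine_rep_def)
    have "z \<in> \<gamma>" using z(2) vec.span_base[of z "{z}"] by simp
    then have 0: "eval_mpoly q1 z = 0" "eval_mpoly q2 z = 0" using g by (auto simp: common_zeros_def)
    then have z3: "z $ 3 \<noteq> 0" using good[OF z(1)] by blast
    define P where "P = (1 / z $ 3) *s z"
    have "P \<in> zeros" using 0 z3 cform_scaleC[OF q1] cform_scaleC[OF q2] by (simp add: zeros_def P_def)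
    moreover have "vec.span {P} = vec.span {z}"
    proof -
      have "k *s z = (k * z $ 3) *s P" "k *s P = (k / z $ 3) *s z" for k using z3 by (simp_all add: P_def vec_eq_iff)
      then have "range (\<lambda>k. k *s P) \<subseteq> range (\<lambda>k. k *s z)" "range (\<lambda>k. k *s z) \<subseteq> range (\<lambda>k. k *s P)"
        by (metis image_subsetI rangeI)+
      then show ?thesis by (simp add: vec.span_singleton)
    qed
    ultimately show "\<gamma> \<in> (\<lambda>P. vec.span {P}) ` zeros" using z(2) by blast
  qed
qed

end

lemma functional_nonneg_sos:
  assumes psd: "\<And>q. q \<in> forms 3 \<Longrightarrow> 0 \<le> a \<bullet> \<kappa> (q * q)" and r: "r \<in> sos_forms 3"
  shows "0 \<le> a \<bullet> \<kappa> r"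
proof -
  obtain k :: nat and q where q: "\<forall>i<k. q i \<in> forms 3" "r = (\<Sum>i<k. (q i)\<^sup>2)" using r unfolding sos_forms_def by blast
  have "\<kappa> r = (\<Sum>i<k. \<kappa> ((q i)\<^sup>2))" unfolding q(2)
    by (rule \<kappa>_sum)
  then show ?thesis using psd q(1) by (auto simp: inner_sum_right power2_eq_square intro!: sum_nonneg)
qed

theorem theorem1p1:
  fixes p :: "3 real_mpoly"
  assumes "p \<in> psd_forms 3" and "p \<notin> sos_forms 3"
  shows "\<exists>q1 \<in> forms 3. \<exists>q2 \<in> forms 3. \<exists>\<gamma> :: nat \<Rightarrow> (complex ^ 3) set.
    bij_betw \<gamma> {1..9} (common_zeros q1 q2) \<and>
    (\<forall>z :: nat \<Rightarrow> complex ^ 3. (\<forall>i\<in>{1..9}. affine_rep (z i) (\<gamma> i)) \<longrightarrow>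
      (\<exists>(l :: 3 real_mpoly \<Rightarrow> real) (\<mu> :: nat \<Rightarrow> complex).
        linear_functional_on (forms 6) l \<and>
        (\<forall>f\<in>forms 6. complex_of_real (l f) = (\<Sum>i=1..9. \<mu> i * eval_mpoly f (z i))) \<and>
        (\<forall>r\<in>sos_forms 3. l r \<ge> 0) \<and>
        l p < 0)) \<and>
    card {i\<in>{1..9}. \<not> real_proj_point (\<gamma> i)} \<le> 2"
proof -
  obtain a where a: "a \<bullet> \<kappa> p < 0" "\<And>q. q \<in> forms 3 \<Longrightarrow> 0 \<le> a \<bullet> \<kappa> (q * q)"
    "\<And>z :: complex ^ 3. z \<noteq> 0 \<Longrightarrow> \<exists>q\<in>forms 3. (\<forall>r\<in>forms 3. a \<bullet> \<kappa> (q * r) = 0) \<and> eval_mpoly q z \<noteq> 0"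
    using separating_functional_base_free[OF assms] by blast
  define K where "K = {q \<in> forms 3. \<forall>r\<in>forms 3. a \<bullet> \<kappa> (q * r) = 0}"
  have "\<exists>q1\<in>K. \<exists>q2\<in>K. transversal_pencil (eval_mpoly q1) (eval_mpoly q2)"
  proof (rule transversal_pencil_exists)
    show "K \<subseteq> forms 3" "0 \<in> K" by (auto simp: K_def)
    show "f + g \<in> K" if "f \<in> K" "g \<in> K" for f g
      using that by (simp add: K_def distrib_right \<kappa>_add inner_add_right)
    show "scl c f \<in> K" if "f \<in> K" for c f
      using that by (simp add: K_def scl_mult \<kappa>_scl)
    show "\<exists>q\<in>K. eval_mpoly q v \<noteq> 0" if "v \<noteq> 0" for v :: "complex ^ 3" using a(3)[OF that] by (auto simp: K_def)
  qed
  then obtain q1 q2 where q: "q1 \<in> K" "q2 \<in> K" "transversal_pencil (eval_mpoly q1) (eval_mpoly q2)" by blast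
  interpret transversal_pencil "eval_mpoly q1" "eval_mpoly q2" by (rule q(3))
  interpret real_pencil q1 q2 a by unfold_locales (use q in \<open>auto simp: K_def\<close>)
  obtain e where e: "bij_betw e {1..9::nat} zeros" using ex_bij_betw_nat_finite_1[OF finite_zeros] card_zeros by auto
  have eZ: "e i \<in> zeros" if "i \<in> {1..9}" for i using e that by (auto simp: bij_betw_def)
  define \<gamma> where "\<gamma> i = vec.span {e i}" for i
  have bij: "bij_betw \<gamma> {1..9} (common_zeros q1 q2)"
  proof -
    have "bij_betw (\<lambda>P. vec.span {P}) zeros (common_zeros q1 q2)"
      unfolding common_zeros_eq by (rule inj_on_imp_bij_betw[OF inj_span_zeros])
    from bij_betw_trans[OF e this] show ?thesis by (simp add: \<gamma>_def[abs_def] o_def)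
  qed
  obtain \<nu> where \<nu>: "\<And>f. f \<in> forms 6 \<Longrightarrow> complex_of_real (a \<bullet> \<kappa> f) = (\<Sum>P\<in>zeros. \<nu> P * eval_mpoly f P)"
    using representation_exists by blast
  have cert: "\<exists>(l :: 3 real_mpoly \<Rightarrow> real) (\<mu> :: nat \<Rightarrow> complex).
        linear_functional_on (forms 6) l \<and>
        (\<forall>f\<in>forms 6. complex_of_real (l f) = (\<Sum>i=1..9. \<mu> i * eval_mpoly f (z i))) \<and>
        (\<forall>r\<in>sos_forms 3. l r \<ge> 0) \<and> l p < 0" if z: "\<forall>i\<in>{1..9}. affine_rep (z i) (\<gamma> i)" for z
  proof -
    have "\<exists>k. i \<in> {1..9} \<longrightarrow> k \<noteq> 0 \<and> z i = k *s e i" for i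
    proof (cases "i \<in> {1..9}")
      case True
      then have "affine_rep (z i) (vec.span {e i})" using z by (simp add: \<gamma>_def)
      from affine_rep_scale[OF this affine_rep_zeros[OF eZ[OF True]]] show ?thesis by metis
    qed blast
    then have "\<forall>i. \<exists>k. i \<in> {1..9} \<longrightarrow> k \<noteq> 0 \<and> z i = k *s e i" by blast
    from choice[OF this] obtain k where k: "\<And>i. i \<in> {1..9} \<Longrightarrow> k i \<noteq> 0" "\<And>i. i \<in> {1..9} \<Longrightarrow> z i = k i *s e i" by blast
    \<comment> \<open>A sextic at \<open>k P\<close> is \<open>k\<^bsup>6\<^esup>\<close> times its value at \<open>P\<close>.\<close>
    define \<mu> where "\<mu> i = \<nu> (e i) / k i ^ 6" for i
    have "complex_of_real (a \<bullet> \<kappa> f) = (\<Sum>i=1..9. \<mu> i * eval_mpoly f (z i))" if f: "f \<in> forms 6" for f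
    proof -
      have "complex_of_real (a \<bullet> \<kappa> f) = (\<Sum>i=1..9. \<nu> (e i) * eval_mpoly f (e i))"
        unfolding \<nu>[OF f] by (rule sum.reindex_bij_betw[OF e, symmetric])
      also have "\<dots> = (\<Sum>i=1..9. \<mu> i * eval_mpoly f (z i))"
        using k by (intro sum.cong refl) (simp add: \<mu>_def cform_scaleC[OF eval_cform[OF f]])
      finally show ?thesis .
    qed
    moreover have "linear_functional_on (forms 6) (\<lambda>f. a \<bullet> \<kappa> f)"
      by (simp add: linear_functional_on_def \<kappa>_add \<kappa>_scl inner_add_right)
    ultimately show ?thesis using functional_nonneg_sos[OF a(2)] a(1)
      by (intro exI[of _ "\<lambda>f. a \<bullet> \<kappa> f"] exI[of _ \<mu>]) auto
  qed
  have "card {i\<in>{1..9}. \<not> real_proj_point (\<gamma> i)} \<le> card {P \<in> zeros. conjv P \<noteq> P}"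
  proof (rule card_inj_on_le)
    show "inj_on e {i \<in> {1..9}. \<not> real_proj_point (\<gamma> i)}" using e by (auto simp: bij_betw_def inj_on_def)
    show "finite {P \<in> zeros. conjv P \<noteq> P}" using finite_zeros by simp
    show "e ` {i \<in> {1..9}. \<not> real_proj_point (\<gamma> i)} \<subseteq> {P \<in> zeros. conjv P \<noteq> P}"
    proof (clarify)
      fix i assume i: "i \<in> {1..9}" "\<not> real_proj_point (\<gamma> i)"
      have "conjv (e i) \<noteq> e i"
      proof
        assume real: "conjv (e i) = e i"
        have "cnj (e i $ j) = e i $ j" for j using real by (metis conjv_nth)
        then have "e i = (\<chi> j. complex_of_real ((\<chi> j. Re (e i $ j)) $ j))" by (simp add: vec_eq_iff complex_eq_iff)
        then have "real_proj_point (\<gamma> i)" unfolding real_proj_point_def \<gamma>_def using affine_rep_zeros[OF eZ[OF i(1)]] by metis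
        then show False using i by blast
      qed
      then show "e i \<in> zeros \<and> conjv (e i) \<noteq> e i" using eZ[OF i(1)] by blast
    qed
  qed
  also have "\<dots> \<le> 2" by (rule card_nonreal_le_2[OF a(2) assms(1) a(1)])
  finally have "card {i\<in>{1..9}. \<not> real_proj_point (\<gamma> i)} \<le> 2" .
  moreover have "q1 \<in> forms 3" "q2 \<in> forms 3" using q by (simp_all add: K_def)
  ultimately show ?thesis using bij cert by blast
qed

end
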